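(* If there is a polynomial-time $\rho$-approximation algorithm for the minimum-ratio $k$-forest problem, then there is a polynomial-time $O(\rho\log^2 m)$-approximation algorithm for the (non-preemptive) Dial-a-Ride problem, where $m$ is the number of demands.
   Context: Minimum-ratio $k$-forest: given an $n$-vertex metric space $(V,d)$, pairs $\{s_i,t_i\}_{i=1}^m$ and a target $k$, find a tree $T$ (with length $d(T)=\sum_{\{u,v\}\in T}d(u,v)$) that connects at most $k$ pairs (a pair is connected if both endpoints are vertices of $T$), minimizing the ratio of $d(T)$ to the number of pairs connected by $T$. Dial-a-Ride: given an $n$-vertex metric $(V,d)$, a root $r$, $m$ demands $(s_i,t_i)$ and a vehicle capacity $k$, find a minimum-length tour from $r$ back to $r$ that moves each object $i$ from $s_i$ to $t_i$, never carrying more than $k$ objects, and non-preemptively (an object once picked up is only dropped at its destination). *)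

theory Defs
  imports "HOL-Analysis.Analysis" "HOL-Library.Log_Nat"
begin

section \<open>Polynomial time\<close>

text \<open>
  Algorithms are programs of a WHILE language over binary trees whose leaves carry rational
  numbers. Costs are logarithmic: evaluating an expression is charged the bit size of its
  value and of the values of all its subexpressions. Each elementary operation can be carried
  out by a Turing machine in time polynomial in that charge, and no value ever computed is
  larger than the charge for computing it; hence polynomial time in this model is polynomial
  time on Turing machines.
\<close>

datatype val = VNil | VNum rat | VPair val val

definition rat_bits :: "rat \<Rightarrow> nat" where
  "rat_bits q =
     floorlog 2 (nat \<bar>fst (quotient_of q)\<bar>) + floorlog 2 (nat (snd (quotient_of q)))"

fun vsize :: "val \<Rightarrow> nat" where
  "vsize VNil = 1"
| "vsize (VNum q) = 1 + rat_bits q"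
| "vsize (VPair a b) = 1 + vsize a + vsize b"

text \<open>\<open>VNil\<close> is false, every other value is true. Ill-typed operations yield \<open>VNil\<close>.\<close>

definition vbool :: "bool \<Rightarrow> val" where
  "vbool b = (if b then VNum 1 else VNil)"

fun vfst :: "val \<Rightarrow> val" where
  "vfst (VPair a b) = a"
| "vfst _ = VNil"

fun vsnd :: "val \<Rightarrow> val" where
  "vsnd (VPair a b) = b"
| "vsnd _ = VNil"

fun is_vpair :: "val \<Rightarrow> bool" where
  "is_vpair (VPair a b) = True"
| "is_vpair _ = False"

fun vless :: "val \<Rightarrow> val \<Rightarrow> bool" where
  "vless (VNum p) (VNum q) = (p < q)"
| "vless _ _ = False"

fun varith :: "(rat \<Rightarrow> rat \<Rightarrow> rat) \<Rightarrow> val \<Rightarrow> val \<Rightarrow> val" where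
  "varith f (VNum p) (VNum q) = VNum (f p q)"
| "varith f _ _ = VNil"

datatype expr =
    Var nat
  | Const val
  | MkPair expr expr
  | Fst expr
  | Snd expr
  | IsPair expr
  | Eq expr expr
  | Less expr expr
  | Add expr expr
  | Sub expr expr
  | Mul expr expr
  | Div expr expr

type_synonym store = "nat \<Rightarrow> val"

fun eval :: "expr \<Rightarrow> store \<Rightarrow> val" where
  "eval (Var x) s = s x"
| "eval (Const v) s = v"
| "eval (MkPair a b) s = VPair (eval a s) (eval b s)"
| "eval (Fst a) s = vfst (eval a s)"
| "eval (Snd a) s = vsnd (eval a s)"
| "eval (IsPair a) s = vbool (is_vpair (eval a s))"
| "eval (Eq a b) s = vbool (eval a s = eval b s)"
| "eval (Less a b) s = vbool (vless (eval a s) (eval b s))"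
| "eval (Add a b) s = varith (+) (eval a s) (eval b s)"
| "eval (Sub a b) s = varith (-) (eval a s) (eval b s)"
| "eval (Mul a b) s = varith (*) (eval a s) (eval b s)"
| "eval (Div a b) s = varith (/) (eval a s) (eval b s)"

fun ecost :: "expr \<Rightarrow> store \<Rightarrow> nat" where
  "ecost (Var x) s = vsize (s x)"
| "ecost (Const v) s = vsize v"
| "ecost (MkPair a b) s = ecost a s + ecost b s + vsize (eval (MkPair a b) s)"
| "ecost (Fst a) s = ecost a s + vsize (eval (Fst a) s)"
| "ecost (Snd a) s = ecost a s + vsize (eval (Snd a) s)"
| "ecost (IsPair a) s = ecost a s + vsize (eval (IsPair a) s)"
| "ecost (Eq a b) s = ecost a s + ecost b s + vsize (eval (Eq a b) s)"
| "ecost (Less a b) s = ecost a s + ecost b s + vsize (eval (Less a b) s)"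
| "ecost (Add a b) s = ecost a s + ecost b s + vsize (eval (Add a b) s)"
| "ecost (Sub a b) s = ecost a s + ecost b s + vsize (eval (Sub a b) s)"
| "ecost (Mul a b) s = ecost a s + ecost b s + vsize (eval (Mul a b) s)"
| "ecost (Div a b) s = ecost a s + ecost b s + vsize (eval (Div a b) s)"

text \<open>
  \<open>Call x p e\<close> is a non-recursive macro: it runs \<open>p\<close>, charging its full cost, in a fresh store
  with the value of \<open>e\<close> as input, and assigns the output to \<open>x\<close>. Input and output are passed
  in variable 0.
\<close>

datatype com =
    Skip
  | Assign nat expr
  | Seq com com
  | If expr com com
  | While expr com
  | Call nat com expr

definition init_store :: "val \<Rightarrow> store" where
  "init_store v = (\<lambda>_. VNil)(0 := v)"

inductive exec :: "com \<Rightarrow> store \<Rightarrow> nat \<Rightarrow> store \<Rightarrow> bool" where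
  exec_Skip: "exec Skip s 1 s"
| exec_Assign: "exec (Assign x e) s (1 + ecost e s) (s(x := eval e s))"
| exec_Seq: "exec c1 s t1 s1 \<Longrightarrow> exec c2 s1 t2 s2 \<Longrightarrow> exec (Seq c1 c2) s (1 + t1 + t2) s2"
| exec_IfTrue: "eval e s \<noteq> VNil \<Longrightarrow> exec c1 s t s' \<Longrightarrow>
    exec (If e c1 c2) s (1 + ecost e s + t) s'"
| exec_IfFalse: "eval e s = VNil \<Longrightarrow> exec c2 s t s' \<Longrightarrow>
    exec (If e c1 c2) s (1 + ecost e s + t) s'"
| exec_WhileFalse: "eval e s = VNil \<Longrightarrow> exec (While e c) s (1 + ecost e s) s"
| exec_WhileTrue: "eval e s \<noteq> VNil \<Longrightarrow> exec c s t1 s1 \<Longrightarrow> exec (While e c) s1 t2 s2 \<Longrightarrow>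
    exec (While e c) s (1 + ecost e s + t1 + t2) s2"
| exec_Call: "exec c (init_store (eval e s)) t s' \<Longrightarrow>
    exec (Call x c e) s (1 + ecost e s + t) (s(x := s' 0))"

inductive_cases exec_SkipE: "exec Skip s t s'"
inductive_cases exec_AssignE: "exec (Assign x e) s t s'"
inductive_cases exec_SeqE: "exec (Seq c1 c2) s t s'"
inductive_cases exec_IfE: "exec (If e c1 c2) s t s'"
inductive_cases exec_WhileE: "exec (While e c) s t s'"
inductive_cases exec_CallE: "exec (Call x c e) s t s'"

lemma exec_deterministic:
  "exec c s t s' \<Longrightarrow> exec c s u s'' \<Longrightarrow> u = t \<and> s'' = s'"
proof (induction arbitrary: u s'' rule: exec.induct)
  case (exec_Skip s)
  then show ?case by (rule exec_SkipE) simp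
next
  case (exec_Assign x e s)
  then show ?case by (rule exec_AssignE) simp
next
  case (exec_Seq c1 s t1 s1 c2 t2 s2)
  from exec_Seq.prems show ?case
    by (rule exec_SeqE) (auto dest!: exec_Seq.IH)
next
  case (exec_IfTrue e s c1 t s' c2)
  from exec_IfTrue.prems show ?case
    by (rule exec_IfE) (auto simp: exec_IfTrue.hyps(1) dest!: exec_IfTrue.IH)
next
  case (exec_IfFalse e s c2 t s' c1)
  from exec_IfFalse.prems show ?case
    by (rule exec_IfE) (auto simp: exec_IfFalse.hyps(1) dest!: exec_IfFalse.IH)
next
  case (exec_WhileFalse e s c)
  from exec_WhileFalse.prems show ?case
    by (rule exec_WhileE) (auto simp: exec_WhileFalse.hyps)
next
  case (exec_WhileTrue e s c t1 s1 t2 s2)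
  from exec_WhileTrue.prems show ?case
    by (rule exec_WhileE) (auto simp: exec_WhileTrue.hyps(1) dest!: exec_WhileTrue.IH)
next
  case (exec_Call c e s t s' x)
  from exec_Call.prems show ?case
    by (rule exec_CallE) (auto dest!: exec_Call.IH)
qed

definition computes_in :: "com \<Rightarrow> val \<Rightarrow> val \<Rightarrow> nat \<Rightarrow> bool" where
  "computes_in p v w t \<longleftrightarrow> (\<exists>s. exec p (init_store v) t s \<and> s 0 = w)"


section \<open>Approximation algorithms for minimization problems\<close>

record ('i, 's) min_problem =
  is_instance :: "'i \<Rightarrow> bool"
  feasible :: "'i \<Rightarrow> 's \<Rightarrow> bool"
  cost :: "'i \<Rightarrow> 's \<Rightarrow> real"
  enc_inst :: "'i \<Rightarrow> val"
  enc_sol :: "'s \<Rightarrow> val"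

definition opt :: "('i, 's) min_problem \<Rightarrow> 'i \<Rightarrow> real" where
  "opt P I = Inf (cost P I ` {S. feasible P I S})"

text \<open>
  The algorithm must halt within polynomial time on every instance, but its output is only
  constrained on instances that have a feasible solution.
\<close>

definition poly_time_approx ::
    "('i, 's) min_problem \<Rightarrow> ('i \<Rightarrow> real) \<Rightarrow> com \<Rightarrow> bool" where
  "poly_time_approx P \<alpha> A \<longleftrightarrow>
     (\<exists>c::nat. \<forall>I. is_instance P I \<longrightarrow>
        (\<exists>out t. computes_in A (enc_inst P I) out t \<and>
           t \<le> c * vsize (enc_inst P I) ^ c + c \<and>
           ((\<exists>S. feasible P I S) \<longrightarrow>
              (\<exists>S. out = enc_sol P S \<and> feasible P I S \<and> cost P I S \<le> \<alpha> I * opt P I))))"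


section \<open>Encodings\<close>

definition enc_nat :: "nat \<Rightarrow> val" where
  "enc_nat n = VNum (of_nat n)"

fun enc_list :: "('a \<Rightarrow> val) \<Rightarrow> 'a list \<Rightarrow> val" where
  "enc_list f [] = VNil"
| "enc_list f (x # xs) = VPair (f x) (enc_list f xs)"

definition enc_pair :: "('a \<Rightarrow> val) \<Rightarrow> ('b \<Rightarrow> val) \<Rightarrow> 'a \<times> 'b \<Rightarrow> val" where
  "enc_pair f g p = VPair (f (fst p)) (g (snd p))"


section \<open>Finite metric spaces with pairs\<close>

text \<open>
  The vertices are \<open>0, \<dots>, n - 1\<close>, where \<open>n\<close> is the number of rows of the distance matrix;
  distances are rational so that instances are finite objects. Pairs may be repeated.
\<close>

record pairs_inst =
  dist_matrix :: "rat list list"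
  pairs :: "(nat \<times> nat) list"
  capacity :: nat

definition nverts :: "('a) pairs_inst_scheme \<Rightarrow> nat" where
  "nverts I = length (dist_matrix I)"

definition npairs :: "('a) pairs_inst_scheme \<Rightarrow> nat" where
  "npairs I = length (pairs I)"

text \<open>The value 0 outside the vertex set is what \<open>Metric_space\<close> requires of a total function.\<close>

definition dst :: "('a) pairs_inst_scheme \<Rightarrow> nat \<Rightarrow> nat \<Rightarrow> real" where
  "dst I u v =
     (if u < nverts I \<and> v < nverts I then real_of_rat (dist_matrix I ! u ! v) else 0)"

definition valid_pairs_inst :: "('a) pairs_inst_scheme \<Rightarrow> bool" where
  "valid_pairs_inst I \<longleftrightarrow>
     (\<forall>row \<in> set (dist_matrix I). length row = nverts I) \<and>
     Metric_space {..<nverts I} (dst I) \<and>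
     (\<forall>(s, t) \<in> set (pairs I). s < nverts I \<and> t < nverts I) \<and>
     1 \<le> capacity I"

definition enc_pairs_inst :: "('a) pairs_inst_scheme \<Rightarrow> val" where
  "enc_pairs_inst I =
     VPair (enc_list (enc_list VNum) (dist_matrix I))
       (VPair (enc_list (enc_pair enc_nat enc_nat) (pairs I)) (enc_nat (capacity I)))"


section \<open>Minimum-ratio k-forest\<close>

text \<open>
  A tree is given by its vertex set \<open>W\<close> and its edge set \<open>F\<close>, where the undirected edge
  \<open>{u, v}\<close> with \<open>u < v\<close> is represented by the pair \<open>(u, v)\<close>. Single vertices are trees.
\<close>

definition is_cycle :: "(nat \<times> nat) set \<Rightarrow> nat list \<Rightarrow> bool" where
  "is_cycle F xs \<longleftrightarrow> 3 \<le> length xs \<and> distinct xs \<and>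
     (\<forall>i < length xs. (xs ! i, xs ! (Suc i mod length xs)) \<in> F \<union> F\<inverse>)"

definition is_tree :: "nat set \<Rightarrow> (nat \<times> nat) set \<Rightarrow> bool" where
  "is_tree W F \<longleftrightarrow> finite W \<and> W \<noteq> {} \<and>
     F \<subseteq> {(u, v). u \<in> W \<and> v \<in> W \<and> u < v} \<and>
     (\<forall>u \<in> W. \<forall>v \<in> W. (u, v) \<in> (F \<union> F\<inverse>)\<^sup>*) \<and>
     (\<nexists>xs. is_cycle F xs)"

definition num_connected :: "('a) pairs_inst_scheme \<Rightarrow> nat set \<Rightarrow> nat" where
  "num_connected I W =
     card {i. i < npairs I \<and> fst (pairs I ! i) \<in> W \<and> snd (pairs I ! i) \<in> W}"

text \<open>A solution lists the vertices and the edges of the tree.\<close>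

type_synonym tree_sol = "nat list \<times> (nat \<times> nat) list"

definition ratio_forest_feasible :: "pairs_inst \<Rightarrow> tree_sol \<Rightarrow> bool" where
  "ratio_forest_feasible I T \<longleftrightarrow>
     is_tree (set (fst T)) (set (snd T)) \<and> set (fst T) \<subseteq> {..<nverts I} \<and>
     1 \<le> num_connected I (set (fst T)) \<and> num_connected I (set (fst T)) \<le> capacity I"

definition tree_length :: "pairs_inst \<Rightarrow> tree_sol \<Rightarrow> real" where
  "tree_length I T = (\<Sum>(u, v) \<in> set (snd T). dst I u v)"

definition min_ratio_k_forest :: "(pairs_inst, tree_sol) min_problem" where
  "min_ratio_k_forest =
     \<lparr> is_instance = valid_pairs_inst,
       feasible = ratio_forest_feasible,
       cost = (\<lambda>I T. tree_length I T / real (num_connected I (set (fst T)))),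
       enc_inst = enc_pairs_inst,
       enc_sol = enc_pair (enc_list enc_nat) (enc_list (enc_pair enc_nat enc_nat)) \<rparr>"


section \<open>Non-preemptive Dial-a-Ride\<close>

record dar_inst = pairs_inst +
  root :: nat

definition valid_dar_inst :: "dar_inst \<Rightarrow> bool" where
  "valid_dar_inst I \<longleftrightarrow> valid_pairs_inst I \<and> root I < nverts I"

datatype event = Move nat | Pick nat | Drop nat

text \<open>
  \<open>serves I v C L es\<close>: starting at vertex \<open>v\<close>, carrying the objects \<open>C\<close> and with every other
  object \<open>i\<close> lying at \<open>L i\<close>, the events \<open>es\<close> can be executed and end with the vehicle back at
  the root and each object at its destination. An object is dropped only at its destination.
\<close>

fun serves :: "dar_inst \<Rightarrow> nat \<Rightarrow> nat set \<Rightarrow> (nat \<Rightarrow> nat) \<Rightarrow> event list \<Rightarrow> bool" where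
  "serves I v C L [] \<longleftrightarrow>
     v = root I \<and> C = {} \<and> (\<forall>i < npairs I. L i = snd (pairs I ! i))"
| "serves I v C L (Move w # es) \<longleftrightarrow> w < nverts I \<and> serves I w C L es"
| "serves I v C L (Pick i # es) \<longleftrightarrow>
     i < npairs I \<and> i \<notin> C \<and> L i = v \<and> card C < capacity I \<and> serves I v (insert i C) L es"
| "serves I v C L (Drop i # es) \<longleftrightarrow>
     i \<in> C \<and> v = snd (pairs I ! i) \<and> serves I v (C - {i}) (L(i := v)) es"

definition dar_feasible :: "dar_inst \<Rightarrow> event list \<Rightarrow> bool" where
  "dar_feasible I es \<longleftrightarrow> serves I (root I) {} (\<lambda>i. fst (pairs I ! i)) es"

fun route_length :: "dar_inst \<Rightarrow> nat \<Rightarrow> event list \<Rightarrow> real" where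
  "route_length I v [] = 0"
| "route_length I v (Move w # es) = dst I v w + route_length I w es"
| "route_length I v (Pick i # es) = route_length I v es"
| "route_length I v (Drop i # es) = route_length I v es"

fun enc_event :: "event \<Rightarrow> val" where
  "enc_event (Move w) = VPair (enc_nat 0) (enc_nat w)"
| "enc_event (Pick i) = VPair (enc_nat 1) (enc_nat i)"
| "enc_event (Drop i) = VPair (enc_nat 2) (enc_nat i)"

definition dial_a_ride :: "(dar_inst, event list) min_problem" where
  "dial_a_ride =
     \<lparr> is_instance = valid_dar_inst,
       feasible = dar_feasible,
       cost = (\<lambda>I es. route_length I (root I) es),
       enc_inst = (\<lambda>I. VPair (enc_pairs_inst I) (enc_nat (root I))),
       enc_sol = enc_list enc_event \<rparr>"


section \<open>Approximation guarantees\<close>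

text \<open>
  A guarantee may depend on the number of vertices, the number of pairs and the capacity.
\<close>

definition guarantee ::
    "(nat \<Rightarrow> nat \<Rightarrow> nat \<Rightarrow> real) \<Rightarrow> ('a) pairs_inst_scheme \<Rightarrow> real" where
  "guarantee \<rho> I = \<rho> (nverts I) (npairs I) (capacity I)"

text \<open>
  The usual reading of \<open>log\<^sup>2 m\<close> inside an O-bound: it coincides with the square of the binary
  logarithm for \<open>m \<ge> 2\<close>, and is 1 instead of 0 (or undefined) for \<open>m \<le> 1\<close>.
\<close>

definition log_sq :: "nat \<Rightarrow> real" where
  "log_sq m = (log 2 (real (max 2 m)))\<^sup>2"

end

theory Submission
  imports Defs
begin

text \<open>
  Greedily serve the remaining requests by approximate minimum-ratio trees: pick up all objects
  along a closed walk around the tree, then drop them along a second one.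

  Such trees are cheap. In an optimal tour every object is carried during one time interval, and at
  most \<open>k\<close> intervals contain a given time. Recursive splitting at median times groups the intervals
  of \<open>m\<close> remaining requests into groups of at most \<open>k\<close>, each living on a stretch of the tour, with
  total length of the stretches \<open>O(log m) OPT\<close>. So some stretch has ratio \<open>O(log m) OPT / m\<close>. Its
  vertex set may join more than \<open>k\<close> pairs, which the forest problem forbids; therefore parallel
  requests beyond the \<open>k\<close>-th are hidden from the forest algorithm, after which every vertex set can be
  trimmed to one joining between a constant fraction of the group and \<open>k\<close> pairs. This leaves the
  number of vertices and the capacity unchanged, so the guarantee \<open>\<rho>\<close> need not be monotone in them.
  Summing the ratios over the greedy steps gives another factor \<open>O(log m)\<close>.

  The trees are reached along a backbone tour through all sources, built by inserting each source
  after the nearest earlier one. This online construction costs \<open>O(log m) OPT\<close>.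

  Polynomial running time is derived compositionally: polynomial-time functions on encoded data are
  closed under iteration over lists as long as the intermediate values stay polynomially bounded.
\<close>

section \<open>Polynomial bounds\<close>

text \<open>The trees need not meet the root or one another, and the forest problem does not charge
  for reaching them. Each tree joins a request and so contains a source; a tour through all sources
  therefore reaches every tree, and since any feasible tour visits all sources, such a backbone is
  comparable with the optimum. Two walks are made around each tree because a destination may come
  before its source; the capacity suffices because the tree joins at most \<open>k\<close> of the
  visible pairs.

  The forest algorithm is specified only on instances that have a feasible solution. Polynomial time
  is therefore stated relative to a domain, and the greedy invariant shows that all queries stay in
  it. Decoding the answers gives a function \<open>orc\<close>, so that running time and
  approximation are proved about one and the same function \<open>dar orc\<close>.

  Costs are compared with an arbitrary feasible tour instead of an optimal one, because
  \<open>opt\<close> is an infimum.\<close>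

definition polyb :: "(nat \<Rightarrow> nat) \<Rightarrow> bool" where
  "polyb f \<longleftrightarrow> (\<exists>c. \<forall>n. f n \<le> (n + 2) ^ c)"

lemma polyb_const [intro]: "polyb (\<lambda>n. k)"
proof -
  have "k \<le> (n + 2) ^ k" for n :: nat
  proof -
    have "k \<le> 2 ^ k" by (simp add: less_imp_le)
    also have "\<dots> \<le> (n + 2) ^ k" by (intro power_mono) auto
    finally show ?thesis .
  qed
  then show ?thesis unfolding polyb_def by blast
qed

lemma polyb_id [intro]: "polyb (\<lambda>n. n)"
  unfolding polyb_def by (intro exI[of _ 1]) auto

text \<open>The base \<open>n + 2\<close> is at least 2, so a sum of two powers fits into the next
  power. This lets a single exponent describe every polynomial bound.\<close>

lemma polyb_add [intro]:
  assumes "polyb f" "polyb g"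
  shows "polyb (\<lambda>n. f n + g n)"
proof -
  obtain c d where c: "\<And>n. f n \<le> (n + 2) ^ c" and d: "\<And>n. g n \<le> (n + 2) ^ d"
    using assms unfolding polyb_def by blast
  have "f n + g n \<le> (n + 2) ^ (max c d + 1)" for n
  proof -
    have "f n \<le> (n + 2) ^ max c d"
      using c[of n] by (rule order_trans) (intro power_increasing, auto)
    moreover have "g n \<le> (n + 2) ^ max c d"
      using d[of n] by (rule order_trans) (intro power_increasing, auto)
    ultimately show ?thesis by (simp add: algebra_simps)
  qed
  then show ?thesis unfolding polyb_def by blast
qed

lemma polyb_mult [intro]:
  assumes "polyb f" "polyb g"
  shows "polyb (\<lambda>n. f n * g n)"
proof -
  obtain c d where c: "\<And>n. f n \<le> (n + 2) ^ c" and d: "\<And>n. g n \<le> (n + 2) ^ d"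
    using assms unfolding polyb_def by blast
  have "f n * g n \<le> (n + 2) ^ (c + d)" for n
    unfolding power_add by (intro mult_mono c d) auto
  then show ?thesis unfolding polyb_def by blast
qed

lemma polyb_power [intro]: "polyb f \<Longrightarrow> polyb (\<lambda>n. f n ^ k)"
  by (induction k) (auto intro: polyb_const)

section \<open>Typed encodings\<close>

text \<open>With encodings attached to types, closure properties speak of ordinary functions.
  Injectivity makes the comparison of trees by \<open>Eq\<close> decide equality of the encoded
  objects.\<close>

class enc =
  fixes encode :: "'a \<Rightarrow> val"
  assumes encode_inj: "encode x = encode y \<longleftrightarrow> x = y"

instantiation nat :: enc
begin
definition encode_nat :: "nat \<Rightarrow> val" where "encode_nat = enc_nat"
instance by standard (simp add: encode_nat_def enc_nat_def)
end

instantiation rat :: enc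
begin
definition encode_rat :: "rat \<Rightarrow> val" where "encode_rat = VNum"
instance by standard (simp add: encode_rat_def)
end

instantiation bool :: enc
begin
definition encode_bool :: "bool \<Rightarrow> val" where "encode_bool = vbool"
instance by standard (auto simp: encode_bool_def vbool_def)
end

instantiation prod :: (enc, enc) enc
begin
definition encode_prod :: "'a \<times> 'b \<Rightarrow> val" where "encode_prod = enc_pair encode encode"
instance by standard (auto simp: encode_prod_def enc_pair_def encode_inj prod_eq_iff)
end

instantiation list :: (enc) enc
begin
definition encode_list :: "'a list \<Rightarrow> val" where "encode_list = enc_list encode"
instance
proof
  fix x y :: "'a list"
  show "encode x = encode y \<longleftrightarrow> x = y"
    unfolding encode_list_def
  proof (induction x arbitrary: y)
    case Nil
    then show ?case by (cases y) auto
  next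
    case (Cons a x)
    then show ?case by (cases y) (auto simp: encode_inj)
  qed
qed
end

lemma encode_Pair [simp]: "encode (a, b) = VPair (encode a) (encode b)"
  by (simp add: encode_prod_def enc_pair_def)

lemma encode_Nil [simp]: "encode [] = VNil"
  by (simp add: encode_list_def)

lemma encode_Cons [simp]: "encode (x # xs) = VPair (encode x) (encode xs)"
  by (simp add: encode_list_def)

definition sz :: "'a::enc \<Rightarrow> nat" where
  "sz a = vsize (encode a)"

lemma vsize_pos: "1 \<le> vsize v"
  by (cases v) auto

lemma sz_pos: "1 \<le> sz a"
  unfolding sz_def by (rule vsize_pos)

lemma sz_Pair [simp]: "sz (a, b) = 1 + sz a + sz b"
  by (simp add: sz_def)

lemma sz_Nil [simp]: "sz [] = 1"
  by (simp add: sz_def)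

lemma sz_Cons [simp]: "sz (x # xs) = 1 + sz x + sz xs"
  by (simp add: sz_def)

lemma sz_append: "sz (xs @ ys) + 1 = sz xs + sz ys"
  by (induction xs) auto

lemma sz_bool: "sz (b :: bool) \<le> 3"
proof -
  have "rat_bits 1 = 2" by (simp add: rat_bits_def compute_floorlog)
  then show ?thesis by (auto simp: sz_def encode_bool_def vbool_def)
qed

lemma sz_Suc: "sz (Suc n) \<le> sz n + 1"
proof -
  have q: "quotient_of (of_nat m) = (int m, 1)" for m
    using quotient_of_int[of "int m"] by simp
  have "floorlog 2 (Suc n) \<le> floorlog 2 n + 1"
  proof (cases "n = 0")
    case False
    then show ?thesis
      using floorlog_bounds[of n 2] by (intro floorlog_leI) auto
  qed (simp add: compute_floorlog)
  then show ?thesis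
    unfolding sz_def encode_nat_def enc_nat_def vsize.simps rat_bits_def q fst_conv snd_conv
      abs_of_nat nat_int by simp
qed

lemma length_le_sz: "length xs < sz xs"
  by (induction xs) (auto simp: sz_pos)

lemma sz_member: "x \<in> set xs \<Longrightarrow> sz x \<le> sz xs"
  by (induction xs) auto

lemma sz_nat_le: "sz (n::nat) \<le> sz (0::nat) + n"
proof (induction n)
  case (Suc n)
  then show ?case using sz_Suc[of n] by simp
qed simp

section \<open>Polynomial-time functions\<close>

text \<open>A value enters the store only by evaluation, which is charged at least the size of the
  value. Time bounds therefore bound the sizes of results, which makes composition of
  polynomial-time programs possible.\<close>

lemma exec_output_size:
  "exec c s t s' \<Longrightarrow> (\<And>x. vsize (s x) \<le> B) \<Longrightarrow> vsize (s' x) \<le> B + t"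
proof (induction arbitrary: B x rule: exec.induct)
  case (exec_Skip s)
  then show ?case by (simp add: le_SucI)
next
  case (exec_Assign x e s)
  have "vsize (eval e s) \<le> ecost e s" by (induction e) auto
  then show ?case using exec_Assign.prems[of x] by (auto simp: trans_le_add1)
next
  case (exec_Seq c1 s t1 s1 c2 t2 s2)
  have "vsize (s2 x) \<le> (B + t1) + t2"
    by (rule exec_Seq.IH(2)) (rule exec_Seq.IH(1), rule exec_Seq.prems)
  then show ?case by simp
next
  case (exec_IfTrue e s c1 t s' c2)
  then show ?case using trans_le_add1 by (metis add.assoc add.commute)
next
  case (exec_IfFalse e s c2 t s' c1)
  then show ?case using trans_le_add1 by (metis add.assoc add.commute)
next
  case (exec_WhileFalse e s c)
  then show ?case using trans_le_add1 by blast
next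
  case (exec_WhileTrue e s c t1 s1 t2 s2)
  have "vsize (s2 x) \<le> (B + t1) + t2"
    by (rule exec_WhileTrue.IH(2)) (rule exec_WhileTrue.IH(1), rule exec_WhileTrue.prems)
  then show ?case by simp
next
  case (exec_Call c e s t s' y)
  have e: "vsize (eval e s) \<le> ecost e s" by (induction e) auto
  have "vsize (init_store (eval e s) z) \<le> ecost e s" for z
    using e vsize_pos[of "eval e s"] by (auto simp: init_store_def)
  then have "vsize (s' 0) \<le> ecost e s + t" by (rule exec_Call.IH)
  then show ?case using exec_Call.prems[of x] by auto
qed

lemma computes_in_size:
  assumes "computes_in p v w t"
  shows "vsize w \<le> vsize v + t"
proof -
  obtain s where s: "exec p (init_store v) t s" "s 0 = w"
    using assms by (auto simp: computes_in_def)
  have "vsize (init_store v x) \<le> vsize v" for x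
    using vsize_pos by (auto simp: init_store_def)
  from exec_output_size[OF s(1) this] s(2) show ?thesis by metis
qed

text \<open>The domain \<open>D\<close> is needed for the oracle, whose answers are meaningful only
  on some instances.\<close>

definition PT_on :: "'a::enc set \<Rightarrow> ('a \<Rightarrow> 'b::enc) \<Rightarrow> bool" where
  "PT_on D f \<longleftrightarrow> (\<exists>p c. \<forall>a\<in>D. \<exists>t. computes_in p (encode a) (encode (f a)) t \<and> t \<le> (sz a + 2) ^ c)"

abbreviation PT :: "('a::enc \<Rightarrow> 'b::enc) \<Rightarrow> bool" where
  "PT \<equiv> PT_on UNIV"

lemma PT_onI:
  assumes "polyb b" and "\<And>a. a \<in> D \<Longrightarrow> \<exists>t. computes_in p (encode a) (encode (f a)) t \<and> t \<le> b (sz a)"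
  shows "PT_on D f"
proof -
  obtain c where "\<And>n. b n \<le> (n + 2) ^ c" using assms(1) unfolding polyb_def by blast
  then show ?thesis using assms(2) unfolding PT_on_def by (meson order_trans)
qed

lemma PT_onE:
  assumes "PT_on D f"
  obtains p c t where "\<And>a. a \<in> D \<Longrightarrow> computes_in p (encode a) (encode (f a)) (t a)"
    and "\<And>a. a \<in> D \<Longrightarrow> t a \<le> (sz a + 2) ^ c"
    and "\<And>a. a \<in> D \<Longrightarrow> sz (f a) \<le> sz a + (sz a + 2) ^ c"
proof -
  obtain p c t where *: "\<And>a. a \<in> D \<Longrightarrow> computes_in p (encode a) (encode (f a)) (t a)"
    "\<And>a. a \<in> D \<Longrightarrow> t a \<le> (sz a + 2) ^ c"
    using assms unfolding PT_on_def by metis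
  have "sz (f a) \<le> sz a + (sz a + 2) ^ c" if "a \<in> D" for a
    using computes_in_size[OF *(1)[OF that]] *(2)[OF that] by (simp add: sz_def)
  then show thesis using * that by blast
qed

lemma PT_on_subset: "PT_on E f \<Longrightarrow> D \<subseteq> E \<Longrightarrow> PT_on D f"
  unfolding PT_on_def by (meson subsetD)

lemma PT_on_cong: "PT_on D f \<Longrightarrow> (\<And>a. a \<in> D \<Longrightarrow> f a = g a) \<Longrightarrow> PT_on D g"
  unfolding PT_on_def by metis

lemma PT_on_sz:
  assumes "PT_on D f"
  obtains c where "\<And>a. a \<in> D \<Longrightarrow> sz (f a) \<le> (sz a + 2) ^ c"
proof -
  obtain p c t where c: "\<And>a. a \<in> D \<Longrightarrow> sz (f a) \<le> sz a + (sz a + 2) ^ c"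
    by (rule PT_onE[OF assms]) (rule that)
  have "polyb (\<lambda>n. n + (n + 2) ^ c)" by (intro polyb_add polyb_id polyb_power polyb_const)
  then obtain d where "\<And>n::nat. n + (n + 2) ^ c \<le> (n + 2) ^ d" unfolding polyb_def by blast
  then show thesis using c that by (meson order_trans)
qed

lemma PT_expr:
  assumes "polyb b" "\<And>a. a \<in> D \<Longrightarrow> eval e (init_store (encode a)) = encode (f a)"
    "\<And>a. a \<in> D \<Longrightarrow> ecost e (init_store (encode a)) \<le> b (sz a)"
  shows "PT_on D f"
proof (rule PT_onI[where p = "Assign 0 e" and b = "\<lambda>n. 1 + b n"])
  show "polyb (\<lambda>n. 1 + b n)" using assms(1) by (intro polyb_add polyb_const)
  fix a assume "a \<in> D"
  then show "\<exists>t. computes_in (Assign 0 e) (encode a) (encode (f a)) t \<and> t \<le> 1 + b (sz a)"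
    using assms(2,3) exec_Assign[of 0 e "init_store (encode a)"] unfolding computes_in_def
    by (intro exI[of _ "1 + ecost e (init_store (encode a))"]) auto
qed

section \<open>Composition, elementary operations and branching\<close>

lemma init_store_upd [simp]: "(init_store v)(0 := w) = init_store w"
  by (auto simp: init_store_def)

lemma init_store_0 [simp]: "init_store v 0 = v"
  by (simp add: init_store_def)

lemma exec_Call_computes:
  assumes "computes_in p (eval e s) w t"
  shows "exec (Call x p e) s (1 + ecost e s + t) (s(x := w))"
  using assms exec_Call unfolding computes_in_def by blast

lemma PT_comp:
  assumes "PT_on D f" "PT_on E g" "\<And>a. a \<in> D \<Longrightarrow> f a \<in> E"
  shows "PT_on D (\<lambda>a. g (f a))"
proof -
  obtain p c t where f: "\<And>a. a \<in> D \<Longrightarrow> computes_in p (encode a) (encode (f a)) (t a)"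
    "\<And>a. a \<in> D \<Longrightarrow> t a \<le> (sz a + 2) ^ c"
    "\<And>a. a \<in> D \<Longrightarrow> sz (f a) \<le> sz a + (sz a + 2) ^ c"
    by (rule PT_onE[OF assms(1)]) (rule that)
  obtain q d u where g: "\<And>a. a \<in> E \<Longrightarrow> computes_in q (encode a) (encode (g a)) (u a)"
    "\<And>a. a \<in> E \<Longrightarrow> u a \<le> (sz a + 2) ^ d"
    by (rule PT_onE[OF assms(2)]) (rule that)
  let ?P = "Seq (Call 0 p (Var 0)) (Call 0 q (Var 0))"
  let ?b = "\<lambda>n. 1 + (1 + n + (n + 2) ^ c) + (1 + (n + (n + 2) ^ c) + (n + (n + 2) ^ c + 2) ^ d)"
  show ?thesis
  proof (rule PT_onI[where p = ?P and b = ?b])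
    show "polyb ?b" by (intro polyb_add polyb_id polyb_const polyb_power)
    fix a assume a: "a \<in> D"
    let ?s = "init_store (encode a)"
    have 1: "exec (Call 0 p (Var 0)) ?s (1 + sz a + t a) (init_store (encode (f a)))"
      using exec_Call_computes[of p "Var 0" ?s "encode (f a)" "t a" 0] f(1)[OF a]
      by (simp add: sz_def)
    have 2: "exec (Call 0 q (Var 0)) (init_store (encode (f a))) (1 + sz (f a) + u (f a))
        (init_store (encode (g (f a))))"
      using exec_Call_computes[of q "Var 0" "init_store (encode (f a))" _ "u (f a)" 0]
        g(1)[OF assms(3)[OF a]] by (simp add: sz_def)
    have "u (f a) \<le> (sz (f a) + 2) ^ d" using g(2) assms(3) a by blast
    also have "\<dots> \<le> (sz a + (sz a + 2) ^ c + 2) ^ d"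
      using f(3)[OF a] by (intro power_mono) auto
    finally have "1 + (1 + sz a + t a) + (1 + sz (f a) + u (f a)) \<le> ?b (sz a)"
      using f(2,3)[OF a] by linarith
    then show "\<exists>t. computes_in ?P (encode a) (encode (g (f a))) t \<and> t \<le> ?b (sz a)"
      using exec_Seq[OF 1 2] unfolding computes_in_def by (meson init_store_0)
  qed
qed

lemma PT_id [intro]: "PT_on D (\<lambda>a. a)"
  by (rule PT_expr[where e = "Var 0" and b = "\<lambda>n. n"]) (auto simp: sz_def)

lemma PT_const [intro]: "PT_on D (\<lambda>a. k)"
  by (rule PT_expr[where e = "Const (encode k)" and b = "\<lambda>n. sz k"]) (auto simp: sz_def)

text \<open>\<open>Call\<close> runs each program in a fresh store, so the input in variable 0
  survives the first call and is available to the second.\<close>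

lemma PT_Pair [intro]:
  assumes "PT_on D f" "PT_on D g"
  shows "PT_on D (\<lambda>a. (f a, g a))"
proof -
  obtain p c t where f: "\<And>a. a \<in> D \<Longrightarrow> computes_in p (encode a) (encode (f a)) (t a)"
    "\<And>a. a \<in> D \<Longrightarrow> t a \<le> (sz a + 2) ^ c"
    "\<And>a. a \<in> D \<Longrightarrow> sz (f a) \<le> sz a + (sz a + 2) ^ c"
    by (rule PT_onE[OF assms(1)]) (rule that)
  obtain q d u where g: "\<And>a. a \<in> D \<Longrightarrow> computes_in q (encode a) (encode (g a)) (u a)"
    "\<And>a. a \<in> D \<Longrightarrow> u a \<le> (sz a + 2) ^ d"
    "\<And>a. a \<in> D \<Longrightarrow> sz (g a) \<le> sz a + (sz a + 2) ^ d"
    by (rule PT_onE[OF assms(2)]) (rule that)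
  let ?A = "Assign 0 (MkPair (Var 1) (Var 2))"
  let ?P = "Seq (Seq (Call 1 p (Var 0)) (Call 2 q (Var 0))) ?A"
  let ?b = "\<lambda>n. 10 + 6 * n + 3 * (n + 2) ^ c + 3 * (n + 2) ^ d"
  show ?thesis
  proof (rule PT_onI[where p = ?P and b = ?b])
    show "polyb ?b" by (intro polyb_add polyb_id polyb_const polyb_power polyb_mult)
    fix a assume a: "a \<in> D"
    let ?s = "init_store (encode a)"
    let ?s1 = "?s(1 := encode (f a))"
    let ?s2 = "?s1(2 := encode (g a))"
    have 1: "exec (Call 1 p (Var 0)) ?s (1 + sz a + t a) ?s1"
      using exec_Call_computes[of p "Var 0" ?s "encode (f a)" "t a" 1] f(1)[OF a]
      by (simp add: sz_def)
    have 2: "exec (Call 2 q (Var 0)) ?s1 (1 + sz a + u a) ?s2"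
      using exec_Call_computes[of q "Var 0" ?s1 "encode (g a)" "u a" 2] g(1)[OF a]
      by (simp add: sz_def)
    note 3 = exec_Seq[OF exec_Seq[OF 1 2] exec_Assign[of 0 "MkPair (Var 1) (Var 2)" ?s2]]
    show "\<exists>t. computes_in ?P (encode a) (encode (f a, g a)) t \<and> t \<le> ?b (sz a)"
      unfolding computes_in_def
      using 3 f(2,3)[OF a] g(2,3)[OF a]
      by (intro exI conjI) (assumption | simp add: sz_def)+
  qed
qed

lemma PT_fst [intro]:
  assumes "PT_on D f" shows "PT_on D (\<lambda>a. fst (f a))"
proof -
  have "PT (fst :: 'b \<times> 'c \<Rightarrow> 'b)"
  proof (rule PT_expr[where e = "Fst (Var 0)" and b = "\<lambda>n. n + n"])
    show "polyb (\<lambda>n. n + n)" by (intro polyb_add polyb_id)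
  qed (auto simp: sz_def)
  with assms show ?thesis using PT_comp[of D f UNIV fst] by simp
qed

lemma PT_snd [intro]:
  assumes "PT_on D f" shows "PT_on D (\<lambda>a. snd (f a))"
proof -
  have "PT (snd :: 'b \<times> 'c \<Rightarrow> 'c)"
  proof (rule PT_expr[where e = "Snd (Var 0)" and b = "\<lambda>n. n + n"])
    show "polyb (\<lambda>n. n + n)" by (intro polyb_add polyb_id)
  qed (auto simp: sz_def)
  with assms show ?thesis using PT_comp[of D f UNIV snd] by simp
qed

text \<open>A nonempty list has the same encoding as the pair of its head and tail.\<close>

lemma PT_Cons [intro]:
  assumes "PT_on D f" "PT_on D g" shows "PT_on D (\<lambda>a. f a # g a)"
  using PT_Pair[OF assms] unfolding PT_on_def by simp

lemma PT_eq [intro]: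
  assumes "PT_on D f" "PT_on D g" shows "PT_on D (\<lambda>a. f a = g a)"
proof -
  have "PT (\<lambda>p :: 'b \<times> 'b. fst p = snd p)"
  proof (rule PT_expr[where e = "Eq (Fst (Var 0)) (Snd (Var 0))" and b = "\<lambda>n. 5 * n + 5"])
    show "polyb (\<lambda>n. 5 * n + 5)" by (intro polyb_add polyb_id polyb_mult polyb_const)
    fix a :: "'b \<times> 'b"
    show "eval (Eq (Fst (Var 0)) (Snd (Var 0))) (init_store (encode a)) = encode (fst a = snd a)"
      by (cases a) (simp add: encode_inj encode_bool_def)
    show "ecost (Eq (Fst (Var 0)) (Snd (Var 0))) (init_store (encode a)) \<le> 5 * sz a + 5"
      using sz_bool[of "fst a = snd a"]
      by (cases a) (simp add: encode_inj encode_bool_def sz_def)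
  qed
  with PT_Pair[OF assms] show ?thesis
    using PT_comp[of D "\<lambda>a. (f a, g a)" UNIV "\<lambda>p. fst p = snd p"] by simp
qed

lemma PT_less_rat [intro]:
  fixes f g :: "'a::enc \<Rightarrow> rat"
  assumes "PT_on D f" "PT_on D g" shows "PT_on D (\<lambda>a. f a < g a)"
proof -
  have "PT (\<lambda>p :: rat \<times> rat. fst p < snd p)"
  proof (rule PT_expr[where e = "Less (Fst (Var 0)) (Snd (Var 0))" and b = "\<lambda>n. 5 * n + 5"])
    show "polyb (\<lambda>n. 5 * n + 5)" by (intro polyb_add polyb_id polyb_mult polyb_const)
    fix a :: "rat \<times> rat"
    show "eval (Less (Fst (Var 0)) (Snd (Var 0))) (init_store (encode a)) = encode (fst a < snd a)"
      by (cases a) (simp add: encode_rat_def encode_bool_def)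
    show "ecost (Less (Fst (Var 0)) (Snd (Var 0))) (init_store (encode a)) \<le> 5 * sz a + 5"
      using sz_bool[of "fst a < snd a"]
      by (cases a) (simp add: encode_rat_def encode_bool_def sz_def)
  qed
  with PT_Pair[OF assms] show ?thesis
    using PT_comp[of D "\<lambda>a. (f a, g a)" UNIV "\<lambda>p. fst p < snd p"] by simp
qed

lemma PT_less_nat [intro]:
  fixes f g :: "'a::enc \<Rightarrow> nat"
  assumes "PT_on D f" "PT_on D g" shows "PT_on D (\<lambda>a. f a < g a)"
proof -
  \<comment> \<open>A natural number and its image in the rationals have the same encoding, so the
    program for \<open>h\<close> computes both.\<close>
  have *: "PT_on D (\<lambda>a. rat_of_nat (h a))" if "PT_on D h" for h :: "'a \<Rightarrow> nat"
    using that unfolding PT_on_def encode_nat_def enc_nat_def encode_rat_def .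
  from PT_less_rat[OF *[OF assms(1)] *[OF assms(2)]] show ?thesis by simp
qed

lemma PT_Suc [intro]:
  assumes "PT_on D f" shows "PT_on D (\<lambda>a. Suc (f a))"
proof -
  have "PT Suc"
  proof (rule PT_expr[where e = "Add (Var 0) (Const (VNum 1))" and b = "\<lambda>n. 3 * n + 6"])
    show "polyb (\<lambda>n. 3 * n + 6)" by (intro polyb_add polyb_id polyb_mult polyb_const)
    fix a :: nat
    show *: "eval (Add (Var 0) (Const (VNum 1))) (init_store (encode a)) = encode (Suc a)"
      by (simp add: encode_nat_def enc_nat_def)
    have "vsize (VNum 1) \<le> 3" using sz_bool[of True] by (simp add: sz_def encode_bool_def vbool_def)
    then show "ecost (Add (Var 0) (Const (VNum 1))) (init_store (encode a)) \<le> 3 * sz a + 6"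
      using sz_Suc[of a] * unfolding ecost.simps * by (simp add: sz_def)
  qed
  with assms show ?thesis using PT_comp[of D f UNIV Suc] by simp
qed

text \<open>Each branch has to be polynomial only where the test selects it. This is what allows a
  guarded call of the oracle.\<close>

lemma PT_If [intro]:
  assumes "PT_on D P" "PT_on {a \<in> D. P a} f" "PT_on {a \<in> D. \<not> P a} g"
  shows "PT_on D (\<lambda>a. if P a then f a else g a)"
proof -
  obtain r e w where P: "\<And>a. a \<in> D \<Longrightarrow> computes_in r (encode a) (encode (P a)) (w a)"
    "\<And>a. a \<in> D \<Longrightarrow> w a \<le> (sz a + 2) ^ e"
    by (rule PT_onE[OF assms(1)]) (rule that)
  obtain p c t where f: "\<And>a. a \<in> {a \<in> D. P a} \<Longrightarrow> computes_in p (encode a) (encode (f a)) (t a)"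
    "\<And>a. a \<in> {a \<in> D. P a} \<Longrightarrow> t a \<le> (sz a + 2) ^ c"
    by (rule PT_onE[OF assms(2)]) (rule that)
  obtain q d u where g: "\<And>a. a \<in> {a \<in> D. \<not> P a} \<Longrightarrow> computes_in q (encode a) (encode (g a)) (u a)"
    "\<And>a. a \<in> {a \<in> D. \<not> P a} \<Longrightarrow> u a \<le> (sz a + 2) ^ d"
    by (rule PT_onE[OF assms(3)]) (rule that)
  let ?I = "If (Var 1) (Call 0 p (Var 0)) (Call 0 q (Var 0))"
  let ?C = "Seq (Call 1 r (Var 0)) ?I"
  let ?b = "\<lambda>n. 10 + 2 * n + (n + 2) ^ e + (n + 2) ^ c + (n + 2) ^ d"
  show ?thesis
  proof (rule PT_onI[where p = ?C and b = ?b])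
    show "polyb ?b" by (intro polyb_add polyb_id polyb_const polyb_power polyb_mult)
    fix a assume a: "a \<in> D"
    let ?s = "init_store (encode a)"
    let ?s1 = "?s(1 := encode (P a))"
    have 1: "exec (Call 1 r (Var 0)) ?s (1 + sz a + w a) ?s1"
      using exec_Call_computes[of r "Var 0" ?s "encode (P a)" "w a" 1] P(1)[OF a]
      by (simp add: sz_def)
    show "\<exists>t. computes_in ?C (encode a) (encode (if P a then f a else g a)) t \<and> t \<le> ?b (sz a)"
    proof (cases "P a")
      case True
      have 2: "exec (Call 0 p (Var 0)) ?s1 (1 + sz a + t a) (?s1(0 := encode (f a)))"
        using exec_Call_computes[of p "Var 0" ?s1 "encode (f a)" "t a" 0] f(1)[of a] a True
        by (simp add: sz_def)
      have v: "eval (Var 1) ?s1 \<noteq> VNil" using True by (simp add: encode_bool_def vbool_def)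
      have "ecost (Var 1) ?s1 \<le> 3" using sz_bool[of "P a"] by (simp add: sz_def)
      then show ?thesis
        using exec_Seq[OF 1 exec_IfTrue[OF v 2]] P(2)[OF a] f(2)[of a] a True
        unfolding computes_in_def by (intro exI conjI) (assumption | simp)+
    next
      case False
      have 2: "exec (Call 0 q (Var 0)) ?s1 (1 + sz a + u a) (?s1(0 := encode (g a)))"
        using exec_Call_computes[of q "Var 0" ?s1 "encode (g a)" "u a" 0] g(1)[of a] a False
        by (simp add: sz_def)
      have v: "eval (Var 1) ?s1 = VNil" using False by (simp add: encode_bool_def vbool_def)
      have "ecost (Var 1) ?s1 \<le> 3" using sz_bool[of "P a"] by (simp add: sz_def)
      then show ?thesis
        using exec_Seq[OF 1 exec_IfFalse[OF v 2]] P(2)[OF a] g(2)[of a] a False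
        unfolding computes_in_def by (intro exI conjI) (assumption | simp)+
    qed
  qed
qed

section \<open>Iteration over lists\<close>

lemma exec_While_iterate:
  assumes "\<And>j. j < n \<Longrightarrow> eval e (st j) \<noteq> VNil"
    and "\<And>j. j < n \<Longrightarrow> \<exists>t\<le>T. exec c (st j) t (st (Suc j))"
    and "eval e (st n) = VNil"
    and "\<And>j. j \<le> n \<Longrightarrow> ecost e (st j) \<le> K"
  shows "\<exists>t \<le> n * (1 + K + T) + 1 + K. exec (While e c) (st 0) t (st n)"
  using assms
proof (induction n arbitrary: st)
  case 0
  then show ?case
    using exec_WhileFalse[of e "st 0" c] by (intro exI[of _ "1 + ecost e (st 0)"]) auto
next
  case (Suc n)
  obtain t1 where t1: "t1 \<le> T" "exec c (st 0) t1 (st (Suc 0))"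
    using Suc.prems(2)[of 0] by auto
  obtain t2 where t2: "t2 \<le> n * (1 + K + T) + 1 + K"
      "exec (While e c) (st (Suc 0)) t2 (st (Suc n))"
    using Suc.IH[of "\<lambda>j. st (Suc j)"] Suc.prems by auto
  have "exec (While e c) (st 0) (1 + ecost e (st 0) + t1 + t2) (st (Suc n))"
    using exec_WhileTrue[OF _ t1(2) t2(2)] Suc.prems(1)[of 0] by simp
  moreover have "1 + ecost e (st 0) + t1 + t2 \<le> Suc n * (1 + K + T) + 1 + K"
    using t1(1) t2(1) Suc.prems(4)[of 0] by simp
  ultimately show ?case by blast
qed

lemma sz_drop_le: "sz (drop j xs) \<le> sz xs"
proof (induction j arbitrary: xs)
  case (Suc j)
  show ?case
  proof (cases xs)
    case (Cons x ys)
    then show ?thesis using Suc.IH[of ys] by simp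
  qed simp
qed simp

text \<open>Iterating a polynomial-time step can square the state in every round, hence the explicit
  bound on all intermediate states. The set \<open>E\<close> has to contain only the triples that
  really occur, for the sake of steps that call the oracle.\<close>

lemma PT_fold_on:
  fixes F :: "'x::enc \<Rightarrow> 's::enc \<Rightarrow> 'a::enc \<Rightarrow> 's"
  assumes F: "PT_on E (\<lambda>p. F (fst p) (fst (snd p)) (snd (snd p)))"
    and xs: "PT_on D xs" and s0: "PT_on D s0"
    and dom: "\<And>a j. a \<in> D \<Longrightarrow> j < length (xs a) \<Longrightarrow>
       (xs a ! j, fold (\<lambda>x s. F x s a) (take j (xs a)) (s0 a), a) \<in> E"
    and B: "polyb B"
    and bound: "\<And>a j. a \<in> D \<Longrightarrow> j \<le> length (xs a) \<Longrightarrow>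
       sz (fold (\<lambda>x s. F x s a) (take j (xs a)) (s0 a)) \<le> B (sz a)"
  shows "PT_on D (\<lambda>a. fold (\<lambda>x s. F x s a) (xs a) (s0 a))"
proof -
  obtain p c t where p: "\<And>a. a \<in> E \<Longrightarrow> computes_in p (encode a) (encode (F (fst a) (fst (snd a)) (snd (snd a)))) (t a)"
    "\<And>a. a \<in> E \<Longrightarrow> t a \<le> (sz a + 2) ^ c"
    by (rule PT_onE[OF F]) (rule that)
  obtain q d u where q: "\<And>a. a \<in> D \<Longrightarrow> computes_in q (encode a) (encode (xs a)) (u a)"
    "\<And>a. a \<in> D \<Longrightarrow> u a \<le> (sz a + 2) ^ d"
    "\<And>a. a \<in> D \<Longrightarrow> sz (xs a) \<le> sz a + (sz a + 2) ^ d"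
    by (rule PT_onE[OF xs]) (rule that)
  obtain r g w where r: "\<And>a. a \<in> D \<Longrightarrow> computes_in r (encode a) (encode (s0 a)) (w a)"
    "\<And>a. a \<in> D \<Longrightarrow> w a \<le> (sz a + 2) ^ g"
    by (rule PT_onE[OF s0]) (rule that)
  \<comment> \<open>\<open>?X\<close> bounds the list, \<open>?T\<close> one round of the loop,
    \<open>?K\<close> one test of the guard and \<open>?b\<close> the whole run.\<close>
  let ?X = "\<lambda>n. n + (n + 2) ^ d"
  let ?T = "\<lambda>n. 20 + 20 * ?X n + 20 * B n + 20 * n + (2 + ?X n + B n + n + 2) ^ c"
  let ?K = "\<lambda>n. ?X n + 3"
  let ?b = "\<lambda>n. 20 + 2 * n + (n + 2) ^ d + (n + 2) ^ g
      + (?X n * (1 + ?K n + ?T n) + 1 + ?K n) + B n"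
  \<comment> \<open>Variable 0 holds the input, 1 the unread part of the list, 2 the accumulator.\<close>
  let ?call = "Call 2 p (MkPair (Fst (Var 1)) (MkPair (Var 2) (Var 0)))"
  let ?body = "Seq ?call (Assign 1 (Snd (Var 1)))"
  let ?loop = "While (IsPair (Var 1)) ?body"
  let ?P = "Seq (Seq (Call 1 q (Var 0)) (Call 2 r (Var 0))) (Seq ?loop (Assign 0 (Var 2)))"
  show ?thesis
  proof (rule PT_onI[where p = ?P and b = ?b])
    show "polyb ?b" by (intro polyb_add polyb_id polyb_const polyb_power polyb_mult B)
    fix a assume a: "a \<in> D"
    define f where "f = (\<lambda>x s. F x s a)"
    define n where "n = length (xs a)"
    define \<sigma> where "\<sigma> L s = (init_store (encode a))(1 := encode (L :: 'x list), 2 := encode (s :: 's))" for L s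
    define S where "S j = fold f (take j (xs a)) (s0 a)" for j
    define st where "st j = \<sigma> (drop j (xs a)) (S j)" for j
    have \<sigma>1: "(\<sigma> L s)(1 := encode L') = \<sigma> L' s" for L L' s
      by (simp add: \<sigma>_def fun_upd_twist)
    have \<sigma>2: "(\<sigma> L s)(2 := encode s') = \<sigma> L s'" for L s s'
      by (simp add: \<sigma>_def)
    have \<sigma>v [simp]: "\<sigma> L s 0 = encode a" "\<sigma> L s 1 = encode L" "\<sigma> L s (Suc 0) = encode L" "\<sigma> L s 2 = encode s" for L s
      by (simp_all add: \<sigma>_def)
    have S: "sz (S j) \<le> B (sz a)" if "j \<le> n" for j
      using bound[OF a] that unfolding S_def f_def n_def by blast
    have dX: "sz (drop j (xs a)) \<le> ?X (sz a)" for j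
      using sz_drop_le q(3)[OF a] order_trans by blast
    have step: "\<exists>t\<le>?T (sz a). exec ?body (st j) t (st (Suc j))" if j: "j < n" for j
    proof -
      let ?e = "MkPair (Fst (Var 1)) (MkPair (Var 2) (Var 0))"
      define x where "x = xs a ! j"
      define L where "L = drop (Suc j) (xs a)"
      have dr: "drop j (xs a) = x # L"
        using j unfolding x_def L_def n_def by (simp add: Cons_nth_drop_Suc)
      have S': "S (Suc j) = F x (S j) a"
        using j unfolding S_def x_def n_def f_def by (simp add: take_Suc_conv_app_nth)
      have ev: "eval ?e (st j) = encode (x, S j, a)"
        unfolding st_def dr by simp
      have E: "(x, S j, a) \<in> E" using dom[OF a] j unfolding x_def S_def n_def f_def by blast
      have xL: "sz x + sz L + 1 \<le> ?X (sz a)" using dX[of j] unfolding dr by simp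
      have Sj: "sz (S j) \<le> B (sz a)" using S j by simp
      have 1: "exec ?call (st j) (1 + ecost ?e (st j) + t (x, S j, a)) ((st j)(2 := encode (S (Suc j))))"
        using exec_Call_computes[of p ?e "st j" "encode (S (Suc j))" "t (x, S j, a)" 2] p(1)[OF E]
        unfolding ev S' by simp
      have s1: "(st j)(2 := encode (S (Suc j))) = \<sigma> (x # L) (S (Suc j))"
        unfolding st_def dr \<sigma>2 ..
      have 2: "exec (Assign 1 (Snd (Var 1))) (\<sigma> (x # L) (S (Suc j)))
          (1 + ecost (Snd (Var 1)) (\<sigma> (x # L) (S (Suc j)))) (st (Suc j))"
        using exec_Assign[of 1 "Snd (Var 1)" "\<sigma> (x # L) (S (Suc j))"] \<sigma>1[of "x # L" "S (Suc j)" L]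
        unfolding st_def L_def[symmetric] by simp
      note 3 = exec_Seq[OF 1[unfolded s1] 2]
      have c1: "ecost ?e (st j) \<le> 2 + 3 * ?X (sz a) + 3 * B (sz a) + 3 * sz a"
        using xL Sj unfolding st_def dr by (simp add: sz_def)
      have c2: "ecost (Snd (Var 1)) (\<sigma> (x # L) (S (Suc j))) \<le> 2 * ?X (sz a)"
        using xL by (simp add: sz_def)
      have "t (x, S j, a) \<le> (sz (x, S j, a) + 2) ^ c" using p(2)[OF E] .
      also have "\<dots> \<le> (2 + ?X (sz a) + B (sz a) + sz a + 2) ^ c"
        using xL Sj by (intro power_mono) auto
      finally have c3: "t (x, S j, a) \<le> (2 + ?X (sz a) + B (sz a) + sz a + 2) ^ c" .
      have "1 + (1 + ecost ?e (st j) + t (x, S j, a)) + (1 + ecost (Snd (Var 1)) (\<sigma> (x # L) (S (Suc j)))) \<le> ?T (sz a)"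
        using c1 c2 c3 by linarith
      then show ?thesis using 3 by blast
    qed
    have 1: "exec (Call 1 q (Var 0)) (init_store (encode a)) (1 + sz a + u a) ((init_store (encode a))(1 := encode (xs a)))"
      using exec_Call_computes[of q "Var 0" "init_store (encode a)" "encode (xs a)" "u a" 1] q(1)[OF a]
      by (simp add: sz_def)
    have 2: "exec (Call 2 r (Var 0)) ((init_store (encode a))(1 := encode (xs a))) (1 + sz a + w a) (st 0)"
      using exec_Call_computes[of r "Var 0" "(init_store (encode a))(1 := encode (xs a))" "encode (s0 a)" "w a" 2] r(1)[OF a]
      by (simp add: sz_def st_def \<sigma>_def S_def)
    have "\<exists>t \<le> n * (1 + ?K (sz a) + ?T (sz a)) + 1 + ?K (sz a). exec ?loop (st 0) t (st n)"
    proof (rule exec_While_iterate)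
      show "eval (IsPair (Var 1)) (st j) \<noteq> VNil" if "j < n" for j
        using that by (simp add: st_def vbool_def n_def Cons_nth_drop_Suc[symmetric])
      show "eval (IsPair (Var 1)) (st n) = VNil"
        by (simp add: st_def vbool_def n_def)
      show "ecost (IsPair (Var 1)) (st j) \<le> ?K (sz a)" for j
        using sz_bool[of "is_vpair (encode (drop j (xs a)))"] dX[of j]
        by (simp add: st_def sz_def encode_bool_def)
    qed (rule step)
    then obtain tl where tl: "tl \<le> n * (1 + ?K (sz a) + ?T (sz a)) + 1 + ?K (sz a)"
        "exec ?loop (st 0) tl (st n)" by blast
    have 4: "exec (Assign 0 (Var 2)) (st n) (1 + sz (S n)) ((st n)(0 := encode (S n)))"
      using exec_Assign[of 0 "Var 2" "st n"] by (simp add: st_def sz_def)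
    note 5 = exec_Seq[OF exec_Seq[OF 1 2] exec_Seq[OF tl(2) 4]]
    have res: "S n = fold (\<lambda>x s. F x s a) (xs a) (s0 a)"
      unfolding S_def n_def f_def by simp
    have "n \<le> ?X (sz a)" using length_le_sz[of "xs a"] q(3)[OF a] unfolding n_def by linarith
    then have "n * (1 + ?K (sz a) + ?T (sz a)) \<le> ?X (sz a) * (1 + ?K (sz a) + ?T (sz a))"
      by (rule mult_le_mono1)
    then have "1 + (1 + (1 + sz a + u a) + (1 + sz a + w a)) + (1 + tl + (1 + sz (S n))) \<le> ?b (sz a)"
      using tl(1) q(2)[OF a] r(2)[OF a] S[of n] by linarith
    then show "\<exists>t. computes_in ?P (encode a) (encode (fold (\<lambda>x s. F x s a) (xs a) (s0 a))) t \<and> t \<le> ?b (sz a)"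
      unfolding computes_in_def res[symmetric] using 5 by (meson fun_upd_same)
  qed
qed

text \<open>When the growth per round depends on the list element and the input but not on the
  state, it adds up to at most the length of the list times a polynomial, so the bound required by
  \<open>PT_fold_on\<close> is automatic.\<close>

lemma PT_fold:
  assumes F: "PT (\<lambda>p. F (fst p) (fst (snd p)) (snd (snd p)))"
    and xs: "PT_on D xs" and s0: "PT_on D s0"
    and G: "polyb G" and growth: "\<And>x s a. sz (F x s a) \<le> sz s + G (sz x + sz a)"
  shows "PT_on D (\<lambda>a. fold (\<lambda>x s. F x s a) (xs a) (s0 a))"
proof -
  obtain c where c: "\<And>a. a \<in> D \<Longrightarrow> sz (xs a) \<le> (sz a + 2) ^ c" by (rule PT_on_sz[OF xs]) (rule that)
  obtain d where d: "\<And>a. a \<in> D \<Longrightarrow> sz (s0 a) \<le> (sz a + 2) ^ d" by (rule PT_on_sz[OF s0]) (rule that)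
  obtain g where g: "\<And>n. G n \<le> (n + 2) ^ g" using G unfolding polyb_def by blast
  let ?B = "\<lambda>n. (n + 2) ^ d + (n + 2) ^ c * ((n + 2) ^ c + n + 2) ^ g"
  show ?thesis
  proof (rule PT_fold_on[OF F xs s0, where B = ?B])
    show "polyb ?B" by (intro polyb_add polyb_id polyb_const polyb_power polyb_mult)
    fix a j assume a: "a \<in> D" and j: "j \<le> length (xs a)"
    have "sz (fold (\<lambda>x s. F x s a) (take j (xs a)) (s0 a)) \<le> sz (s0 a) + j * ((sz a + 2) ^ c + sz a + 2) ^ g"
      using j
    proof (induction j)
      case (Suc j)
      let ?x = "xs a ! j"
      have "sz (fold (\<lambda>x s. F x s a) (take (Suc j) (xs a)) (s0 a))
          \<le> sz (fold (\<lambda>x s. F x s a) (take j (xs a)) (s0 a)) + G (sz ?x + sz a)"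
        using Suc.prems growth by (simp add: take_Suc_conv_app_nth)
      moreover have "G (sz ?x + sz a) \<le> ((sz a + 2) ^ c + sz a + 2) ^ g"
      proof -
        have "sz ?x \<le> (sz a + 2) ^ c"
          using sz_member[of ?x "xs a"] c[OF a] Suc.prems by (meson nth_mem order_trans Suc_le_lessD)
        then have "(sz ?x + sz a + 2) ^ g \<le> ((sz a + 2) ^ c + sz a + 2) ^ g" by (intro power_mono) auto
        then show ?thesis using g order_trans by blast
      qed
      ultimately show ?case using Suc by simp
    qed simp
    also have "\<dots> \<le> ?B (sz a)"
      using d[OF a] c[OF a] length_le_sz[of "xs a"] j by (intro add_mono mult_mono) auto
    finally show "sz (fold (\<lambda>x s. F x s a) (take j (xs a)) (s0 a)) \<le> ?B (sz a)" .
  qed simp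
qed

section \<open>Several arguments, propositional connectives and list operations\<close>

lemma PT_comp2:
  assumes "PT (\<lambda>p. g (fst p) (snd p))" "PT_on D f1" "PT_on D f2"
  shows "PT_on D (\<lambda>a. g (f1 a) (f2 a))"
  using PT_comp[OF PT_Pair[OF assms(2,3)] assms(1)] by simp

lemma PT_comp3:
  assumes "PT (\<lambda>p. g (fst p) (fst (snd p)) (snd (snd p)))" "PT_on D f1" "PT_on D f2" "PT_on D f3"
  shows "PT_on D (\<lambda>a. g (f1 a) (f2 a) (f3 a))"
  using PT_comp[OF PT_Pair[OF assms(2) PT_Pair[OF assms(3,4)]] assms(1)] by simp

lemma PT_comp4:
  assumes "PT (\<lambda>p. g (fst p) (fst (snd p)) (fst (snd (snd p))) (snd (snd (snd p))))"
    "PT_on D f1" "PT_on D f2" "PT_on D f3" "PT_on D f4"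
  shows "PT_on D (\<lambda>a. g (f1 a) (f2 a) (f3 a) (f4 a))"
  using PT_comp[OF PT_Pair[OF assms(2) PT_Pair[OF assms(3) PT_Pair[OF assms(4,5)]]] assms(1)] by simp

lemma PT_not [intro]: "PT_on D P \<Longrightarrow> PT_on D (\<lambda>a. \<not> P a)"
  using PT_eq[of D P "\<lambda>_. False"] by (simp add: PT_const)

lemma PT_conj [intro]:
  assumes "PT_on D P" "PT_on D Q" shows "PT_on D (\<lambda>a. P a \<and> Q a)"
proof -
  have "PT_on D (\<lambda>a. if P a then Q a else False)"
    by (rule PT_If[OF assms(1) PT_on_subset[OF assms(2)] PT_const]) auto
  then show ?thesis by (rule PT_on_cong) simp
qed

lemma PT_disj [intro]:
  assumes "PT_on D P" "PT_on D Q" shows "PT_on D (\<lambda>a. P a \<or> Q a)"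
proof -
  have "PT_on D (\<lambda>a. if P a then True else Q a)"
    by (rule PT_If[OF assms(1) PT_const PT_on_subset[OF assms(2)]]) auto
  then show ?thesis by (rule PT_on_cong) simp
qed

lemma PT_rev [intro]:
  assumes "PT_on D xs" shows "PT_on D (\<lambda>a. rev (xs a))"
proof -
  have "PT_on D (\<lambda>a. fold (\<lambda>x s. x # s) (xs a) [])"
    by (rule PT_fold[where G = "\<lambda>n. n + 1"]) (intro assms PT_Cons PT_fst PT_snd PT_id PT_const polyb_add polyb_id polyb_const | simp)+
  then show ?thesis by (simp add: rev_conv_fold[symmetric] fold_Cons_rev)
qed

lemma PT_append [intro]:
  assumes "PT_on D xs" "PT_on D ys" shows "PT_on D (\<lambda>a. xs a @ ys a)"
proof -
  have "PT_on D (\<lambda>a. fold (\<lambda>x s. x # s) (rev (xs a)) (ys a))"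
    by (rule PT_fold[where G = "\<lambda>n. n + 1"]) (intro assms PT_rev PT_Cons PT_fst PT_snd PT_id PT_const polyb_add polyb_id polyb_const | simp)+
  then show ?thesis by (simp add: fold_Cons_rev)
qed

text \<open>The mapped function may refer to the surrounding input \<open>a\<close>, which every
  round receives as a parameter; this takes the place of closures. The fold collects the results in
  reverse order.\<close>

lemma PT_map [intro]:
  assumes f: "PT (\<lambda>p. f (fst p) (snd p))" and "PT_on D xs"
  shows "PT_on D (\<lambda>a. map (\<lambda>x. f x a) (xs a))"
proof -
  obtain c where c: "\<And>p. sz (f (fst p) (snd p)) \<le> (sz p + 2) ^ c"
    by (rule PT_on_sz[OF f], rule that) blast
  have *: "fold (\<lambda>x s. f x a # s) ys s = rev (map (\<lambda>x. f x a) ys) @ s" for a ys s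
    by (induction ys arbitrary: s) auto
  have "PT_on D (\<lambda>a. fold (\<lambda>x s. f x a # s) (xs a) [])"
  proof (rule PT_fold[where G = "\<lambda>n. (1 + n + 2) ^ c + 1"])
    show "PT (\<lambda>p. f (fst p) (snd (snd p)) # fst (snd p))"
      by (intro PT_Cons PT_comp2[of f, OF f] PT_fst PT_snd PT_id)
    fix x s a show "sz (f x a # s) \<le> sz s + ((1 + (sz x + sz a) + 2) ^ c + 1)"
      using c[of "(x, a)"] by simp
  qed (intro assms PT_const polyb_add polyb_id polyb_const polyb_power)+
  then have "PT_on D (\<lambda>a. rev (fold (\<lambda>x s. f x a # s) (xs a) []))" by (rule PT_rev)
  then show ?thesis by (simp add: *)
qed

lemma PT_filter [intro]:
  assumes f: "PT (\<lambda>p. P (fst p) (snd p))" and "PT_on D xs"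
  shows "PT_on D (\<lambda>a. filter (\<lambda>x. P x a) (xs a))"
proof -
  have *: "fold (\<lambda>x s. if P x a then x # s else s) ys s = rev (filter (\<lambda>x. P x a) ys) @ s" for a ys s
    by (induction ys arbitrary: s) auto
  have "PT_on D (\<lambda>a. fold (\<lambda>x s. if P x a then x # s else s) (xs a) [])"
  proof (rule PT_fold[where G = "\<lambda>n. n + 1"])
    show "PT (\<lambda>p. if P (fst p) (snd (snd p)) then fst p # fst (snd p) else fst (snd p))"
      by (intro PT_If PT_Cons PT_comp2[of P, OF f] PT_fst PT_snd PT_id)
  qed (intro assms PT_const polyb_add polyb_id polyb_const polyb_power | simp)+
  then have "PT_on D (\<lambda>a. rev (fold (\<lambda>x s. if P x a then x # s else s) (xs a) []))" by (rule PT_rev)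
  then show ?thesis by (simp add: *)
qed

lemma PT_concat [intro]:
  fixes xs :: "'a::enc \<Rightarrow> 'b::enc list list"
  assumes "PT_on D xs" shows "PT_on D (\<lambda>a. concat (xs a))"
proof -
  have *: "fold (\<lambda>x s. s @ x) ys s = s @ concat ys" for ys and s :: "'b list"
    by (induction ys arbitrary: s) auto
  have "PT_on D (\<lambda>a. fold (\<lambda>x s. s @ x) (xs a) [])"
  proof (rule PT_fold[where G = "\<lambda>n. n"])
    fix x s :: "'b list" and a :: 'a
    show "sz (s @ x) \<le> sz s + (sz x + sz a)" using sz_append[of s x] by simp
  qed (intro assms PT_append PT_fst PT_snd PT_id PT_const polyb_add polyb_id polyb_const polyb_power)+
  then show ?thesis by (simp add: *)
qed

lemma PT_length [intro]:
  assumes "PT_on D xs" shows "PT_on D (\<lambda>a. length (xs a))"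
proof -
  have *: "fold (\<lambda>x. Suc) ys n = n + length ys" for ys :: "'b list" and n
    by (induction ys arbitrary: n) auto
  have "PT_on D (\<lambda>a. fold (\<lambda>x s. Suc s) (xs a) 0)"
  proof (rule PT_fold[where G = "\<lambda>n. 1"])
    fix x :: 'b and s :: nat and a :: 'a
    show "sz (Suc s) \<le> sz s + 1" by (rule sz_Suc)
  qed (intro assms PT_Suc PT_fst PT_snd PT_id PT_const polyb_add polyb_id polyb_const polyb_power)+
  then show ?thesis by (simp add: *)
qed

lemma PT_mem [intro]:
  assumes "PT_on D f" "PT_on D xs" shows "PT_on D (\<lambda>a. f a \<in> set (xs a))"
proof -
  have "PT (\<lambda>p :: 'b \<times> 'b list. filter (\<lambda>x. x = fst p) (snd p) \<noteq> [])"
    by (intro PT_not PT_eq PT_filter PT_fst PT_snd PT_id PT_const)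
  then have "PT (\<lambda>p :: 'b \<times> 'b list. fst p \<in> set (snd p))"
    by (rule PT_on_cong) (auto simp: filter_empty_conv)
  then show ?thesis by (rule PT_comp2[OF _ assms])
qed

lemma PT_enumerate [intro]:
  assumes "PT_on D xs" shows "PT_on D (\<lambda>a. List.enumerate 0 (xs a))"
proof -
  let ?F = "\<lambda>x s. (Suc (fst s), snd s @ [(fst s, x)])"
  have *: "fold ?F ys (n, zs) = (n + length ys, zs @ List.enumerate n ys)" for ys :: "'b list" and n zs
    by (induction ys arbitrary: n zs) auto
  have szl: "sz (List.enumerate n ys) \<le> sz ys + length ys * (2 + sz (0::nat) + n + length ys)" for n and ys :: "'b list"
  proof (induction ys arbitrary: n)
    case (Cons y ys)
    then show ?case using Cons[of "Suc n"] sz_nat_le[of n] by (simp add: algebra_simps)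
  qed simp
  have id: "PT (\<lambda>a :: 'b list. snd (fold ?F a (0, [])))"
  \<comment> \<open>The size of the appended index depends on the counter in the state, so the
    growth condition of \<open>PT_fold\<close> fails and the states are bounded directly.\<close>
  proof (intro PT_snd, rule PT_fold_on[where E = UNIV and D = UNIV and B = "\<lambda>n. 1 + (sz (0::nat) + n) + (n + n * (2 + sz (0::nat) + n))"])
    fix a :: "'b list" and j
    assume j: "j \<le> length a"
    have l: "sz (take j a) \<le> sz a" for a :: "'b list"
    proof (induction a arbitrary: j)
      case (Cons x a)
      then show ?case by (cases j) (simp_all add: sz_pos le_SucI)
    qed simp
    let ?B = "(sz (0::nat) + sz a) + (sz a + sz a * (2 + sz (0::nat) + sz a))"
    have "j * (2 + sz (0::nat) + j) \<le> sz a * (2 + sz (0::nat) + sz a)"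
      using length_le_sz[of a] j by (intro mult_mono) auto
    then have "sz (List.enumerate 0 (take j a)) \<le> sz a + sz a * (2 + sz (0::nat) + sz a)"
      using szl[of 0 "take j a"] l[of a] j by simp
    then show "sz (fold ?F (take j a) (0, [])) \<le> 1 + (sz (0::nat) + sz a) + (sz a + sz a * (2 + sz (0::nat) + sz a))"
      using sz_nat_le[of j] length_le_sz[of a] j unfolding * by simp
  qed (intro PT_Pair PT_append PT_Cons PT_Suc PT_fst PT_snd PT_id PT_const polyb_add polyb_id polyb_const polyb_power polyb_mult | simp)+
  have "PT (\<lambda>a :: 'b list. List.enumerate 0 a)"
    by (rule PT_on_cong[OF id]) (simp add: *)
  then show ?thesis using PT_comp[OF assms, of UNIV] by simp
qed

lemmas PT_basic = PT_id PT_fst PT_snd PT_Pair PT_Cons PT_eq PT_less_nat PT_less_rat PT_Suc PT_If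
  PT_not PT_conj PT_disj PT_rev PT_append PT_map PT_filter PT_concat PT_length PT_mem PT_enumerate PT_const

lemmas polyb_basic = polyb_add polyb_id polyb_const polyb_power polyb_mult

section \<open>The algorithm\<close>

instantiation event :: enc
begin
definition encode_event :: "event \<Rightarrow> val" where "encode_event = enc_event"
instance
proof
  fix x y :: event
  show "encode x = encode y \<longleftrightarrow> x = y"
    by (cases x; cases y) (simp_all add: encode_event_def enc_nat_def)
qed
end

lemma PT_Move [intro]: "PT_on D f \<Longrightarrow> PT_on D (\<lambda>a. Move (f a))"
  using PT_Pair[OF PT_const[of D "0::nat"], of f] unfolding PT_on_def
  by (simp add: encode_event_def encode_nat_def)

lemma PT_Pick [intro]: "PT_on D f \<Longrightarrow> PT_on D (\<lambda>a. Pick (f a))"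
  using PT_Pair[OF PT_const[of D "1::nat"], of f] unfolding PT_on_def
  by (simp add: encode_event_def encode_nat_def)

lemma PT_Drop [intro]: "PT_on D f \<Longrightarrow> PT_on D (\<lambda>a. Drop (f a))"
  using PT_Pair[OF PT_const[of D "2::nat"], of f] unfolding PT_on_def
  by (simp add: encode_event_def encode_nat_def)

text \<open>Index in the instance, source and destination. The index identifies the object after
  filtering and keeps parallel requests apart.\<close>

type_synonym req = "nat \<times> nat \<times> nat"

text \<open>Start vertex on the backbone, requests carried together, and the vertices of the walk
  around the tree.\<close>

type_synonym service = "nat \<times> req list \<times> nat list"

definition lookup :: "'a list \<Rightarrow> nat \<Rightarrow> 'a \<Rightarrow> 'a" where
  "lookup xs i d = fold (\<lambda>p s. if fst p = i then snd p else s) (List.enumerate 0 xs) d"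

definition mdist :: "rat list list \<Rightarrow> nat \<Rightarrow> nat \<Rightarrow> rat" where
  "mdist M u v = lookup (lookup M u []) v 0"

abbreviation src :: "req \<Rightarrow> nat" where "src x \<equiv> fst (snd x)"
abbreviation dest :: "req \<Rightarrow> nat" where "dest x \<equiv> snd (snd x)"

text \<open>Orientation is ignored because a tree connects a pair in either direction, so requests
  running in opposite directions between two vertices also add up.\<close>

definition same_ends :: "req \<Rightarrow> req \<Rightarrow> bool" where
  "same_ends x y \<longleftrightarrow> (src x = src y \<and> dest x = dest y) \<or> (src x = dest y \<and> dest x = src y)"

definition cap :: "nat \<Rightarrow> req list \<Rightarrow> req list" where
  "cap k R = fold (\<lambda>x s. if length (filter (\<lambda>y. same_ends x y) s) < k then x # s else s) R []"

definition induced :: "nat list \<Rightarrow> req list \<Rightarrow> req list" where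
  "induced W R = filter (\<lambda>x. src x \<in> set W \<and> dest x \<in> set W) R"

text \<open>The test \<open>b \<notin> set s\<close> is vacuous on duplicate-free lists without \<open>b\<close>; it limits the growth to one element on
  all others, so that the running time bound needs no invariant.\<close>

definition ins :: "nat \<Rightarrow> nat \<Rightarrow> nat list \<Rightarrow> nat list" where
  "ins a b z = rev (fold (\<lambda>x s. if x = a \<and> b \<notin> set s then b # x # s else x # s) z [])"

definition grow :: "nat \<times> nat \<Rightarrow> nat list \<Rightarrow> nat list" where
  "grow e z =
     (if fst e \<in> set z \<and> snd e \<notin> set z then ins (fst e) (snd e) z
      else if snd e \<in> set z \<and> fst e \<notin> set z then ins (snd e) (fst e) z else z)"

text \<open>The vertex list serves as a counter: while vertices are missing, one pass over the edges
  attaches at least one of them, so no search of the tree has to be programmed.\<close>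

definition tree_tour :: "nat list \<times> (nat \<times> nat) list \<Rightarrow> nat \<Rightarrow> nat list" where
  "tree_tour T v = fold (\<lambda>_ z. fold grow (snd T) z) (fst T) [v]"

definition nearest :: "rat list list \<Rightarrow> nat list \<Rightarrow> nat \<Rightarrow> nat \<Rightarrow> nat" where
  "nearest M z v r = fold (\<lambda>u b. if mdist M u v < mdist M b v then u else b) z r"

definition backbone :: "rat list list \<Rightarrow> nat \<Rightarrow> req list \<Rightarrow> nat list" where
  "backbone M r R =
     fold (\<lambda>x z. if src x \<in> set z then z else ins (nearest M z (src x) r) (src x) z) R [r]"

text \<open>An object whose source is its destination needs no transport. Without such pairs every
  request joins two different vertices, as trimming requires.\<close>

definition requests :: "(nat \<times> nat) list \<Rightarrow> req list" where
  "requests ps = filter (\<lambda>x. src x \<noteq> dest x) (List.enumerate 0 ps)"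

text \<open>A tree is attached to the backbone at a source of one of its requests.\<close>

definition some_src :: "req list \<Rightarrow> nat" where
  "some_src R = fold (\<lambda>x _. src x) R 0"

definition service_of :: "nat list \<times> (nat \<times> nat) list \<Rightarrow> req list \<Rightarrow> service" where
  "service_of T R =
     (some_src (induced (fst T) R), induced (fst T) R,
      tree_tour T (some_src (induced (fst T) R)))"

type_synonym oracle_inst = "rat list list \<times> (nat \<times> nat) list \<times> nat"

text \<open>Only requests that survive the capping are served; the hidden ones stay in the list for
  later rounds. On an empty list the step idles, so a fixed number of rounds can be run without
  posing an infeasible query.\<close>

definition greedy_step ::
  "(oracle_inst \<Rightarrow> nat list \<times> (nat \<times> nat) list) \<Rightarrow> rat list list \<Rightarrow> nat \<Rightarrow>
   req list \<times> service list \<Rightarrow> req list \<times> service list" where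
  "greedy_step orc M k s =
     (if fst s = [] then s
      else (filter (\<lambda>x. x \<notin> set (induced (fst (orc (M, map snd (cap k (fst s)), k))) (cap k (fst s)))) (fst s),
            service_of (orc (M, map snd (cap k (fst s)), k)) (cap k (fst s)) # snd s))"

text \<open>All objects are on board before the second walk starts, so the order of sources and
  destinations along the walk does not matter. The last move returns to the start vertex, where the
  next service may begin.\<close>

definition perform :: "service \<Rightarrow> event list" where
  "perform S =
     concat (map (\<lambda>u. Move u # map (\<lambda>x. Pick (fst x)) (filter (\<lambda>x. src x = u) (fst (snd S)))) (snd (snd S))) @
     concat (map (\<lambda>u. Move u # map (\<lambda>x. Drop (fst x)) (filter (\<lambda>x. dest x = u) (fst (snd S)))) (snd (snd S))) @
     [Move (fst S)]"

definition schedule :: "nat \<Rightarrow> nat list \<Rightarrow> service list \<Rightarrow> event list" where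
  "schedule r Z SS =
     concat (map (\<lambda>v. Move v # concat (map (\<lambda>S. perform S) (filter (\<lambda>S. fst S = v) SS))) Z) @ [Move r]"

text \<open>The list of pairs counts the rounds: each round on a nonempty list of requests serves at
  least one of them.\<close>

definition dar ::
  "(oracle_inst \<Rightarrow> nat list \<times> (nat \<times> nat) list) \<Rightarrow> oracle_inst \<times> nat \<Rightarrow> event list" where
  "dar orc a =
     schedule (snd a) (backbone (fst (fst a)) (snd a) (requests (fst (snd (fst a)))))
       (snd (fold (\<lambda>_ s. greedy_step orc (fst (fst a)) (snd (snd (fst a))) s) (fst (snd (fst a)))
          (requests (fst (snd (fst a))), [])))"

subsection \<open>Running time\<close>

lemma PT_lookup:
  assumes "PT_on D xs" "PT_on D i" "PT_on D d"
  shows "PT_on D (\<lambda>a. lookup (xs a) (i a) (d a))"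
proof (rule PT_comp3[OF _ assms])
  show "PT (\<lambda>p :: 'b list \<times> nat \<times> 'b. lookup (fst p) (fst (snd p)) (snd (snd p)))"
    unfolding lookup_def
  proof (rule PT_fold[where G = "\<lambda>n. n"])
    fix x :: "nat \<times> 'b" and s :: 'b and a :: "'b list \<times> nat \<times> 'b"
    show "sz (if fst x = fst (snd a) then snd x else s) \<le> sz s + (sz x + sz a)"
      by (cases x) auto
  qed (intro PT_basic polyb_basic)+
qed

lemma PT_mdist:
  assumes "PT_on D M" "PT_on D u" "PT_on D v"
  shows "PT_on D (\<lambda>a. mdist (M a) (u a) (v a))"
  unfolding mdist_def by (intro PT_lookup assms PT_const)

lemma PT_cap:
  assumes "PT_on D k" "PT_on D R"
  shows "PT_on D (\<lambda>a. cap (k a) (R a))"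
proof (rule PT_comp2[OF _ assms])
  show "PT (\<lambda>p. cap (fst p) (snd p))"
    unfolding cap_def same_ends_def
    by (rule PT_fold[where G = "\<lambda>n. n + 1"]; (intro PT_basic polyb_basic)?; simp)
qed

lemma PT_induced:
  assumes "PT_on D W" "PT_on D R"
  shows "PT_on D (\<lambda>a. induced (W a) (R a))"
  by (rule PT_comp2[OF _ assms]) (unfold induced_def, intro PT_basic)

lemma PT_ins:
  assumes "PT_on D u" "PT_on D v" "PT_on D z"
  shows "PT_on D (\<lambda>a. ins (u a) (v a) (z a))"
proof (rule PT_comp3[OF _ assms])
  show "PT (\<lambda>p. ins (fst p) (fst (snd p)) (snd (snd p)))"
    unfolding ins_def
  proof (intro PT_rev, rule PT_fold[where G = "\<lambda>n. n + 2"])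
    fix x :: nat and s :: "nat list" and a :: "nat \<times> nat \<times> nat list"
    show "sz (if x = fst a \<and> fst (snd a) \<notin> set s then fst (snd a) # x # s else x # s) \<le> sz s + (sz x + sz a + 2)"
      by (cases a) auto
  qed (intro PT_basic polyb_basic)+
qed

lemma sz_rev [simp]: "sz (rev xs) = sz xs"
proof (induction xs)
  case (Cons x xs)
  then show ?case using sz_append[of "rev xs" "[x]"] by simp
qed simp

lemma sz_ins: "sz (ins a b z) \<le> sz z + sz b + 1"
proof -
  have "sz (fold (\<lambda>x s. if x = a \<and> b \<notin> set s then b # x # s else x # s) z s) + 1
      \<le> sz z + sz s + (if b \<in> set s then 0 else sz b + 1)" for s
  proof (induction z arbitrary: s)
    case (Cons x z)
    then show ?case
      using Cons[of "b # x # s"] Cons[of "x # s"] by (auto split: if_splits)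
  qed simp
  from this[of "[]"] show ?thesis by (simp add: ins_def)
qed

lemma sz_grow: "sz (grow e z) \<le> sz z + sz e"
  using sz_ins[of "fst e" "snd e" z] sz_ins[of "snd e" "fst e" z]
  by (cases e) (auto simp: grow_def)

lemma sz_fold_grow: "sz (fold grow F z) \<le> sz z + sz F"
proof (induction F arbitrary: z)
  case (Cons e F)
  have "sz (fold grow F (grow e z)) \<le> sz (grow e z) + sz F" by (rule Cons.IH)
  with sz_grow[of e z] show ?case by simp
qed simp

lemma PT_grow:
  assumes "PT_on D e" "PT_on D z"
  shows "PT_on D (\<lambda>a. grow (e a) (z a))"
  by (rule PT_comp2[OF _ assms]) (unfold grow_def, intro PT_ins PT_basic)

lemma PT_tree_tour:
  assumes "PT_on D T" "PT_on D v"
  shows "PT_on D (\<lambda>a. tree_tour (T a) (v a))"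
proof (rule PT_comp2[OF _ assms])
  have *: "PT (\<lambda>p. fold grow (fst p) (snd p))"
  proof (rule PT_fold[where F = "\<lambda>x s a. grow x s" and G = "\<lambda>n. n"])
    fix x s and a :: "(nat \<times> nat) list \<times> nat list"
    show "sz (grow x s) \<le> sz s + (sz x + sz a)" using sz_grow[of x s] by simp
  qed (intro PT_basic PT_grow polyb_basic)+
  show "PT (\<lambda>p. tree_tour (fst p) (snd p))"
    unfolding tree_tour_def
  proof (rule PT_fold[where G = "\<lambda>n. n"])
    fix x :: nat and s and a :: "(nat list \<times> (nat \<times> nat) list) \<times> nat"
    show "sz (fold grow (snd (fst a)) s) \<le> sz s + (sz x + sz a)"
      using sz_fold_grow[of "snd (fst a)" s] by (cases a) auto
  qed (intro PT_comp2[OF *] PT_basic polyb_basic)+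
qed

lemma PT_nearest:
  assumes "PT_on D M" "PT_on D z" "PT_on D v" "PT_on D r"
  shows "PT_on D (\<lambda>a. nearest (M a) (z a) (v a) (r a))"
proof (rule PT_comp4[OF _ assms])
  show "PT (\<lambda>p. nearest (fst p) (fst (snd p)) (fst (snd (snd p))) (snd (snd (snd p))))"
    unfolding nearest_def
    by (rule PT_fold[where G = "\<lambda>n. n"]; (intro PT_mdist PT_basic polyb_basic)?; simp)
qed

lemma PT_backbone:
  assumes "PT_on D M" "PT_on D r" "PT_on D R"
  shows "PT_on D (\<lambda>a. backbone (M a) (r a) (R a))"
proof (rule PT_comp3[OF _ assms])
  show "PT (\<lambda>p. backbone (fst p) (fst (snd p)) (snd (snd p)))"
    unfolding backbone_def
  proof (rule PT_fold[where G = "\<lambda>n. n + 1"])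
    fix x :: req and z and a :: "rat list list \<times> nat \<times> req list"
    show "sz (if src x \<in> set z then z else ins (nearest (fst a) z (src x) (fst (snd a))) (src x) z)
        \<le> sz z + (sz x + sz a + 1)"
      using sz_ins[of "nearest (fst a) z (src x) (fst (snd a))" "src x" z] by (cases x) auto
  qed (intro PT_ins PT_nearest PT_basic polyb_basic)+
qed

lemma PT_requests: "PT_on D ps \<Longrightarrow> PT_on D (\<lambda>a. requests (ps a))"
  unfolding requests_def by (intro PT_basic)

lemma PT_some_src:
  assumes "PT_on D R" shows "PT_on D (\<lambda>a. some_src (R a))"
proof -
  have "PT some_src"
    unfolding some_src_def
  proof (rule PT_fold[where G = "\<lambda>n. n"])
    fix x :: req and s :: nat and a :: "req list"
    show "sz (src x) \<le> sz s + (sz x + sz a)" by (cases x) auto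
  qed (intro PT_basic polyb_basic)+
  then show ?thesis using PT_comp[OF assms, of UNIV] by simp
qed

lemma PT_service_of:
  assumes "PT_on D T" "PT_on D R"
  shows "PT_on D (\<lambda>a. service_of (T a) (R a))"
  unfolding service_of_def by (intro PT_basic PT_some_src PT_tree_tour PT_induced assms)

lemma PT_perform: "PT_on D S \<Longrightarrow> PT_on D (\<lambda>a. perform (S a))"
proof -
  assume S: "PT_on D S"
  have "PT perform" unfolding perform_def by (intro PT_basic PT_Move PT_Pick PT_Drop)
  then show ?thesis using PT_comp[OF S, of UNIV] by simp
qed

lemma PT_schedule:
  assumes "PT_on D r" "PT_on D Z" "PT_on D SS"
  shows "PT_on D (\<lambda>a. schedule (r a) (Z a) (SS a))"
  by (rule PT_comp3[OF _ assms])
     (unfold schedule_def, intro PT_basic PT_Move PT_perform)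

lemma fold_const: "fold (\<lambda>_ s. g s) xs s = (g ^^ length xs) s"
  by (induction xs arbitrary: s) (simp_all add: funpow_swap1)

lemma sz_filter: "sz (filter P xs) \<le> sz xs"
  by (induction xs) auto

text \<open>The list of requests only shrinks, so every query is polynomial in the input, and with
  it every answer and every service added. Thus the state stays polynomial although the step applies
  an oracle.\<close>

lemma PT_greedy:
  fixes orc :: "oracle_inst \<Rightarrow> nat list \<times> (nat \<times> nat) list" and D :: "(oracle_inst \<times> nat) set"
  defines "st \<equiv> \<lambda>j a. (greedy_step orc (fst (fst a)) (snd (snd (fst a))) ^^ j)
      (requests (fst (snd (fst a))), [])"
  assumes orc: "PT_on I orc"
    and dom: "\<And>a j. a \<in> D \<Longrightarrow> j < length (fst (snd (fst a))) \<Longrightarrow> fst (st j a) \<noteq> [] \<Longrightarrow>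
      (fst (fst a), map snd (cap (snd (snd (fst a))) (fst (st j a))), snd (snd (fst a))) \<in> I"
  shows "PT_on D (\<lambda>a. fold (\<lambda>_ s. greedy_step orc (fst (fst a)) (snd (snd (fst a))) s)
      (fst (snd (fst a))) (requests (fst (snd (fst a))), []))"
proof -
  define arg :: "req list \<times> oracle_inst \<times> nat \<Rightarrow> oracle_inst" where
    "arg p = (fst (fst (snd p)), map snd (cap (snd (snd (fst (snd p)))) (fst p)), snd (snd (fst (snd p))))" for p
  have arg: "PT_on E arg" for E
    unfolding arg_def by (intro PT_basic PT_cap)
  have orc': "PT_on {p. arg p \<in> I} (\<lambda>p. orc (arg p))"
    by (rule PT_comp[OF arg orc]) simp
  define svc where "svc p = service_of (orc (arg p)) (cap (snd (snd (fst (snd p)))) (fst p))" for p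
  have svc: "PT_on {p. arg p \<in> I} svc"
    unfolding svc_def by (intro PT_service_of PT_cap orc' PT_basic)
  define rest where "rest p = filter (\<lambda>x. x \<notin> set (induced (fst (orc (arg p))) (cap (snd (snd (fst (snd p)))) (fst p)))) (fst p)" for p
  have "PT (\<lambda>p :: req list \<times> req list. filter (\<lambda>x. x \<notin> set (fst p)) (snd p))"
    by (intro PT_basic)
  then have rest: "PT_on {p. arg p \<in> I} rest"
    unfolding rest_def by (rule PT_comp2) (intro PT_induced PT_cap orc' PT_basic)+
  have step: "greedy_step orc (fst (fst a)) (snd (snd (fst a))) s =
      (if fst s = [] then s else (rest (fst s, a), svc (fst s, a) # snd s))" for a s
    unfolding greedy_step_def rest_def svc_def arg_def by simp
  \<comment> \<open>Nothing is demanded when the list of requests is empty, because the step then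
    leaves the oracle alone.\<close>
  let ?E = "{p :: (nat \<times> nat) \<times> (req list \<times> service list) \<times> oracle_inst \<times> nat.
      fst (fst (snd p)) \<noteq> [] \<longrightarrow> arg (fst (fst (snd p)), snd (snd p)) \<in> I}"
  obtain c where c: "\<And>p. arg p \<in> I \<Longrightarrow> sz (svc p) \<le> (sz p + 2) ^ c"
    by (rule PT_on_sz[OF svc], rule that) blast
  have "PT_on D (\<lambda>a. requests (fst (snd (fst a))))" by (intro PT_requests PT_basic)
  then obtain d where d: "\<And>a. a \<in> D \<Longrightarrow> sz (requests (fst (snd (fst a)))) \<le> (sz a + 2) ^ d"
    by (rule PT_on_sz) (rule that)
  let ?S = "\<lambda>n. ((n + 2) ^ d + n + 3) ^ c + 1"
  let ?B = "\<lambda>n. (n + 2) ^ d + n * ?S n + 2"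
  show ?thesis
  proof (rule PT_fold_on[where E = ?E and B = ?B])
    show "PT_on ?E (\<lambda>p. greedy_step orc (fst (fst (snd (snd p)))) (snd (snd (fst (snd (snd p))))) (fst (snd p)))"
      unfolding step
      by (rule PT_If; (intro PT_basic PT_comp[OF _ rest] PT_comp[OF _ svc])?; (auto; fail)?)
    show "PT_on D (\<lambda>a. fst (snd (fst a)))" "PT_on D (\<lambda>a. (requests (fst (snd (fst a))), [] :: service list))"
      by (intro PT_requests PT_basic)+
    show "polyb ?B" by (intro polyb_basic)
    fix a j assume a: "a \<in> D"
    {
      assume j: "j < length (fst (snd (fst a)))"
      show "(fst (snd (fst a)) ! j, fold (\<lambda>_ s. greedy_step orc (fst (fst a)) (snd (snd (fst a))) s)
          (take j (fst (snd (fst a)))) (requests (fst (snd (fst a))), []), a) \<in> ?E"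
        using dom[OF a j] j unfolding fold_const by (simp add: arg_def st_def)
    }
    assume j: "j \<le> length (fst (snd (fst a)))"
    then have "sz (fst (st j a)) \<le> (sz a + 2) ^ d \<and> sz (snd (st j a)) \<le> 1 + j * ?S (sz a)"
    proof (induction j)
      case 0
      then show ?case using d[OF a] by (simp add: st_def)
    next
      case (Suc j)
      then have IH: "sz (fst (st j a)) \<le> (sz a + 2) ^ d" "sz (snd (st j a)) \<le> 1 + j * ?S (sz a)" by auto
      have S: "st (Suc j) a = (if fst (st j a) = [] then st j a else (rest (fst (st j a), a), svc (fst (st j a), a) # snd (st j a)))"
        unfolding step[symmetric] st_def by simp
      show ?case
      proof (cases "fst (st j a) = []")
        case True
        then show ?thesis unfolding S using IH by (simp add: trans_le_add2)
      next
        case False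
        then have "arg (fst (st j a), a) \<in> I" using dom[OF a, of j] Suc.prems by (simp add: arg_def)
        then have "sz (svc (fst (st j a), a)) \<le> (1 + sz (fst (st j a)) + sz a + 2) ^ c" using c by fastforce
        also have "\<dots> \<le> ((sz a + 2) ^ d + sz a + 3) ^ c" using IH(1) by (intro power_mono) auto
        finally have "sz (svc (fst (st j a), a)) \<le> ((sz a + 2) ^ d + sz a + 3) ^ c" .
        moreover have "sz (rest (fst (st j a), a)) \<le> sz (fst (st j a))"
          unfolding rest_def using sz_filter by (metis fst_conv)
        ultimately show ?thesis unfolding S using IH False by (simp add: algebra_simps)
      qed
    qed
    moreover have "j * ?S (sz a) \<le> sz a * ?S (sz a)"
    proof (rule mult_le_mono1)
      have "sz (fst (snd (fst a))) \<le> sz a" by (cases a) (auto simp: sz_def)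
      then show "j \<le> sz a" using j length_le_sz[of "fst (snd (fst a))"] by simp
    qed
    ultimately have "1 + sz (fst (st j a)) + sz (snd (st j a)) \<le> ?B (sz a)" by linarith
    then show "sz (fold (\<lambda>_ s. greedy_step orc (fst (fst a)) (snd (snd (fst a))) s)
          (take j (fst (snd (fst a)))) (requests (fst (snd (fst a))), [])) \<le> ?B (sz a)"
      using j unfolding fold_const by (cases "st j a") (simp add: st_def min_def)
  qed
qed

lemma PT_dar:
  fixes orc :: "oracle_inst \<Rightarrow> nat list \<times> (nat \<times> nat) list" and D :: "(oracle_inst \<times> nat) set"
  assumes "PT_on I orc"
    and "\<And>M ps k r j R SS. ((M, ps, k), r) \<in> D \<Longrightarrow> j < length ps \<Longrightarrow>
      (greedy_step orc M k ^^ j) (requests ps, []) = (R, SS) \<Longrightarrow> R \<noteq> [] \<Longrightarrow> (M, map snd (cap k R), k) \<in> I"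
  shows "PT_on D (dar orc)"
proof -
  have "PT_on D (\<lambda>a. dar orc a)"
    unfolding dar_def
  proof (intro PT_schedule PT_backbone PT_requests PT_basic PT_greedy[OF assms(1)])
    fix a :: "oracle_inst \<times> nat" and j
    obtain M ps k r where a: "a = ((M, ps, k), r)" by (metis surj_pair)
    assume "a \<in> D" "j < length (fst (snd (fst a)))"
      "fst ((greedy_step orc (fst (fst a)) (snd (snd (fst a))) ^^ j) (requests (fst (snd (fst a))), [])) \<noteq> []"
    then show "(fst (fst a), map snd (cap (snd (snd (fst a))) (fst ((greedy_step orc (fst (fst a)) (snd (snd (fst a))) ^^ j) (requests (fst (snd (fst a))), [])))), snd (snd (fst a))) \<in> I"
      using assms(2)[of M ps k r j] unfolding a by (metis fst_conv prod.collapse snd_conv)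
  qed
  then show ?thesis by simp
qed

section \<open>Walks in metric spaces\<close>

fun walk_len :: "('a \<Rightarrow> 'a \<Rightarrow> real) \<Rightarrow> 'a list \<Rightarrow> real" where
  "walk_len d (x # y # zs) = d x y + walk_len d (y # zs)"
| "walk_len d _ = 0"

lemma walk_len_append: "walk_len d (xs @ v # ys) = walk_len d (xs @ [v]) + walk_len d (v # ys)"
  by (induction xs rule: induct_list012) auto

lemma walk_len_nth: "walk_len d xs = (\<Sum>j<length xs - 1. d (xs ! j) (xs ! Suc j))"
proof (induction d xs rule: walk_len.induct)
  case (1 d x y zs)
  then show ?case by (simp add: lessThan_Suc_eq_insert_0 sum.reindex image_iff)
qed auto

lemma walk_len_segment: "l \<le> r \<Longrightarrow> r < length xs \<Longrightarrow>
   walk_len d (take (r - l + 1) (drop l xs)) = (\<Sum>j\<in>{l..<r}. d (xs ! j) (xs ! Suc j))"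
proof -
  assume a: "l \<le> r" "r < length xs"
  have "(\<Sum>j\<in>{l..<r}. d (xs ! j) (xs ! Suc j)) = (\<Sum>j<r - l. d (xs ! (j + l)) (xs ! Suc (j + l)))"
    using sum.shift_bounds_nat_ivl[of "\<lambda>j. d (xs ! j) (xs ! Suc j)" 0 l "r - l"] a
    by (simp add: atLeast0LessThan)
  also have "\<dots> = walk_len d (take (r - l + 1) (drop l xs))"
    unfolding walk_len_nth using a by (intro sum.cong) (auto simp: add.commute)
  finally show ?thesis by simp
qed

context Metric_space
begin

lemma walk_len_nonneg: "0 \<le> walk_len d xs"
  by (induction xs rule: induct_list012) auto

text \<open>Keep the last visit to each point of \<open>X\<close>; by the triangle inequality,
  skipping the other points makes the walk no longer. The start \<open>a\<close> is kept so that the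
  induction compares walks with a common beginning.\<close>

lemma walk_shortcut:
  assumes "insert a (set ws) \<subseteq> M"
  shows "\<exists>ys. distinct ys \<and> set ys = X \<inter> set ws \<and> walk_len d (a # ys) \<le> walk_len d (a # ws)"
  using assms
proof (induction ws arbitrary: a)
  case (Cons w ws)
  show ?case
  proof (cases "w \<in> X \<and> w \<notin> set ws")
    case True
    obtain ys where "distinct ys" "set ys = X \<inter> set ws" "walk_len d (w # ys) \<le> walk_len d (w # ws)"
      using Cons.IH[of w] Cons.prems by auto
    with True show ?thesis by (intro exI[of _ "w # ys"]) auto
  next
    case False
    obtain ys where ys: "distinct ys" "set ys = X \<inter> set ws" "walk_len d (a # ys) \<le> walk_len d (a # ws)"
      using Cons.IH[of a] Cons.prems by auto
    have "walk_len d (a # ws) \<le> walk_len d (a # w # ws)"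
    proof (cases ws)
      case (Cons b bs)
      have "d a b \<le> d a w + d w b" using Cons.prems Cons by (intro triangle) auto
      then show ?thesis using Cons by simp
    qed simp
    with ys False show ?thesis by (intro exI[of _ ys]) auto
  qed
qed simp

lemma walk_len_separated:
  assumes "distinct ys" "\<And>u v. u \<in> set ys \<Longrightarrow> v \<in> set ys \<Longrightarrow> u \<noteq> v \<Longrightarrow> x \<le> d u v"
  shows "x * real (length ys - 1) \<le> walk_len d ys"
  using assms
proof (induction ys rule: induct_list012)
  case (3 a b ys)
  then have "x * real (length (b # ys) - 1) \<le> walk_len d (b # ys)" by auto
  moreover have "x \<le> d a b" using 3 by auto
  ultimately show ?case by (simp add: algebra_simps)
qed auto

lemma walk_visits_separated:
  assumes "set ws \<subseteq> M" "X \<subseteq> set ws" "X \<noteq> {}"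
    and "\<And>u v. u \<in> X \<Longrightarrow> v \<in> X \<Longrightarrow> u \<noteq> v \<Longrightarrow> x \<le> d u v"
  shows "x * real (card X - 1) \<le> walk_len d ws"
proof -
  obtain a as where ws: "ws = a # as" using assms(2,3) by (cases ws) auto
  obtain ys where ys: "distinct ys" "set ys = X \<inter> set ws" "walk_len d (a # ys) \<le> walk_len d (a # ws)"
    using walk_shortcut[of a ws X] assms(1) ws by auto
  have "walk_len d (a # ws) = walk_len d ws" using ws assms(1) by simp
  moreover have "walk_len d ys \<le> walk_len d (a # ys)" by (cases ys) auto
  moreover have "set ys = X" using ys assms(2) by auto
  moreover have "x * real (length ys - 1) \<le> walk_len d ys"
    using ys(1) assms(4) \<open>set ys = X\<close> by (intro walk_len_separated) auto
  moreover have "length ys = card X" using ys(1) \<open>set ys = X\<close> distinct_card by fastforce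
  ultimately show ?thesis using ys(3) by simp
qed

text \<open>Every point joins its predecessors at cost \<open>c\<close>. The cheapest of \<open>n\<close> points costs at most
  an \<open>n\<close>-th of any walk through all of them, because they are separated by that cost.\<close>

lemma online_connection_bound:
  fixes J :: "nat set"
  assumes "finite J" "set ws \<subseteq> M" "r \<in> set ws" "v ` J \<subseteq> set ws"
    and "\<And>i j. i \<in> J \<Longrightarrow> j \<in> J \<Longrightarrow> i < j \<Longrightarrow> c j \<le> d (v i) (v j)"
    and "\<And>j. j \<in> J \<Longrightarrow> c j \<le> d r (v j)"
  shows "sum c J \<le> walk_len d ws * harm (card J)"
  using assms
proof (induction "card J" arbitrary: J)
  case 0
  then show ?case by (simp add: harm_def)
next
  case (Suc n)
  then have "J \<noteq> {}" by auto
  obtain j0 where j0: "j0 \<in> J" "\<And>j. j \<in> J \<Longrightarrow> c j0 \<le> c j"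
    using arg_min_if_finite[OF Suc.prems(1) \<open>J \<noteq> {}\<close>, of c] by (metis not_le)
  have sep: "c j0 \<le> d (v i) (v j)" if "i \<in> J" "j \<in> J" "i \<noteq> j" for i j
  proof (cases "i < j")
    case True
    then show ?thesis using Suc.prems(5)[of i j] j0(2)[of j] that by linarith
  next
    case False
    then have "j < i" using that by simp
    then have "c j0 \<le> d (v j) (v i)" using Suc.prems(5)[of j i] j0(2)[of i] that by linarith
    then show ?thesis by (simp add: commute)
  qed
  have "c j0 * real (card J) \<le> walk_len d ws"
  proof (cases "c j0 \<le> 0")
    case True
    then show ?thesis using walk_len_nonneg[of ws] by (metis mult_nonpos_nonneg of_nat_0_le_iff order_trans)
  next
    case False
    have M: "v i \<in> M" if "i \<in> J" for i using that Suc.prems by auto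
    have inj: "inj_on v J"
      using sep False M by (intro inj_onI) (metis mdist_zero)
    have r: "r \<notin> v ` J"
      using Suc.prems(6) j0(2) False M by (metis imageE mdist_zero order_trans)
    \<comment> \<open>Positive separation makes \<open>v\<close> injective and keeps
      \<open>r\<close> apart from its values. Adding \<open>r\<close> gives
      \<open>card J + 1\<close> points, which makes up for the 1 subtracted when steps are counted
      instead of points.\<close>
    have "c j0 * real (card (insert r (v ` J)) - 1) \<le> walk_len d ws"
    proof (rule walk_visits_separated)
      fix x y assume "x \<in> insert r (v ` J)" "y \<in> insert r (v ` J)" "x \<noteq> y"
      then show "c j0 \<le> d x y"
        using sep Suc.prems(6) j0(2) commute by (smt (verit) imageE insert_iff)
    qed (use Suc.prems in auto)
    then show ?thesis using inj r Suc.prems(1) by (simp add: card_image)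
  qed
  then have 1: "c j0 \<le> walk_len d ws / real (card J)"
    using \<open>J \<noteq> {}\<close> Suc.prems(1) by (simp add: pos_le_divide_eq card_gt_0_iff)
  have "sum c (J - {j0}) \<le> walk_len d ws * harm (card (J - {j0}))"
    using Suc.hyps(2) Suc.prems j0(1) by (intro Suc.hyps(1)) auto
  moreover have "card J = Suc (card (J - {j0}))" using Suc.prems(1) j0(1) by (metis card.remove)
  ultimately show ?case
    using 1 sum.remove[OF Suc.prems(1) j0(1), of c]
    by (simp add: harm_Suc algebra_simps divide_inverse)
qed

end

section \<open>Intervals of bounded depth\<close>

text \<open>Split at a median of the right ends: the intervals through the median form one group of at
  most \<open>k\<close>, and the remaining ones fall into two halves living on disjoint ranges.\<close>

lemma interval_groups_bound:
  fixes w :: "nat \<Rightarrow> real" and a b :: "'i \<Rightarrow> nat"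
  assumes w: "\<And>j. 0 \<le> w j"
    and S: "finite S" "\<And>i. i \<in> S \<Longrightarrow> l \<le> a i \<and> a i \<le> b i \<and> b i \<le> r"
    and depth: "\<And>x. card {i \<in> S. a i \<le> x \<and> x \<le> b i} \<le> k"
    and group: "\<And>l' r' G. G \<subseteq> S \<Longrightarrow> G \<noteq> {} \<Longrightarrow> card G \<le> k \<Longrightarrow> l \<le> l' \<Longrightarrow> l' \<le> r' \<Longrightarrow> r' \<le> r \<Longrightarrow>
      (\<And>i. i \<in> G \<Longrightarrow> l' \<le> a i \<and> b i \<le> r') \<Longrightarrow> \<mu> * real (card G) \<le> sum w {l'..<r'}"
  shows "\<mu> * real (card S) \<le> real (floorlog 2 (card S)) * sum w {l..<r}"
  using S depth group
proof (induction "card S" arbitrary: S l r rule: less_induct)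
  case less
  show ?case
  proof (cases "S = {}")
    case True
    then show ?thesis by (simp add: floorlog_def)
  next
    case False
    define P where "P x \<longleftrightarrow> card S \<le> 2 * card {i \<in> S. b i \<le> x}" for x
    have "{i \<in> S. b i \<le> r} = S" using less.prems(2) by auto
    then have "P r" by (simp add: P_def)
    \<comment> \<open>By minimality fewer than half of the intervals end before \<open>x\<close>; by
      \<open>P x\<close> at most half of them begin after \<open>x\<close>.\<close>
    define x where "x = (LEAST x. P x)"
    have Px: "P x" and x_le: "x \<le> r" using \<open>P r\<close> unfolding x_def by (auto intro: LeastI Least_le)
    define A where "A = {i \<in> S. b i < x}"
    define G where "G = {i \<in> S. a i \<le> x \<and> x \<le> b i}"
    define B where "B = {i \<in> S. x < a i}"
    have fin: "finite A" "finite G" "finite B" using less.prems(1) by (auto simp: A_def G_def B_def)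
    have S_eq: "S = A \<union> (G \<union> B)" using less.prems(2) by (force simp: A_def G_def B_def)
    have dis: "A \<inter> (G \<union> B) = {}" "G \<inter> B = {}" using less.prems(2) by (force simp: A_def G_def B_def)+
    have card_S: "card S = card A + (card G + card B)"
      unfolding S_eq using fin dis by (subst card_Un_disjoint, auto)+
    have cA: "2 * card A < card S"
    proof (cases x)
      case 0
      then have "A = {}" by (simp add: A_def)
      then show ?thesis using False less.prems(1) by (simp add: card_gt_0_iff)
    next
      case (Suc y)
      then have "\<not> P y" unfolding x_def using not_less_Least[of y P] by simp
      moreover have "A = {i \<in> S. b i \<le> y}" using Suc by (auto simp: A_def)
      ultimately show ?thesis by (simp add: P_def)
    qed
    have cB: "2 * card B \<le> card S"
    proof -
      have "B \<subseteq> S - {i \<in> S. b i \<le> x}" using less.prems(2) by (force simp: B_def)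
      then have "card B \<le> card (S - {i \<in> S. b i \<le> x})" using less.prems(1) by (intro card_mono) auto
      also have "\<dots> = card S - card {i \<in> S. b i \<le> x}" using less.prems(1) by (intro card_Diff_subset) auto
      finally show ?thesis using Px unfolding P_def by linarith
    qed
    obtain i where i: "i \<in> S" using False by auto
    have lx: "l \<le> x"
    proof (rule ccontr)
      assume "\<not> l \<le> x"
      then have "{i \<in> S. b i \<le> x} = {}" using less.prems(2) by fastforce
      then have "card S = 0" using Px unfolding P_def by (simp only: card.empty)
      then show False using False less.prems(1) by simp
    qed
    define h where "h = floorlog 2 (card S)"
    \<comment> \<open>Halving a number removes one binary digit.\<close>
    have sub: "Suc (floorlog 2 (card C)) \<le> h" if "2 * card C \<le> card S" for C :: "'i set"
    proof -
      have "0 < card S" using False less.prems(1) by (simp add: card_gt_0_iff)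
      then have "h = Suc (floorlog 2 (card S div 2))"
        unfolding h_def using compute_floorlog[of 2 "card S"] by simp
      moreover have "floorlog 2 (card C) \<le> floorlog 2 (card S div 2)"
        using that by (intro floorlog_mono) auto
      ultimately show ?thesis by simp
    qed
    have sub': "real (floorlog 2 (card C)) \<le> real h - 1" if "2 * card C \<le> card S" for C :: "'i set"
      using sub[OF that] by linarith
    have "0 \<le> sum w {l..<x}" "0 \<le> sum w {x..<r}" using w by (simp_all add: sum_nonneg)
    have A: "\<mu> * real (card A) \<le> (real h - 1) * sum w {l..<x}"
    proof -
      have "\<mu> * real (card A) \<le> real (floorlog 2 (card A)) * sum w {l..<x}"
      proof (rule less.hyps)
        show "card A < card S" using cA by linarith
        fix y show "card {i \<in> A. a i \<le> y \<and> y \<le> b i} \<le> k"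
          using less.prems(1) by (intro order_trans[OF card_mono less.prems(3)[of y]]) (auto simp: A_def)
      next
        fix l' r' G' assume "G' \<subseteq> A" "G' \<noteq> {}" "card G' \<le> k" "l \<le> l'" "l' \<le> r'" "r' \<le> x"
          "\<And>i. i \<in> G' \<Longrightarrow> l' \<le> a i \<and> b i \<le> r'"
        then show "\<mu> * real (card G') \<le> sum w {l'..<r'}"
          using x_le by (intro less.prems(4)) (auto simp: A_def)
      qed (use fin less.prems(2) in \<open>auto simp: A_def\<close>)
      also have "\<dots> \<le> (real h - 1) * sum w {l..<x}"
        using sub'[of A] cA \<open>0 \<le> sum w {l..<x}\<close> by (intro mult_right_mono) auto
      finally show ?thesis .
    qed
    have B: "\<mu> * real (card B) \<le> (real h - 1) * sum w {x..<r}"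
    proof -
      have "\<mu> * real (card B) \<le> real (floorlog 2 (card B)) * sum w {x..<r}"
      proof (rule less.hyps)
        show "card B < card S" using cB False less.prems(1) card_gt_0_iff[of S] by linarith
        fix y show "card {i \<in> B. a i \<le> y \<and> y \<le> b i} \<le> k"
          using less.prems(1) by (intro order_trans[OF card_mono less.prems(3)[of y]]) (auto simp: B_def)
      next
        fix l' r' G' assume "G' \<subseteq> B" "G' \<noteq> {}" "card G' \<le> k" "x \<le> l'" "l' \<le> r'" "r' \<le> r"
          "\<And>i. i \<in> G' \<Longrightarrow> l' \<le> a i \<and> b i \<le> r'"
        then show "\<mu> * real (card G') \<le> sum w {l'..<r'}"
          using lx by (intro less.prems(4)) (auto simp: B_def)
      qed (use fin less.prems(2) in \<open>auto simp: B_def\<close>)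
      also have "\<dots> \<le> (real h - 1) * sum w {x..<r}"
        using sub'[of B] cB \<open>0 \<le> sum w {x..<r}\<close> by (intro mult_right_mono) auto
      finally show ?thesis .
    qed
    have split: "sum w {l..<r} = sum w {l..<x} + sum w {x..<r}"
      using lx x_le by (simp add: sum.atLeastLessThan_concat)
    \<comment> \<open>The group through the median is charged to the whole range. This is affordable
      because both halves save one unit of the logarithm and together they cover the range exactly
      once.\<close>
    have G: "\<mu> * real (card G) \<le> sum w {l..<r}"
    proof (cases "G = {}")
      case True
      then show ?thesis using w by (simp add: sum_nonneg)
    next
      case ne: False
      have "G \<subseteq> S" by (auto simp: G_def)
      then show ?thesis
        using ne less.prems(2,3) lx x_le by (intro less.prems(4)) (auto simp: G_def)
    qed
    have "\<mu> * real (card S) = \<mu> * real (card A) + \<mu> * real (card G) + \<mu> * real (card B)"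
      unfolding card_S by (simp add: algebra_simps)
    also have "\<dots> \<le> (real h - 1) * sum w {l..<x} + sum w {l..<r} + (real h - 1) * sum w {x..<r}"
      using A B G by linarith
    also have "\<dots> = real h * sum w {l..<r}" unfolding split by (simp add: algebra_simps)
    finally show ?thesis unfolding h_def .
  qed
qed

section \<open>Trees\<close>

lemma is_tree_singleton: "is_tree {v} {}"
  by (auto simp: is_tree_def is_cycle_def intro!: exI[of _ 0])

text \<open>On a cyclic list of length at least 3 the predecessor and the successor of an entry
  differ. This is used to keep a new leaf off all cycles.\<close>

lemma is_cycle_degree:
  assumes "is_cycle F xs" "v \<in> set xs"
  shows "\<exists>u w. u \<noteq> w \<and> (v, u) \<in> F \<union> F\<inverse> \<and> (v, w) \<in> F \<union> F\<inverse>"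
proof -
  let ?n = "length xs"
  have n: "3 \<le> ?n" "distinct xs" and E: "\<And>i. i < ?n \<Longrightarrow> (xs ! i, xs ! (Suc i mod ?n)) \<in> F \<union> F\<inverse>"
    using assms(1) by (auto simp: is_cycle_def)
  obtain i where i: "i < ?n" "xs ! i = v" using assms(2) by (auto simp: in_set_conv_nth)
  \<comment> \<open>The cyclic predecessor of \<open>i\<close>; adding \<open>?n - 1\<close> avoids
    truncated subtraction at \<open>i = 0\<close>.\<close>
  define j where "j = (i + (?n - 1)) mod ?n"
  have j: "j < ?n" unfolding j_def using n by (intro mod_less_divisor) linarith
  have "Suc j mod ?n = Suc (i + (?n - 1)) mod ?n" unfolding j_def by (rule mod_Suc_eq)
  also have "Suc (i + (?n - 1)) = i + ?n" using n by linarith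
  finally have Sj: "Suc j mod ?n = i" using i by simp
  have ne: "j \<noteq> Suc i mod ?n"
  proof -
    have "Suc (Suc j mod ?n) mod ?n = Suc (Suc j) mod ?n" by (rule mod_Suc_eq)
    moreover have "Suc (Suc j) mod ?n = (if Suc (Suc j) < ?n then Suc (Suc j) else Suc (Suc j) - ?n)"
      using j n by (auto simp: le_mod_geq not_less)
    ultimately show ?thesis using n j unfolding Sj by (auto split: if_splits)
  qed
  have "xs ! j \<noteq> xs ! (Suc i mod ?n)"
    using ne nth_eq_iff_index_eq[OF n(2) j, of "Suc i mod ?n"] n j mod_less_divisor[of ?n "Suc i"]
    by linarith
  moreover have "(v, xs ! j) \<in> F \<union> F\<inverse>" using E[OF j] Sj i by auto
  moreover have "(v, xs ! (Suc i mod ?n)) \<in> F \<union> F\<inverse>" using E[OF i(1)] i by auto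
  ultimately show ?thesis by blast
qed

text \<open>The only neighbour of \<open>v\<close> is \<open>u\<close>, so no cycle passes through
  \<open>v\<close>, and a cycle avoiding \<open>v\<close> lies in the old edge set. Minimum and
  maximum orient the new edge as the representation demands.\<close>

lemma is_tree_add_leaf:
  assumes T: "is_tree W F" and u: "u \<in> W" and v: "v \<notin> W"
  shows "is_tree (insert v W) (insert (min u v, max u v) F)"
proof -
  let ?F = "insert (min u v, max u v) F"
  have uv: "u \<noteq> v" using u v by auto
  have FW: "F \<subseteq> {(u, v). u \<in> W \<and> v \<in> W \<and> u < v}" using T by (simp add: is_tree_def)
  have conn: "\<And>a b. a \<in> W \<Longrightarrow> b \<in> W \<Longrightarrow> (a, b) \<in> (F \<union> F\<inverse>)\<^sup>*" using T by (simp add: is_tree_def)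
  have mono: "(F \<union> F\<inverse>)\<^sup>* \<subseteq> (?F \<union> ?F\<inverse>)\<^sup>*" by (intro rtrancl_mono) auto
  have e: "(u, v) \<in> ?F \<union> ?F\<inverse>" "(v, u) \<in> ?F \<union> ?F\<inverse>" by (auto simp: min_def max_def)
  have toU: "(a, u) \<in> (?F \<union> ?F\<inverse>)\<^sup>*" and fromU: "(u, a) \<in> (?F \<union> ?F\<inverse>)\<^sup>*" if "a \<in> insert v W" for a
    using that conn[of a u] conn[of u a] u mono e by (auto intro: r_into_rtrancl)
  have nbr: "w = u" if a: "(v, w) \<in> ?F \<union> ?F\<inverse>" for w
  proof -
    have "(v, w) \<notin> F" "(w, v) \<notin> F" using FW v by blast+
    with a uv show "w = u" by (auto simp: min_def max_def split: if_splits)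
  qed
  have "\<not> is_cycle ?F xs" for xs
  proof
    assume c: "is_cycle ?F xs"
    have "v \<notin> set xs" using is_cycle_degree[OF c, of v] nbr by metis
    then have "(xs ! i, xs ! (Suc i mod length xs)) \<in> F \<union> F\<inverse>" if "i < length xs" for i
    proof -
      have "Suc i mod length xs < length xs" using that by (intro mod_less_divisor) linarith
      then have "xs ! i \<in> set xs" "xs ! (Suc i mod length xs) \<in> set xs"
        using that by (blast intro: nth_mem)+
      then have "xs ! i \<noteq> v" "xs ! (Suc i mod length xs) \<noteq> v"
        using \<open>v \<notin> set xs\<close> by metis+
      moreover have "(xs ! i, xs ! (Suc i mod length xs)) \<in> ?F \<union> ?F\<inverse>" using c that by (simp add: is_cycle_def)
      ultimately show ?thesis using uv by (auto simp: min_def max_def simp del: mod_Suc split: if_splits)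
    qed
    then have "is_cycle F xs" using c by (simp add: is_cycle_def)
    then show False using T by (auto simp: is_tree_def)
  qed
  moreover have "?F \<subseteq> {(a, b). a \<in> insert v W \<and> b \<in> insert v W \<and> a < b}"
  proof -
    have "(min u v, max u v) \<in> {(a, b). a \<in> insert v W \<and> b \<in> insert v W \<and> a < b}"
      using u uv by (auto simp: min_def max_def)
    moreover have "F \<subseteq> {(a, b). a \<in> insert v W \<and> b \<in> insert v W \<and> a < b}"
      using FW by auto
    ultimately show ?thesis by (rule insert_subsetI)
  qed
  moreover have "\<forall>a\<in>insert v W. \<forall>b\<in>insert v W. (a, b) \<in> (?F \<union> ?F\<inverse>)\<^sup>*"
    using toU fromU rtrancl_trans by metis
  moreover have "finite (insert v W)" using T by (simp add: is_tree_def)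
  ultimately show ?thesis unfolding is_tree_def by blast
qed

text \<open>Read from its end, the walk attaches each new vertex as a leaf to its successor, paying
  for the step between them; a vertex seen before adds no edge.\<close>

lemma walk_tree:
  fixes ys :: "nat list"
  assumes "Metric_space N d" "ys \<noteq> []"
  shows "\<exists>F. finite F \<and> is_tree (set ys) F \<and> (\<Sum>(u, v)\<in>F. d u v) \<le> walk_len d ys"
  using assms(2)
proof (induction ys rule: induct_list012)
  case (2 x)
  then show ?case using is_tree_singleton[of x] by (intro exI[of _ "{}"]) auto
next
  case (3 x y zs)
  interpret Metric_space N d by (rule assms(1))
  obtain F where F: "finite F" "is_tree (set (y # zs)) F" "(\<Sum>(u, v)\<in>F. d u v) \<le> walk_len d (y # zs)"
    using 3 by auto
  show ?case
  proof (cases "x \<in> set (y # zs)")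
    case True
    then have "set (x # y # zs) = set (y # zs)" by auto
    then show ?thesis using F by (intro exI[of _ F]) (auto simp: add_increasing)
  next
    case False
    let ?e = "(min y x, max y x)"
    have "(\<Sum>(u, v)\<in>insert ?e F. d u v) \<le> d (min y x) (max y x) + (\<Sum>(u, v)\<in>F. d u v)"
      using F(1) by (cases "?e \<in> F") (auto simp: insert_absorb)
    moreover have "d (min y x) (max y x) = d x y" by (simp add: min_def max_def commute)
    ultimately show ?thesis
      using is_tree_add_leaf[OF F(2), of y x] False F by (intro exI[of _ "insert ?e F"]) auto
  qed
qed simp

section \<open>Capping multiplicities and trimming vertex sets\<close>

abbreviation joins :: "nat set \<Rightarrow> req \<Rightarrow> bool" where
  "joins W x \<equiv> src x \<in> W \<and> dest x \<in> W"

lemma length_filter_le3: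
  assumes "\<And>x. x \<in> set xs \<Longrightarrow> P x \<Longrightarrow> A x \<or> B x \<or> C x"
  shows "length (filter P xs) \<le> length (filter A xs) + length (filter B xs) + length (filter C xs)"
  using assms by (induction xs) (auto simp: le_SucI split: if_splits)

lemma length_filter_mono:
  assumes "\<And>x. x \<in> set xs \<Longrightarrow> P x \<Longrightarrow> A x"
  shows "length (filter P xs) \<le> length (filter A xs)"
  using assms by (induction xs) (auto simp: le_SucI)

text \<open>A tree connects all pairs inside its vertex set, possibly more than \<open>k\<close> of them. In a minimal
  vertex set with more than \<open>k\<close> pairs, an edge misses one of any three vertices, so deleting one of
  them keeps a third of the pairs. Two vertices alone carry at most \<open>k\<close> pairs by assumption.\<close>

lemma trim_vertex_set:
  assumes "finite W" "\<And>x. x \<in> set R \<Longrightarrow> src x \<noteq> dest x"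
    and cap: "\<And>x. length (filter (same_ends x) R) \<le> k"
    and "1 \<le> a" "a \<le> k" "a \<le> length (filter (joins W) R)"
  shows "\<exists>X\<subseteq>W. 1 \<le> length (filter (joins X) R) \<and> length (filter (joins X) R) \<le> k \<and>
    a \<le> 3 * length (filter (joins X) R)"
  using assms(1,6)
proof (induction W rule: finite_psubset_induct)
  case (psubset W)
  let ?e = "\<lambda>X. length (filter (joins X) R)"
  consider "?e W \<le> k" | v where "v \<in> W" "k < ?e (W - {v})"
    | "k < ?e W" "\<And>v. v \<in> W \<Longrightarrow> ?e (W - {v}) \<le> k" by force
  then show ?case
  proof cases
    case 1
    then show ?thesis using psubset.prems assms(4) by (intro exI[of _ W]) auto
  next
    case 2
    have "\<exists>X\<subseteq>W - {v}. 1 \<le> ?e X \<and> ?e X \<le> k \<and> a \<le> 3 * ?e X"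
      using 2 assms(5) by (intro psubset.IH) auto
    then show ?thesis by blast
  next
    case 3
    then have "filter (joins W) R \<noteq> []" by auto
    then obtain x where x: "x \<in> set R" "joins W x" by (auto simp: filter_empty_conv)
    have "\<exists>z\<in>W. z \<noteq> src x \<and> z \<noteq> dest x"
    proof (rule ccontr)
      assume "\<not> ?thesis"
      then have "?e W \<le> length (filter (same_ends x) R)"
        using assms(2) by (intro length_filter_mono) (metis same_ends_def)
      then show False using cap[of x] 3(1) by simp
    qed
    then obtain z where z: "z \<in> W" "z \<noteq> src x" "z \<noteq> dest x" by blast
    have "?e W \<le> ?e (W - {src x}) + ?e (W - {dest x}) + ?e (W - {z})"
      using z assms(2)[OF x(1)] by (intro length_filter_le3) auto
    then have "?e W \<le> 3 * ?e (W - {src x}) \<or> ?e W \<le> 3 * ?e (W - {dest x}) \<or> ?e W \<le> 3 * ?e (W - {z})"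
      by linarith
    then obtain v where v: "v \<in> W" "?e W \<le> 3 * ?e (W - {v})" using x z by blast
    \<comment> \<open>More than \<open>k \<ge> a\<close> requests were joined by \<open>W\<close>. A
      third of them is therefore positive and at least a third of \<open>a\<close>, while the
      assumption of this case bounds it by \<open>k\<close>.\<close>
    then show ?thesis using 3 psubset.prems assms(4) by (intro exI[of _ "W - {v}"]) auto
  qed
qed

text \<open>Since \<open>same_ends\<close> is an equivalence relation, adding a request to a class
  with fewer than \<open>k\<close> members keeps all classes within \<open>k\<close>. A request is
  rejected only if its class is full, and accepted requests are never lost.\<close>

lemma cap_props:
  shows "set (cap k R) \<subseteq> set R" and "distinct R \<Longrightarrow> distinct (cap k R)"
    and "length (filter (same_ends x) (cap k R)) \<le> k"
    and "x \<in> set R \<Longrightarrow> x \<notin> set (cap k R) \<Longrightarrow> k \<le> length (filter (same_ends x) (cap k R))"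
proof -
  let ?F = "\<lambda>x s. if length (filter (\<lambda>y. same_ends x y) s) < k then x # s else s"
  have sym: "same_ends u v \<Longrightarrow> same_ends u w = same_ends v w" for u v w
    by (auto simp: same_ends_def)
  have "set (fold ?F R s) \<subseteq> set R \<union> set s" for s
  proof (induction R arbitrary: s)
    case (Cons y R)
    have "set (fold ?F R (?F y s)) \<subseteq> set R \<union> set (?F y s)" by (rule Cons)
    also have "\<dots> \<subseteq> set (y # R) \<union> set s" by auto
    finally show ?case by simp
  qed simp
  from this[of "[]"] show "set (cap k R) \<subseteq> set R" by (simp add: cap_def)
  have "distinct (R @ s) \<Longrightarrow> distinct (fold ?F R s)" for s
    by (induction R arbitrary: s) auto
  from this[of "[]"] show "distinct R \<Longrightarrow> distinct (cap k R)" by (simp add: cap_def)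
  have "(\<And>x. length (filter (same_ends x) s) \<le> k) \<Longrightarrow> length (filter (same_ends x) (fold ?F R s)) \<le> k" for s
  proof (induction R arbitrary: s)
    case (Cons y R)
    have "length (filter (same_ends z) (y # s)) \<le> k" if "length (filter (same_ends y) s) < k" for z
    proof (cases "same_ends z y")
      case True
      then have "filter (same_ends z) s = filter (same_ends y) s" using sym by (intro filter_cong) auto
      then show ?thesis using that by simp
    qed (use Cons.prems in simp)
    then show ?case using Cons by simp
  qed simp
  from this[of "[]"] show "length (filter (same_ends x) (cap k R)) \<le> k" by (simp add: cap_def)
  have mono: "length (filter P s) \<le> length (filter P (fold ?F R s))" for P R s
  proof (induction R arbitrary: s)
    case (Cons y R)
    have "length (filter P s) \<le> length (filter P (?F y s))" by simp
    also have "\<dots> \<le> length (filter P (fold ?F R (?F y s)))" by (rule Cons)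
    finally show ?case by simp
  qed simp
  have keep: "y \<in> set s \<Longrightarrow> y \<in> set (fold ?F R s)" for y R s
    by (induction R arbitrary: s) auto
  have "x \<in> set R \<Longrightarrow> x \<notin> set (fold ?F R s) \<Longrightarrow> k \<le> length (filter (same_ends x) (fold ?F R s))" for s
  proof (induction R arbitrary: s)
    case (Cons y R)
    show ?case
    proof (cases "x \<in> set R")
      case True
      then show ?thesis using Cons by simp
    next
      case False
      then have xy: "x = y" using Cons.prems by simp
      then have "\<not> length (filter (same_ends x) s) < k" using Cons.prems(2) keep[of x "x # s" R] by auto
      then show ?thesis using mono[of "same_ends x" s "y # R"] by linarith
    qed
  qed simp
  from this[of "[]"] show "x \<in> set R \<Longrightarrow> x \<notin> set (cap k R) \<Longrightarrow> k \<le> length (filter (same_ends x) (cap k R))"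
    by (simp add: cap_def)
qed

text \<open>If a member of \<open>G\<close> is hidden, then \<open>k\<close> visible requests have
  the same two ends, and \<open>W\<close> joins all of them. As groups have at most \<open>k\<close>
  members, hiding costs nothing.\<close>

lemma cap_inside:
  assumes "distinct R" "G \<subseteq> set R" "card G \<le> k" "\<And>x. x \<in> G \<Longrightarrow> joins W x"
  shows "card G \<le> length (filter (joins W) (cap k R))"
proof (cases "G \<subseteq> set (cap k R)")
  case True
  have "card G \<le> card (set (filter (joins W) (cap k R)))"
    using True assms(4) by (intro card_mono) auto
  also have "\<dots> = length (filter (joins W) (cap k R))"
    using cap_props(2)[OF assms(1)] by (intro distinct_card) simp
  finally show ?thesis .
next
  case False
  then obtain x where x: "x \<in> G" "x \<notin> set (cap k R)" by blast
  have "k \<le> length (filter (same_ends x) (cap k R))" using cap_props(4) x assms(2) by blast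
  also have "\<dots> \<le> length (filter (joins W) (cap k R))"
    using assms(4)[OF x(1)] by (intro length_filter_mono) (auto simp: same_ends_def)
  finally show ?thesis using assms(3) by simp
qed

section \<open>Dial-a-Ride tours as walks\<close>

text \<open>The position is repeated at pickups and drops, so that positions and loads share one
  time index.\<close>

fun stops :: "nat \<Rightarrow> event list \<Rightarrow> nat list" where
  "stops v [] = [v]"
| "stops v (Move w # es) = v # stops w es"
| "stops v (Pick i # es) = v # stops v es"
| "stops v (Drop i # es) = v # stops v es"

fun loads :: "nat set \<Rightarrow> event list \<Rightarrow> nat set list" where
  "loads C [] = [C]"
| "loads C (Move w # es) = C # loads C es"
| "loads C (Pick i # es) = C # loads (insert i C) es"
| "loads C (Drop i # es) = C # loads (C - {i}) es"

lemma stops_nth_0 [simp]: "stops v es ! 0 = v"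
  by (induction v es rule: stops.induct) auto

lemma length_stops [simp]: "length (stops v es) = Suc (length es)"
  by (induction v es rule: stops.induct) auto

lemma length_loads [simp]: "length (loads C es) = Suc (length es)"
  by (induction C es rule: loads.induct) auto

lemma stops_Cons: "\<exists>ws. stops v es = v # ws"
  by (induction v es rule: stops.induct) auto

lemma serves_stops_verts: "serves I v C L es \<Longrightarrow> v < nverts I \<Longrightarrow> set (stops v es) \<subseteq> {..<nverts I}"
  by (induction I v C L es rule: serves.induct) auto

lemma serves_loads:
  "serves I v C L es \<Longrightarrow> finite C \<Longrightarrow> card C \<le> capacity I \<Longrightarrow> X \<in> set (loads C es) \<Longrightarrow>
     finite X \<and> card X \<le> capacity I"
proof (induction I v C L es rule: serves.induct)
  case (3 I v C L i es)
  then show ?case by (auto simp: card_insert_if)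
next
  case (4 I v C L i es)
  have "card (C - {i}) \<le> card C" using 4 by (intro card_mono) auto
  then have c: "card (C - {i}) \<le> capacity I" using 4 by simp
  have srv: "serves I v (C - {i}) (L(i := v)) es" using 4(2) unfolding serves.simps by blast
  show ?case
  proof (cases "X = C")
    case True
    then show ?thesis using 4 by simp
  next
    case False
    then have "X \<in> set (loads (C - {i}) es)" using 4 by simp
    then show ?thesis using 4(1)[OF srv _ c] 4(3) by simp
  qed
qed auto

section \<open>The time interval during which an object is carried\<close>

definition carried_to :: "nat \<Rightarrow> nat \<Rightarrow> nat list \<Rightarrow> nat set list \<Rightarrow> bool" where
  "carried_to i t vs Cs \<longleftrightarrow> (\<exists>b<length vs. vs ! b = t \<and> (\<forall>j\<le>b. i \<in> Cs ! j))"

definition carried_between :: "nat \<Rightarrow> nat \<Rightarrow> nat \<Rightarrow> nat list \<Rightarrow> nat set list \<Rightarrow> bool" where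
  "carried_between i s t vs Cs \<longleftrightarrow>
     (\<exists>a b. a \<le> b \<and> b < length vs \<and> vs ! a = s \<and> vs ! b = t \<and> (\<forall>j. a \<le> j \<and> j \<le> b \<longrightarrow> i \<in> Cs ! j))"

lemma carried_to_Cons: "i \<in> C \<Longrightarrow> carried_to i t vs Cs \<Longrightarrow> carried_to i t (v # vs) (C # Cs)"
  unfolding carried_to_def
proof (elim exE conjE)
  fix b assume b: "i \<in> C" "b < length vs" "vs ! b = t" "\<forall>j\<le>b. i \<in> Cs ! j"
  then have "\<forall>j\<le>Suc b. i \<in> (C # Cs) ! j" by (auto simp: nth_Cons split: nat.split)
  then show "\<exists>b<length (v # vs). (v # vs) ! b = t \<and> (\<forall>j\<le>b. i \<in> (C # Cs) ! j)"
    using b by (intro exI[of _ "Suc b"]) auto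
qed

lemma carried_to_now: "i \<in> C \<Longrightarrow> carried_to i v (v # vs) (C # Cs)"
  unfolding carried_to_def by (intro exI[of _ 0]) auto

lemma carried_between_Cons:
  "carried_between i s t vs Cs \<Longrightarrow> carried_between i s t (v # vs) (C # Cs)"
  unfolding carried_between_def
proof (elim exE conjE)
  fix a b assume ab: "a \<le> b" "b < length vs" "vs ! a = s" "vs ! b = t" "\<forall>j. a \<le> j \<and> j \<le> b \<longrightarrow> i \<in> Cs ! j"
  then have "\<forall>j. Suc a \<le> j \<and> j \<le> Suc b \<longrightarrow> i \<in> (C # Cs) ! j" by (auto simp: nth_Cons split: nat.split)
  then show "\<exists>a b. a \<le> b \<and> b < length (v # vs) \<and> (v # vs) ! a = s \<and> (v # vs) ! b = t \<and>
      (\<forall>j. a \<le> j \<and> j \<le> b \<longrightarrow> i \<in> (C # Cs) ! j)"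
    using ab by (intro exI[of _ "Suc a"] exI[of _ "Suc b"]) auto
qed

lemma carried_betweenI: "carried_to i t vs Cs \<Longrightarrow> carried_between i (vs ! 0) t vs Cs"
  unfolding carried_to_def carried_between_def by blast

text \<open>Here non-preemption enters: a drop can only happen at the destination, so a picked
  object is carried all the way. Distinct ends force a pickup. Both cases are needed together
  because a pickup leads from the second to the first.\<close>

lemma serves_carry:
  assumes "serves I v C L es" "fst (pairs I ! i) \<noteq> snd (pairs I ! i)" "i < npairs I"
  shows "(i \<in> C \<longrightarrow> carried_to i (snd (pairs I ! i)) (stops v es) (loads C es)) \<and>
    (i \<notin> C \<and> L i = fst (pairs I ! i) \<longrightarrow>
      carried_between i (fst (pairs I ! i)) (snd (pairs I ! i)) (stops v es) (loads C es))"
  using assms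
proof (induction I v C L es rule: serves.induct)
  case (3 I v C L p es)
  show ?case
  proof (cases "p = i")
    case True
    then have "carried_between i v (snd (pairs I ! i)) (stops v es) (loads (insert i C) es)"
      using 3 carried_betweenI[of i "snd (pairs I ! i)" "stops v es" "loads (insert i C) es"] by auto
    then show ?thesis using 3 True by (auto intro: carried_between_Cons)
  next
    case False
    then show ?thesis using 3 by (auto intro: carried_to_Cons carried_between_Cons)
  qed
next
  case (4 I v C L p es)
  show ?case
  proof (cases "p = i")
    case True
    then show ?thesis using 4 by (auto intro: carried_to_now)
  next
    case False
    have "serves I v (C - {p}) (L(p := v)) es" using 4(2) unfolding serves.simps by blast
    from 4(1)[OF this 4(3,4)] show ?thesis
      using False by (auto intro: carried_to_Cons carried_between_Cons)
  qed
qed (auto intro: carried_to_Cons carried_between_Cons)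

section \<open>The lower bound\<close>

locale dar_setup =
  fixes I :: dar_inst
  assumes valid: "valid_dar_inst I"
begin

sublocale Metric_space "{..<nverts I}" "dst I"
  using valid by (simp add: valid_dar_inst_def valid_pairs_inst_def)

lemma capacity_pos: "1 \<le> capacity I"
  using valid by (simp add: valid_dar_inst_def valid_pairs_inst_def)

lemma root_vert: "root I < nverts I"
  using valid by (simp add: valid_dar_inst_def)

lemma request_props:
  assumes "x \<in> set (requests (pairs I))"
  shows "fst x < npairs I" "pairs I ! fst x = snd x" "src x \<noteq> dest x"
    "src x < nverts I" "dest x < nverts I"
proof -
  have x: "x \<in> set (zip [0..<length (pairs I)] (pairs I))" "src x \<noteq> dest x"
    using assms by (auto simp: requests_def enumerate_eq_zip)
  then show a: "fst x < npairs I" "pairs I ! fst x = snd x" "src x \<noteq> dest x"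
    by (auto simp: set_zip npairs_def)
  then have "snd x \<in> set (pairs I)" by (metis npairs_def nth_mem)
  then show "src x < nverts I" "dest x < nverts I"
    using valid by (fastforce simp: valid_dar_inst_def valid_pairs_inst_def)+
qed

lemma request_memI:
  assumes "i < npairs I" "fst (pairs I ! i) \<noteq> snd (pairs I ! i)"
  shows "(i, pairs I ! i) \<in> set (requests (pairs I))"
  using assms by (auto simp: requests_def enumerate_eq_zip set_zip npairs_def intro!: exI[of _ i])

lemma distinct_requests: "distinct (requests (pairs I))"
  by (simp add: requests_def enumerate_eq_zip distinct_zipI1)

lemma length_requests: "length (requests (pairs I)) \<le> npairs I"
  unfolding requests_def npairs_def by (metis length_enumerate length_filter_le)

definition sub_inst :: "req list \<Rightarrow> pairs_inst" where
  "sub_inst R = \<lparr>dist_matrix = dist_matrix I, pairs = map snd R, capacity = capacity I\<rparr>"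

lemma sub_inst_simps [simp]:
  "nverts (sub_inst R) = nverts I" "dst (sub_inst R) = dst I" "capacity (sub_inst R) = capacity I"
  "npairs (sub_inst R) = length R" "pairs (sub_inst R) = map snd R"
  by (auto simp: sub_inst_def nverts_def dst_def npairs_def fun_eq_iff)

lemma sub_inst_valid:
  assumes "set R \<subseteq> set (requests (pairs I))"
  shows "valid_pairs_inst (sub_inst R)"
proof -
  have "\<forall>(s, t)\<in>set (map snd R). s < nverts I \<and> t < nverts I"
    using assms request_props(4,5) by fastforce
  moreover have "\<forall>row\<in>set (dist_matrix (sub_inst R)). length row = nverts I"
    using valid by (simp add: valid_dar_inst_def valid_pairs_inst_def sub_inst_def)
  ultimately show ?thesis
    using capacity_pos Metric_space_axioms unfolding valid_pairs_inst_def sub_inst_simps by blast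
qed

lemma num_connected_sub_inst: "num_connected (sub_inst R) W = length (filter (joins W) R)"
  by (auto simp: num_connected_def length_filter_conv_card intro!: arg_cong[where f = card])

text \<open>Trimming the visited vertices leaves a set \<open>X\<close> that joins at most
  \<open>k\<close> visible requests, but at least a third as many as \<open>G\<close> has; this is
  the factor 3. Shortcutting the walk to \<open>X\<close> before building the tree ensures that no
  discarded vertex returns, which would bring back surplus pairs. The inequality is stated without
  division.\<close>

lemma forest_of_walk:
  assumes R: "set R \<subseteq> set (requests (pairs I))" "distinct R"
    and G: "G \<subseteq> set R" "G \<noteq> {}" "card G \<le> capacity I" "\<And>x. x \<in> G \<Longrightarrow> joins (set ws) x"
    and ws: "set ws \<subseteq> {..<nverts I}"
  defines "J \<equiv> sub_inst (cap (capacity I) R)"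
  shows "\<exists>T. ratio_forest_feasible J T \<and>
    tree_length J T * real (card G) \<le> 3 * walk_len (dst I) ws * real (num_connected J (set (fst T)))"
proof -
  let ?R = "cap (capacity I) R"
  have fin: "finite G" using G(1) finite_subset by blast
  have "1 \<le> card G" using G(2) fin by (simp add: Suc_le_eq card_gt_0_iff)
  have "\<exists>X\<subseteq>set ws. 1 \<le> length (filter (joins X) ?R) \<and> length (filter (joins X) ?R) \<le> capacity I \<and>
      card G \<le> 3 * length (filter (joins X) ?R)"
  proof (rule trim_vertex_set)
    show "src x \<noteq> dest x" if "x \<in> set ?R" for x
      using that cap_props(1) R(1) request_props(3) by blast
    show "card G \<le> length (filter (joins (set ws)) ?R)"
      using cap_inside[OF R(2) G(1,3,4)] by blast
  qed (use cap_props(3) G(3) \<open>1 \<le> card G\<close> in auto)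
  then obtain X where X: "X \<subseteq> set ws" "1 \<le> length (filter (joins X) ?R)"
      "length (filter (joins X) ?R) \<le> capacity I" "card G \<le> 3 * length (filter (joins X) ?R)"
    by blast
  have "X \<noteq> {}"
  proof
    assume "X = {}"
    then have "filter (joins X) ?R = []" by simp
    then show False using X(2) by simp
  qed
  then obtain w ws' where w: "ws = w # ws'" using X(1) by (cases ws) auto
  obtain ys where ys: "distinct ys" "set ys = X \<inter> set ws" "walk_len (dst I) (w # ys) \<le> walk_len (dst I) (w # ws)"
    using walk_shortcut[of w ws X] ws w by auto
  have ysX: "set ys = X" using ys(2) X(1) by auto
  then have "ys \<noteq> []" using \<open>X \<noteq> {}\<close> by auto
  then obtain F where F: "finite F" "is_tree X F" "(\<Sum>(u, v)\<in>F. dst I u v) \<le> walk_len (dst I) ys"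
    using walk_tree[OF Metric_space_axioms, of ys] ysX by auto
  obtain fs where fs: "set fs = F" using F(1) finite_list by blast
  have "walk_len (dst I) ys \<le> walk_len (dst I) (w # ys)" by (cases ys) auto
  moreover have "walk_len (dst I) (w # ws) = walk_len (dst I) ws" using w ws by simp
  ultimately have "tree_length J (ys, fs) \<le> walk_len (dst I) ws"
    using F(3) ys(3) fs unfolding tree_length_def J_def by simp
  moreover have "real (card G) \<le> 3 * real (num_connected J X)"
    using X(4) unfolding J_def num_connected_sub_inst by linarith
  moreover have "0 \<le> tree_length J (ys, fs)"
    unfolding tree_length_def J_def by (simp add: sum_nonneg split_beta)
  ultimately have "tree_length J (ys, fs) * real (card G) \<le> walk_len (dst I) ws * (3 * real (num_connected J X))"
    by (intro mult_mono) (auto simp: walk_len_nonneg)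
  moreover have "ratio_forest_feasible J (ys, fs)"
    using F(2) X ws fs ysX unfolding ratio_forest_feasible_def J_def num_connected_sub_inst by auto
  ultimately show ?thesis using ysX by (intro exI[of _ "(ys, fs)"]) (auto simp: algebra_simps)
qed

lemma route_length_stops:
  "v < nverts I \<Longrightarrow> serves I v C L es \<Longrightarrow> walk_len (dst I) (stops v es) = route_length I v es"
proof (induction es arbitrary: v C L)
  case (Cons e es)
  have ws: "\<exists>ws. stops u es = u # ws" for u by (rule stops_Cons)
  show ?case
  proof (cases e)
    case (Move w)
    then have "walk_len (dst I) (stops w es) = route_length I w es"
      using Cons.prems by (intro Cons.IH) auto
    then show ?thesis using Move ws[of w] by auto
  next
    case (Pick i)
    then have "walk_len (dst I) (stops v es) = route_length I v es"
      using Cons.prems by (intro Cons.IH) auto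
    then show ?thesis using Pick ws[of v] Cons.prems by auto
  next
    case (Drop i)
    then have "walk_len (dst I) (stops v es) = route_length I v es"
      using Cons.prems by (intro Cons.IH) auto
    then show ?thesis using Drop ws[of v] Cons.prems by auto
  qed
qed simp

lemma opt_ratio_nonneg: "0 \<le> cost min_ratio_k_forest (sub_inst R) T"
  by (simp add: min_ratio_k_forest_def tree_length_def sum_nonneg split_beta)

lemma opt_ratio_le:
  assumes "ratio_forest_feasible (sub_inst R) T"
  shows "opt min_ratio_k_forest (sub_inst R) \<le> cost min_ratio_k_forest (sub_inst R) T"
  unfolding opt_def
proof (rule cInf_lower)
  show "bdd_below (cost min_ratio_k_forest (sub_inst R) ` {S. feasible min_ratio_k_forest (sub_inst R) S})"
    using opt_ratio_nonneg by (intro bdd_belowI[of _ 0]) auto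
qed (use assms in \<open>simp add: min_ratio_k_forest_def\<close>)

text \<open>A single request and the walk between its ends suffice. Hence every query posed on a
  nonempty list has a constrained answer.\<close>

lemma forest_feasible_ex:
  assumes R: "set R \<subseteq> set (requests (pairs I))" "distinct R" "R \<noteq> []"
  shows "\<exists>T. ratio_forest_feasible (sub_inst (cap (capacity I) R)) T"
proof -
  obtain x where x: "x \<in> set R" using R(3) by (cases R) auto
  then show ?thesis
    using forest_of_walk[OF R(1,2), of "{x}" "[src x, dest x]"] request_props(4,5)[of x] R(1) capacity_pos
    by auto
qed

text \<open>The intervals are those during which the requests are carried, the weights are the step
  lengths of the tour, and \<open>\<mu>\<close> is a third of the optimal ratio. A group on a
  stretch of length \<open>L\<close> yields a feasible tree of ratio at most
  \<open>3 * L / card G\<close>, which cannot be below the optimum.\<close>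

lemma forest_density:
  assumes R: "set R \<subseteq> set (requests (pairs I))" "distinct R"
    and es: "dar_feasible I es"
  shows "opt min_ratio_k_forest (sub_inst (cap (capacity I) R)) * real (length R) \<le>
    3 * real (floorlog 2 (length R)) * route_length I (root I) es"
proof -
  let ?J = "sub_inst (cap (capacity I) R)"
  let ?O = "opt min_ratio_k_forest ?J"
  define ws where "ws = stops (root I) es"
  define w where "w j = dst I (ws ! j) (ws ! Suc j)" for j
  have srv: "serves I (root I) {} (\<lambda>i. fst (pairs I ! i)) es"
    using es by (simp add: dar_feasible_def)
  have ws: "set ws \<subseteq> {..<nverts I}" unfolding ws_def using serves_stops_verts[OF srv root_vert] .
  have "\<exists>a b. a \<le> b \<and> b \<le> length es \<and> ws ! a = src x \<and> ws ! b = dest x \<and>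
      (\<forall>j. a \<le> j \<and> j \<le> b \<longrightarrow> fst x \<in> loads {} es ! j)" if "x \<in> set R" for x
  proof -
    have x: "x \<in> set (requests (pairs I))" using that R(1) by blast
    show ?thesis
      using serves_carry[OF srv, of "fst x"] request_props[OF x] unfolding ws_def carried_between_def
      by (auto simp: less_Suc_eq_le)
  qed
  then obtain a b where ab: "\<And>x. x \<in> set R \<Longrightarrow> a x \<le> b x \<and> b x \<le> length es \<and> ws ! a x = src x \<and>
      ws ! b x = dest x \<and> (\<forall>j. a x \<le> j \<and> j \<le> b x \<longrightarrow> fst x \<in> loads {} es ! j)"
    by metis
  \<comment> \<open>Loads are sets of indices while intervals belong to requests; injectivity
    transfers the capacity bound.\<close>
  have inj: "inj_on fst (set R)"
    using R(1) request_props(2) by (intro inj_onI) (metis prod_eqI subsetD)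
  have "?O / 3 * real (card (set R)) \<le> real (floorlog 2 (card (set R))) * sum w {0..<length es}"
  proof (rule interval_groups_bound[where a = a and b = b and k = "capacity I"])
    fix y
    show "card {x \<in> set R. a x \<le> y \<and> y \<le> b x} \<le> capacity I"
    proof (cases "y \<le> length es")
      case True
      then have X: "finite (loads {} es ! y)" "card (loads {} es ! y) \<le> capacity I"
        using serves_loads[OF srv, of "loads {} es ! y"] by (auto simp: less_Suc_eq_le)
      have "card {x \<in> set R. a x \<le> y \<and> y \<le> b x} = card (fst ` {x \<in> set R. a x \<le> y \<and> y \<le> b x})"
        by (rule card_image[symmetric]) (rule inj_on_subset[OF inj], auto)
      also have "\<dots> \<le> card (loads {} es ! y)" using ab X by (intro card_mono) auto
      finally show ?thesis using X by simp
    next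
      case False
      then have "{x \<in> set R. a x \<le> y \<and> y \<le> b x} = {}" using ab by fastforce
      then show ?thesis by (simp only: card.empty)
    qed
  next
    fix l r G
    assume G: "G \<subseteq> set R" "G \<noteq> {}" "card G \<le> capacity I" and lr: "l \<le> r" "r \<le> length es"
      and in_lr: "\<And>x. x \<in> G \<Longrightarrow> l \<le> a x \<and> b x \<le> r"
    define us where "us = take (r - l + 1) (drop l ws)"
    have len: "walk_len (dst I) us = sum w {l..<r}"
      unfolding us_def w_def using walk_len_segment[of l r ws "dst I"] lr by (simp add: ws_def)
    have mem: "ws ! j \<in> set us" if "l \<le> j" "j \<le> r" for j
    proof -
      have "us ! (j - l) = ws ! j" "j - l < length us" using that lr by (auto simp: us_def ws_def)
      then show ?thesis by (metis nth_mem)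
    qed
    have usw: "set us \<subseteq> {..<nverts I}"
      using ws unfolding us_def by (meson order_trans set_drop_subset set_take_subset)
    have "joins (set us) x" if "x \<in> G" for x
      using mem[of "a x"] mem[of "b x"] in_lr[OF that] ab[of x] G(1) that by auto
    then obtain T where T: "ratio_forest_feasible ?J T"
      "tree_length ?J T * real (card G) \<le> 3 * walk_len (dst I) us * real (num_connected ?J (set (fst T)))"
      using forest_of_walk[OF R G _ usw] by blast
    have c: "0 < real (num_connected ?J (set (fst T)))" using T(1) by (auto simp: ratio_forest_feasible_def)
    have "?O \<le> tree_length ?J T / real (num_connected ?J (set (fst T)))"
      using opt_ratio_le[OF T(1)] by (simp add: min_ratio_k_forest_def)
    then have "?O * real (card G) \<le> tree_length ?J T / real (num_connected ?J (set (fst T))) * real (card G)"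
      by (rule mult_right_mono) simp
    also have "\<dots> \<le> 3 * walk_len (dst I) us" using T(2) c by (simp add: divide_simps mult.commute)
    finally show "?O / 3 * real (card G) \<le> sum w {l..<r}" using len by simp
  qed (use ab in \<open>auto simp: w_def\<close>)
  moreover have "sum w {0..<length es} = route_length I (root I) es"
    using route_length_stops[OF root_vert srv] unfolding walk_len_nth w_def ws_def
    by (simp add: atLeast0LessThan)
  moreover have "card (set R) = length R" using R(2) by (rule distinct_card)
  ultimately show ?thesis by (simp add: algebra_simps)
qed

end

section \<open>Tours by insertion\<close>

lemma ins_split:
  assumes "distinct z" "a \<in> set z" "b \<notin> set z"
  obtains z1 z2 where "z = z1 @ a # z2" "ins a b z = z1 @ a # b # z2"
proof -
  let ?F = "\<lambda>x s. if x = a \<and> b \<notin> set s then b # x # s else x # s"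
  have 1: "a \<notin> set ys \<Longrightarrow> fold ?F ys s = rev ys @ s" for ys s
    by (induction ys arbitrary: s) auto
  have 2: "b \<in> set s \<Longrightarrow> fold ?F ys s = rev ys @ s" for ys s
    by (induction ys arbitrary: s) auto
  obtain z1 z2 where z: "z = z1 @ a # z2" using assms(2) by (meson split_list)
  then have "a \<notin> set z1" "b \<notin> set z1" using assms by auto
  then have "ins a b z = z1 @ a # b # z2"
    unfolding ins_def z by (simp add: 1 2)
  with z show thesis using that by blast
qed

lemma (in Metric_space) walk_len_insert:
  assumes "set (z1 @ a # z2 @ [r]) \<subseteq> M" "b \<in> M"
  shows "walk_len d (z1 @ a # b # z2 @ [r]) \<le> walk_len d (z1 @ a # z2 @ [r]) + 2 * d a b"
proof -
  \<comment> \<open>The closing point \<open>r\<close> gives \<open>a\<close> a successor even if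
    \<open>a\<close> is the last vertex of the tour.\<close>
  obtain y ys where y: "z2 @ [r] = y # ys" by (cases "z2 @ [r]") auto
  then have "y \<in> M" "a \<in> M" using assms(1) by (metis append_Cons in_set_conv_decomp subsetD set_append UnI2 list.set_intros)+
  then have "d b y \<le> d b a + d a y" using assms(2) by (intro triangle) auto
  then show ?thesis
    unfolding y using walk_len_append[of d z1 a "b # y # ys"] walk_len_append[of d z1 a "y # ys"]
    by (simp add: commute)
qed

lemma set_ins: "distinct z \<Longrightarrow> a \<in> set z \<Longrightarrow> b \<notin> set z \<Longrightarrow> set (ins a b z) = insert b (set z)"
  by (rule ins_split[of z a b]) auto

lemma distinct_ins: "distinct z \<Longrightarrow> a \<in> set z \<Longrightarrow> b \<notin> set z \<Longrightarrow> distinct (ins a b z)"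
  by (rule ins_split[of z a b]) auto

lemma grow_mono: "distinct z \<Longrightarrow> set z \<subseteq> set (grow e z)"
  by (auto simp: grow_def set_ins)

lemma grow_distinct: "distinct z \<Longrightarrow> distinct (grow e z)"
  by (simp add: grow_def distinct_ins)

lemma grow_ends:
  "distinct z \<Longrightarrow> fst e \<in> set z \<or> snd e \<in> set z \<Longrightarrow> fst e \<in> set (grow e z) \<and> snd e \<in> set (grow e z)"
  by (auto simp: grow_def set_ins)

lemma fold_grow_mono: "distinct z \<Longrightarrow> distinct (fold grow F z) \<and> set z \<subseteq> set (fold grow F z)"
proof (induction F arbitrary: z)
  case (Cons e F)
  then show ?case using Cons.IH[OF grow_distinct[OF Cons.prems, of e]] grow_mono[OF Cons.prems, of e] by auto
qed simp

lemma fold_grow_ends: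
  "distinct z \<Longrightarrow> e \<in> set F \<Longrightarrow> fst e \<in> set z \<or> snd e \<in> set z \<Longrightarrow>
    fst e \<in> set (fold grow F z) \<and> snd e \<in> set (fold grow F z)"
proof (induction F arbitrary: z)
  case (Cons f F)
  note d = grow_distinct[OF Cons.prems(1), of f]
  show ?case
  proof (cases "e = f")
    case True
    then show ?thesis
      using grow_ends[OF Cons.prems(1), of e] Cons.prems(3) fold_grow_mono[OF d, of F] by auto
  next
    case False
    then show ?thesis
      using Cons.IH[OF d] Cons.prems grow_mono[OF Cons.prems(1), of f] by auto
  qed
qed simp

section \<open>Closed walks around trees\<close>

context Metric_space
begin

text \<open>\<open>E\<close> collects the edges paid for so far. Since they join visited vertices,
  an edge leading to an unvisited vertex is not among them, so no edge is paid for twice.\<close>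

definition partial_tour :: "'a \<Rightarrow> ('a \<times> 'a) set \<Rightarrow> 'a set \<Rightarrow> 'a list \<Rightarrow> bool" where
  "partial_tour v F W z \<longleftrightarrow> distinct z \<and> z \<noteq> [] \<and> hd z = v \<and> set z \<subseteq> W \<and>
     (\<exists>E\<subseteq>F. E \<subseteq> set z \<times> set z \<and> walk_len d (z @ [v]) \<le> 2 * (\<Sum>(a, b)\<in>E. d a b))"

end

lemma partial_tour_ins:
  fixes v :: nat
  assumes "Metric_space M d" "Metric_space.partial_tour d v F W z" "finite F" "W \<subseteq> M"
    and e: "(a, b) \<in> F \<or> (b, a) \<in> F" and a: "a \<in> set z" and b: "b \<notin> set z" "b \<in> W"
  shows "Metric_space.partial_tour d v F W (ins a b z)"
proof -
  interpret Metric_space M d by (rule assms(1))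
  obtain E where z: "distinct z" "z \<noteq> []" "hd z = v" "set z \<subseteq> W" and E: "E \<subseteq> F" "E \<subseteq> set z \<times> set z"
    and len: "walk_len d (z @ [v]) \<le> 2 * (\<Sum>(a, b)\<in>E. d a b)"
    using assms(2) unfolding partial_tour_def by blast
  obtain f where f: "f \<in> F" "f = (a, b) \<or> f = (b, a)" using e by blast
  have dab: "(case f of (a, b) \<Rightarrow> d a b) = d a b" using f(2) by (auto simp: commute)
  have fE: "f \<notin> E" using f(2) E(2) b(1) by auto
  have finE: "finite E" using E(1) assms(3) finite_subset by blast
  obtain z1 z2 where s: "z = z1 @ a # z2" "ins a b z = z1 @ a # b # z2"
    by (rule ins_split[OF z(1) a b(1)])
  have "v \<in> set z" using z(2,3) by auto
  then have "set (z1 @ a # z2 @ [v]) \<subseteq> M" using z(4) assms(4) s(1) by auto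
  then have "walk_len d (z1 @ a # b # z2 @ [v]) \<le> walk_len d (z1 @ a # z2 @ [v]) + 2 * d a b"
    using b(2) assms(4) by (intro walk_len_insert) auto
  then have "walk_len d (ins a b z @ [v]) \<le> 2 * (\<Sum>(a, b)\<in>insert f E. d a b)"
    using len s finE fE dab by simp
  moreover have "insert f E \<subseteq> set (ins a b z) \<times> set (ins a b z)" using E(2) f(2) s by auto
  moreover have "hd (ins a b z) = v" using z(3) s by (cases z1) auto
  moreover have "distinct (ins a b z)" "set (ins a b z) \<subseteq> W" using z b s by auto
  ultimately show ?thesis
    unfolding partial_tour_def using E(1) f(1) s
    by (intro conjI exI[of _ "insert f E"]) auto
qed

lemma partial_tour_grow:
  fixes v :: nat
  assumes "Metric_space M d" "Metric_space.partial_tour d v F W z" "finite F" "W \<subseteq> M"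
    and "e \<in> F" "F \<subseteq> W \<times> W"
  shows "Metric_space.partial_tour d v F W (grow e z)"
  using partial_tour_ins[OF assms(1-4), of "fst e" "snd e"] partial_tour_ins[OF assms(1-4), of "snd e" "fst e"]
    assms unfolding grow_def by (cases e) auto

text \<open>Each insertion costs at most twice its edge, whence the factor 2. If a pass adds no
  vertex, the visited set is closed under adjacency and by connectedness contains all
  vertices.\<close>

lemma tree_tour_props:
  assumes ms: "Metric_space M d" and T: "is_tree (set (fst T)) (set (snd T))" and v: "v \<in> set (fst T)"
    and M: "set (fst T) \<subseteq> M"
  defines "Z \<equiv> tree_tour T v"
  shows "distinct Z" "Z \<noteq> []" "hd Z = v" "set Z = set (fst T)"
    "walk_len d (Z @ [v]) \<le> 2 * (\<Sum>(a, b)\<in>set (snd T). d a b)"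
proof -
  interpret Metric_space M d by (rule ms)
  let ?W = "set (fst T)" and ?F = "set (snd T)"
  have FW: "?F \<subseteq> ?W \<times> ?W" using T by (auto simp: is_tree_def)
  define pass where "pass = fold grow (snd T)"
  define z where "z j = (pass ^^ j) [v]" for j
  have Z: "Z = z (length (fst T))"
    unfolding Z_def tree_tour_def z_def pass_def fold_const ..
  have inv: "partial_tour v ?F ?W (fold grow F y)" if "partial_tour v ?F ?W y" "set F \<subseteq> ?F" for F y
    using that
  proof (induction F arbitrary: y)
    case (Cons e F)
    then show ?case
      using partial_tour_grow[OF ms Cons.prems(1) _ M, of e] FW by simp
  qed simp
  have pt: "partial_tour v ?F ?W (z j)" for j
  proof (induction j)
    case 0
    have "walk_len d ([v] @ [v]) \<le> 2 * (\<Sum>(a, b)\<in>{}. d a b)" using v M by auto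
    then show ?case using v unfolding partial_tour_def z_def by (auto intro!: exI[of _ "{}"])
  next
    case (Suc j)
    then show ?case using inv[of "z j" "snd T"] by (simp add: z_def pass_def)
  qed
  have zp: "distinct (z j)" "v \<in> set (z j)" "set (z j) \<subseteq> ?W" for j
    using pt[of j] unfolding partial_tour_def by auto
  have step: "?W \<subseteq> set (z j) \<or> card (set (z j)) < card (set (z (Suc j)))" for j
  proof (rule disjCI)
    assume n: "\<not> card (set (z j)) < card (set (z (Suc j)))"
    have zS: "z (Suc j) = fold grow (snd T) (z j)" by (simp add: z_def pass_def)
    then have "set (z j) \<subseteq> set (z (Suc j))" using fold_grow_mono[OF zp(1)] by simp
    then have eq: "set (z (Suc j)) = set (z j)"
      using n by (metis List.finite_set card_seteq not_less)
    have closed: "b \<in> set (z j)" if "a \<in> set (z j)" "(a, b) \<in> ?F \<union> ?F\<inverse>" for a b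
      using that fold_grow_ends[OF zp(1)[of j], of _ "snd T"] eq unfolding zS by fastforce
    have "w \<in> set (z j)" if "(v, w) \<in> (?F \<union> ?F\<inverse>)\<^sup>*" for w
      using that by (induction rule: rtrancl_induct) (use zp closed in blast)+
    then show "?W \<subseteq> set (z j)" using T v unfolding is_tree_def by blast
  qed
  have keep: "set (z j) \<subseteq> set (z (Suc j))" for j
    using fold_grow_mono[OF zp(1)[of j], of "snd T"] by (simp add: z_def pass_def)
  \<comment> \<open>With \<open>j\<close> equal to the length of the vertex list, the second
    alternative would demand more vertices than the tree has.\<close>
  have "?W \<subseteq> set (z j) \<or> Suc j \<le> card (set (z j))" for j
  proof (induction j)
    case 0
    then show ?case by (simp add: z_def)
  next
    case (Suc j)
    then show ?case using step[of j] keep[of j] by auto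
  qed
  from this[of "length (fst T)"] have "?W \<subseteq> set Z"
  proof
    assume "Suc (length (fst T)) \<le> card (set (z (length (fst T))))"
    also have "\<dots> \<le> card ?W" using zp by (intro card_mono) auto
    also have "\<dots> \<le> length (fst T)" by (rule card_length)
    finally show ?thesis by simp
  qed (simp add: Z)
  then show "set Z = ?W" using zp(3)[of "length (fst T)"] unfolding Z by (rule equalityI[rotated])
  obtain E where E: "E \<subseteq> ?F" "walk_len d (Z @ [v]) \<le> 2 * (\<Sum>(a, b)\<in>E. d a b)"
    and rest: "distinct Z" "Z \<noteq> []" "hd Z = v"
    using pt[of "length (fst T)"] unfolding partial_tour_def Z[symmetric] by blast
  show "distinct Z" "Z \<noteq> []" "hd Z = v" by (fact rest)+
  have "(\<Sum>(a, b)\<in>E. d a b) \<le> (\<Sum>(a, b)\<in>?F. d a b)"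
    using E(1) by (intro sum_mono2) auto
  then show "walk_len d (Z @ [v]) \<le> 2 * (\<Sum>(a, b)\<in>?F. d a b)" using E(2) by linarith
qed

section \<open>The backbone\<close>

lemma lookup_nth: "i < length xs \<Longrightarrow> lookup xs i d = xs ! i"
proof -
  have "fold (\<lambda>p s. if fst p = i then snd p else s) (List.enumerate n xs) d =
      (if n \<le> i \<and> i < n + length xs then xs ! (i - n) else d)" for n d
    by (induction xs arbitrary: n d) (auto simp: nth_Cons' Suc_diff_le)
  then show "i < length xs \<Longrightarrow> lookup xs i d = xs ! i" by (simp add: lookup_def)
qed

lemma nearest_props:
  shows "nearest M z v r \<in> insert r (set z)"
    and "u \<in> insert r (set z) \<Longrightarrow> mdist M (nearest M z v r) v \<le> mdist M u v"
proof -
  have "nearest M z v r \<in> insert r (set z) \<and>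
      (\<forall>u\<in>insert r (set z). mdist M (nearest M z v r) v \<le> mdist M u v)"
    unfolding nearest_def
  proof (induction z arbitrary: r)
    case (Cons x z)
    let ?r = "if mdist M x v < mdist M r v then x else r"
    have "mdist M ?r v \<le> mdist M r v" "mdist M ?r v \<le> mdist M x v" by auto
    then show ?case using Cons.IH[of ?r] by auto
  qed simp
  then show "nearest M z v r \<in> insert r (set z)"
    "u \<in> insert r (set z) \<Longrightarrow> mdist M (nearest M z v r) v \<le> mdist M u v" by blast+
qed

context dar_setup
begin

lemma mdist_dst: "u < nverts I \<Longrightarrow> v < nverts I \<Longrightarrow> dst I u v = real_of_rat (mdist (dist_matrix I) u v)"
proof -
  assume uv: "u < nverts I" "v < nverts I"
  then have "length (dist_matrix I ! u) = nverts I"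
    using valid by (simp add: valid_dar_inst_def valid_pairs_inst_def nverts_def)
  then show ?thesis using uv by (simp add: dst_def mdist_def lookup_nth nverts_def)
qed

text \<open>The numbers \<open>c\<close> are the connection costs in the form that
  \<open>online_connection_bound\<close> expects: a source inserted after its nearest predecessor is
  no farther from it than from the root or any earlier source, and a source already present costs
  0.\<close>

lemma backbone_props:
  assumes "set R \<subseteq> set (requests (pairs I))"
  defines "Z \<equiv> backbone (dist_matrix I) (root I)"
  shows "distinct (Z R) \<and> Z R \<noteq> [] \<and> hd (Z R) = root I \<and> set (Z R) = insert (root I) (src ` set R) \<and>
    (\<exists>c. walk_len (dst I) (Z R @ [root I]) \<le> 2 * sum c {..<length R} \<and>
      (\<forall>j<length R. c j \<le> dst I (root I) (src (R ! j)) \<and> (\<forall>i<j. c j \<le> dst I (src (R ! i)) (src (R ! j)))))"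
  using assms(1)
proof (induction R rule: rev_induct)
  case Nil
  then show ?case using root_vert by (auto simp: Z_def backbone_def)
next
  case (snoc x R)
  obtain c where IH: "distinct (Z R)" "Z R \<noteq> []" "hd (Z R) = root I" "set (Z R) = insert (root I) (src ` set R)"
    and c: "walk_len (dst I) (Z R @ [root I]) \<le> 2 * sum c {..<length R}"
    "\<And>j. j < length R \<Longrightarrow> c j \<le> dst I (root I) (src (R ! j))"
    "\<And>i j. j < length R \<Longrightarrow> i < j \<Longrightarrow> c j \<le> dst I (src (R ! i)) (src (R ! j))"
    using snoc by auto
  have verts: "set (Z R) \<subseteq> {..<nverts I}" "src x < nverts I"
    unfolding IH(4) using snoc.prems root_vert request_props(4) by auto
  have Zx: "Z (R @ [x]) = (if src x \<in> set (Z R) then Z R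
      else ins (nearest (dist_matrix I) (Z R) (src x) (root I)) (src x) (Z R))"
    by (simp add: Z_def backbone_def)
  have combine: "\<exists>c'. walk_len (dst I) (Z (R @ [x]) @ [root I]) \<le> 2 * sum c' {..<length (R @ [x])} \<and>
      (\<forall>j<length (R @ [x]). c' j \<le> dst I (root I) (src ((R @ [x]) ! j)) \<and>
        (\<forall>i<j. c' j \<le> dst I (src ((R @ [x]) ! i)) (src ((R @ [x]) ! j))))"
    if new: "\<And>u. u \<in> set (Z R) \<Longrightarrow> y \<le> dst I u (src x)"
      and len: "walk_len (dst I) (Z (R @ [x]) @ [root I]) \<le> walk_len (dst I) (Z R @ [root I]) + 2 * y" for y
  proof (intro exI conjI allI impI)
    let ?c = "c(length R := y)"
    have "sum ?c {..<length (R @ [x])} = sum c {..<length R} + y" by simp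
    then show "walk_len (dst I) (Z (R @ [x]) @ [root I]) \<le> 2 * sum ?c {..<length (R @ [x])}"
      using len c(1) by simp
    fix j assume j: "j < length (R @ [x])"
    show "?c j \<le> dst I (root I) (src ((R @ [x]) ! j))"
      using j c(2)[of j] new[of "root I"] IH(4) by (auto simp: nth_append less_Suc_eq)
    fix i assume i: "i < j"
    show "?c j \<le> dst I (src ((R @ [x]) ! i)) (src ((R @ [x]) ! j))"
      using i j c(3)[of j i] new[of "src (R ! i)"] IH(4) by (auto simp: nth_append less_Suc_eq)
  qed
  show ?case
  proof (cases "src x \<in> set (Z R)")
    case True
    then have e: "Z (R @ [x]) = Z R" unfolding Zx by simp
    show ?thesis using combine[of 0] IH True unfolding e by auto
  next
    case False
    let ?u = "nearest (dist_matrix I) (Z R) (src x) (root I)"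
    have u: "?u \<in> set (Z R)" using nearest_props(1)[of "dist_matrix I" "Z R"] IH(4) by blast
    have min: "dst I ?u (src x) \<le> dst I w (src x)" if "w \<in> set (Z R)" for w
    proof -
      have "mdist (dist_matrix I) ?u (src x) \<le> mdist (dist_matrix I) w (src x)"
        using that by (intro nearest_props(2)) simp
      then show ?thesis using verts u that mdist_dst by (auto simp: subset_iff of_rat_less_eq)
    qed
    obtain z1 z2 where s: "Z R = z1 @ ?u # z2" "ins ?u (src x) (Z R) = z1 @ ?u # src x # z2"
      by (rule ins_split[OF IH(1) u False])
    have e: "Z (R @ [x]) = z1 @ ?u # src x # z2" using Zx False s(2) by simp
    have "set (z1 @ ?u # z2 @ [root I]) \<subseteq> {..<nverts I}" using verts(1) root_vert by (subst (asm) s(1)) auto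
    then have "walk_len (dst I) (z1 @ ?u # src x # z2 @ [root I])
        \<le> walk_len (dst I) (z1 @ ?u # z2 @ [root I]) + 2 * dst I ?u (src x)"
      using verts(2) by (intro walk_len_insert) auto
    then have "walk_len (dst I) (Z (R @ [x]) @ [root I]) \<le> walk_len (dst I) (Z R @ [root I]) + 2 * dst I ?u (src x)"
      unfolding e by (subst (2) s(1)) simp
    note c' = combine[OF min this]
    have "set (Z (R @ [x])) = insert (src x) (set (Z R))" using set_ins[OF IH(1) u False] Zx False by simp
    moreover have "distinct (Z (R @ [x]))" using distinct_ins[OF IH(1) u False] Zx False by simp
    moreover have "hd (Z (R @ [x])) = root I" using IH(3) unfolding e by (subst (asm) s(1)) (cases z1; simp)
    moreover have "Z (R @ [x]) \<noteq> []" unfolding e by simp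
    ultimately show ?thesis using c' IH(4) by auto
  qed
qed

text \<open>The stops of a feasible tour form a walk through the root and all sources, against which
  the connection costs are measured. The 2 comes from going to an inserted source and back.\<close>

lemma backbone_length:
  assumes R: "set R \<subseteq> set (requests (pairs I))" and es: "dar_feasible I es"
  shows "walk_len (dst I) (backbone (dist_matrix I) (root I) R @ [root I])
    \<le> 2 * route_length I (root I) es * harm (length R)"
proof -
  let ?ws = "stops (root I) es"
  have srv: "serves I (root I) {} (\<lambda>i. fst (pairs I ! i)) es"
    using es by (simp add: dar_feasible_def)
  obtain c where c: "walk_len (dst I) (backbone (dist_matrix I) (root I) R @ [root I]) \<le> 2 * sum c {..<length R}"
    "\<And>j. j < length R \<Longrightarrow> c j \<le> dst I (root I) (src (R ! j))"
    "\<And>i j. j < length R \<Longrightarrow> i < j \<Longrightarrow> c j \<le> dst I (src (R ! i)) (src (R ! j))"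
    using backbone_props[OF R] by blast
  have "sum c {..<length R} \<le> walk_len (dst I) ?ws * harm (card {..<length R})"
  proof (rule online_connection_bound[where v = "\<lambda>j. src (R ! j)"])
    show "set ?ws \<subseteq> {..<nverts I}" by (rule serves_stops_verts[OF srv root_vert])
    show "root I \<in> set ?ws" using stops_Cons[of "root I" es] by auto
    show "(\<lambda>j. src (R ! j)) ` {..<length R} \<subseteq> set ?ws"
    proof (intro subsetI, elim imageE)
      fix u j assume u: "u = src (R ! j)" "j \<in> {..<length R}"
      then have "R ! j \<in> set (requests (pairs I))" using R by auto
      then have "carried_between (fst (R ! j)) (src (R ! j)) (dest (R ! j)) ?ws (loads {} es)"
        using serves_carry[OF srv, of "fst (R ! j)"] request_props[of "R ! j"] by auto
      then obtain a where "a < length ?ws" "?ws ! a = u"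
        unfolding carried_between_def u(1) by (meson le_less_trans)
      then show "u \<in> set ?ws" by (metis nth_mem)
    qed
  qed (use c in auto)
  then show ?thesis
    using c(1) route_length_stops[OF root_vert srv] by (simp add: algebra_simps)
qed

end

section \<open>Executing a schedule\<close>

fun moves :: "event list \<Rightarrow> nat list" where
  "moves [] = []"
| "moves (Move w # es) = w # moves es"
| "moves (Pick i # es) = moves es"
| "moves (Drop i # es) = moves es"

lemma moves_append [simp]: "moves (xs @ ys) = moves xs @ moves ys"
  by (induction xs rule: moves.induct) auto

lemma moves_concat: "moves (concat xss) = concat (map moves xss)"
  by (induction xss) auto

lemma moves_Pick [simp]: "moves (map (\<lambda>x. Pick (f x)) xs) = []"
  by (induction xs) auto

lemma moves_Drop [simp]: "moves (map (\<lambda>x. Drop (f x)) xs) = []"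
  by (induction xs) auto

lemma route_length_moves: "route_length I v es = walk_len (dst I) (v # moves es)"
  by (induction I v es rule: route_length.induct) auto

definition route_of :: "service \<Rightarrow> nat list" where
  "route_of S = snd (snd S) @ snd (snd S) @ [fst S]"

lemma moves_perform: "moves (perform S) = route_of S"
  by (simp add: perform_def route_of_def moves_concat comp_def)

lemma moves_schedule:
  "moves (schedule r Z SS) =
    concat (map (\<lambda>v. v # concat (map route_of (filter (\<lambda>S. fst S = v) SS))) Z) @ [r]"
  by (simp add: schedule_def moves_concat comp_def moves_perform)

definition ids :: "service list \<Rightarrow> nat list" where
  "ids SS = concat (map (\<lambda>S. map fst (fst (snd S))) SS)"

text \<open>In this form successive deliveries compose by union of the delivered sets.\<close>

definition deliver :: "dar_inst \<Rightarrow> (nat \<Rightarrow> nat) \<Rightarrow> nat set \<Rightarrow> nat \<Rightarrow> nat" where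
  "deliver I L X j = (if j \<in> X then snd (pairs I ! j) else L j)"

lemma deliver_simps [simp]: "deliver I L {} = L" "deliver I (deliver I L X) Y = deliver I L (X \<union> Y)"
  by (auto simp: deliver_def fun_eq_iff)

lemma serves_picks:
  assumes "finite C" "distinct is" "set is \<inter> C = {}" "card (C \<union> set is) \<le> capacity I"
    and "\<And>i. i \<in> set is \<Longrightarrow> i < npairs I \<and> L i = v"
    and "serves I v (C \<union> set is) L rest"
  shows "serves I v C L (map Pick is @ rest)"
  using assms
proof (induction "is" arbitrary: C)
  case (Cons i js)
  have "card C < card (C \<union> set (i # js))"
    using Cons.prems by (intro psubset_card_mono) auto
  then have "card C < capacity I" using Cons.prems(4) by simp
  moreover have "serves I v (insert i C) L (map Pick js @ rest)"
    using Cons.prems by (intro Cons.IH) (auto simp: insert_commute)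
  ultimately show ?case using Cons.prems by simp
qed simp

lemma serves_drops:
  assumes "distinct is" "set is \<subseteq> C" "\<And>i. i \<in> set is \<Longrightarrow> snd (pairs I ! i) = v"
    and "serves I v (C - set is) (deliver I L (set is)) rest"
  shows "serves I v C L (map Drop is @ rest)"
  using assms
proof (induction "is" arbitrary: C L)
  case (Cons i js)
  have "L(i := v) = deliver I L {i}" using Cons.prems(3)[of i] by (auto simp: deliver_def)
  moreover have "C - {i} - set js = C - set (i # js)" by auto
  ultimately have "serves I v (C - {i}) (L(i := v)) (map Drop js @ rest)"
    using Cons.prems by (intro Cons.IH) auto
  then show ?case using Cons.prems by simp
qed simp

text \<open>The load only grows during the first walk, so it suffices to check the capacity for the
  final load. Since no vertex of \<open>Z\<close> is repeated, no object is picked up twice.\<close>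

lemma serves_pick_tour:
  assumes "distinct Z" "set Z \<subseteq> {..<nverts I}" "distinct (map fst Q)"
    and Q: "\<And>x. x \<in> set Q \<Longrightarrow> fst x < npairs I \<and> L (fst x) = src x"
    and "finite C" "C \<inter> fst ` {x \<in> set Q. src x \<in> set Z} = {}"
    and "card (C \<union> fst ` {x \<in> set Q. src x \<in> set Z}) \<le> capacity I"
    and "serves I (last (v # Z)) (C \<union> fst ` {x \<in> set Q. src x \<in> set Z}) L rest"
  shows "serves I v C L
    (concat (map (\<lambda>u. Move u # map (\<lambda>x. Pick (fst x)) (filter (\<lambda>x. src x = u) Q)) Z) @ rest)"
  using assms(1,2,5-8)
proof (induction Z arbitrary: v C)
  case (Cons u Z)
  let ?P = "map fst (filter (\<lambda>x. src x = u) Q)"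
  let ?R = "concat (map (\<lambda>u. Move u # map (\<lambda>x. Pick (fst x)) (filter (\<lambda>x. src x = u) Q)) Z) @ rest"
  have setP: "set ?P = fst ` {x \<in> set Q. src x = u}" by auto
  have U: "C \<union> fst ` {x \<in> set Q. src x \<in> set (u # Z)} = (C \<union> set ?P) \<union> fst ` {x \<in> set Q. src x \<in> set Z}"
    unfolding setP by auto
  have inj: "inj_on fst (set Q)" using assms(3) by (simp add: distinct_map)
  have "set ?P \<inter> fst ` {x \<in> set Q. src x \<in> set Z} = {}"
  proof (rule ccontr)
    assume "\<not> ?thesis"
    then obtain x y where "x \<in> set Q" "src x = u" "y \<in> set Q" "src y \<in> set Z" "fst x = fst y"
      unfolding setP by blast
    then show False using inj Cons.prems(1) by (metis distinct.simps(2) inj_onD)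
  qed
  moreover have "C \<inter> fst ` {x \<in> set Q. src x \<in> set Z} = {}" using Cons.prems(4) by auto
  ultimately have "(C \<union> set ?P) \<inter> fst ` {x \<in> set Q. src x \<in> set Z} = {}" by blast
  then have "serves I u (C \<union> set ?P) L ?R"
    using Cons.prems U by (intro Cons.IH) auto
  moreover have "card (C \<union> set ?P) \<le> card ((C \<union> set ?P) \<union> fst ` {x \<in> set Q. src x \<in> set Z})"
    using Cons.prems(3) by (intro card_mono) auto
  ultimately have "serves I u C L (map Pick ?P @ ?R)"
    using Cons.prems(3-5) Q assms(3) U unfolding setP
    by (intro serves_picks) (auto simp: distinct_map_filter setP)
  then show ?case using Cons.prems(2) by (simp add: comp_def)
qed simp

lemma serves_drop_tour:
  assumes "distinct Z" "set Z \<subseteq> {..<nverts I}" "distinct (map fst Q)"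
    and Q: "\<And>x. x \<in> set Q \<Longrightarrow> snd (pairs I ! fst x) = dest x"
    and "fst ` {x \<in> set Q. dest x \<in> set Z} \<subseteq> C"
    and "serves I (last (v # Z)) (C - fst ` {x \<in> set Q. dest x \<in> set Z})
      (deliver I L (fst ` {x \<in> set Q. dest x \<in> set Z})) rest"
  shows "serves I v C L
    (concat (map (\<lambda>u. Move u # map (\<lambda>x. Drop (fst x)) (filter (\<lambda>x. dest x = u) Q)) Z) @ rest)"
  using assms(1,2,5,6)
proof (induction Z arbitrary: v C L)
  case (Cons u Z)
  let ?P = "map fst (filter (\<lambda>x. dest x = u) Q)"
  let ?R = "concat (map (\<lambda>u. Move u # map (\<lambda>x. Drop (fst x)) (filter (\<lambda>x. dest x = u) Q)) Z) @ rest"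
  have setP: "set ?P = fst ` {x \<in> set Q. dest x = u}" by auto
  have U: "fst ` {x \<in> set Q. dest x \<in> set (u # Z)} = set ?P \<union> fst ` {x \<in> set Q. dest x \<in> set Z}"
    unfolding setP by auto
  have inj: "inj_on fst (set Q)" using assms(3) by (simp add: distinct_map)
  have disj: "set ?P \<inter> fst ` {x \<in> set Q. dest x \<in> set Z} = {}"
  proof (rule ccontr)
    assume "\<not> ?thesis"
    then obtain x y where "x \<in> set Q" "dest x = u" "y \<in> set Q" "dest y \<in> set Z" "fst x = fst y"
      unfolding setP by blast
    then show False using inj Cons.prems(1) by (metis distinct.simps(2) inj_onD)
  qed
  have "serves I u (C - set ?P) (deliver I L (set ?P)) ?R"
  proof (rule Cons.IH)
    show "fst ` {x \<in> set Q. dest x \<in> set Z} \<subseteq> C - set ?P"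
      using Cons.prems(3) disj unfolding U by blast
    have "C - set ?P - fst ` {x \<in> set Q. dest x \<in> set Z} = C - fst ` {x \<in> set Q. dest x \<in> set (u # Z)}"
      unfolding U by blast
    then show "serves I (last (u # Z)) (C - set ?P - fst ` {x \<in> set Q. dest x \<in> set Z})
        (deliver I (deliver I L (set ?P)) (fst ` {x \<in> set Q. dest x \<in> set Z})) rest"
      using Cons.prems(4) U by simp
  qed (use Cons.prems in auto)
  then have "serves I u C L (map Drop ?P @ ?R)"
  proof (intro serves_drops)
    show "distinct ?P" using assms(3) by (simp add: distinct_map_filter)
    show "set ?P \<subseteq> C" using Cons.prems(3) unfolding U by blast
    show "snd (pairs I ! i) = u" if "i \<in> set ?P" for i using that Q by auto
  qed
  then show ?case using Cons.prems(2) by (simp add: comp_def)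
qed simp

section \<open>Feasibility and length of the schedule\<close>

context dar_setup
begin

text \<open>The start vertex is a source, which places it on the backbone; the bound on the number
  of requests allows all of them on board at once.\<close>

definition good_service :: "service \<Rightarrow> bool" where
  "good_service S \<longleftrightarrow> (case S of (v, Q, Z) \<Rightarrow>
     distinct Z \<and> Z \<noteq> [] \<and> hd Z = v \<and> set Z \<subseteq> {..<nverts I} \<and>
     set Q \<subseteq> set (requests (pairs I)) \<and> distinct (map fst Q) \<and> length Q \<le> capacity I \<and>
     v \<in> src ` set Q \<and> (\<forall>x\<in>set Q. joins (set Z) x))"

lemma serves_perform:
  assumes S: "good_service S" and L: "\<And>x. x \<in> set (fst (snd S)) \<Longrightarrow> L (fst x) = src x"
    and rest: "serves I (fst S) {} (deliver I L (set (ids [S]))) rest"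
  shows "serves I u {} L (perform S @ rest)"
proof -
  obtain v Q Z where Sv: "S = (v, Q, Z)" by (metis surj_pair)
  have Z: "distinct Z" "Z \<noteq> []" "set Z \<subseteq> {..<nverts I}" "hd Z = v"
    and Q: "set Q \<subseteq> set (requests (pairs I))" "distinct (map fst Q)" "length Q \<le> capacity I"
      "\<And>x. x \<in> set Q \<Longrightarrow> joins (set Z) x"
    using S unfolding good_service_def Sv by auto
  have v: "v < nverts I" using Z by (cases Z) auto
  have A: "fst ` {x \<in> set Q. src x \<in> set Z} = fst ` set Q" "fst ` {x \<in> set Q. dest x \<in> set Z} = fst ` set Q"
    using Q(4) by auto
  have "card (fst ` set Q) \<le> capacity I"
    using Q(3) by (metis card_image_le card_length List.finite_set order_trans)
  moreover have "serves I (last (u # Z)) (fst ` set Q) L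
      (concat (map (\<lambda>u. Move u # map (\<lambda>x. Drop (fst x)) (filter (\<lambda>x. dest x = u) Q)) Z) @ [Move v] @ rest)"
  proof (rule serves_drop_tour)
    show "snd (pairs I ! fst x) = dest x" if "x \<in> set Q" for x
      using that Q(1) request_props(2)[of x] by auto
    show "serves I (last (last (u # Z) # Z)) (fst ` set Q - fst ` {x \<in> set Q. dest x \<in> set Z})
        (deliver I L (fst ` {x \<in> set Q. dest x \<in> set Z})) ([Move v] @ rest)"
      using rest v unfolding A Sv by (simp add: ids_def)
  qed (use Z Q A in auto)
  moreover have "fst x < npairs I \<and> L (fst x) = src x" if "x \<in> set Q" for x
    using that L[of x] Q(1) request_props(1)[of x] unfolding Sv by auto
  ultimately have "serves I u {} L
      (concat (map (\<lambda>u. Move u # map (\<lambda>x. Pick (fst x)) (filter (\<lambda>x. src x = u) Q)) Z) @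
       concat (map (\<lambda>u. Move u # map (\<lambda>x. Drop (fst x)) (filter (\<lambda>x. dest x = u) Q)) Z) @ [Move v] @ rest)"
    using Z(1,3) Q(2) by (intro serves_pick_tour) (simp_all add: A)
  then show ?thesis by (simp add: perform_def Sv)
qed

lemma ids_simps [simp]: "ids [] = []" "ids (S # SS) = map fst (fst (snd S)) @ ids SS"
  by (simp_all add: ids_def)

lemma ids_mem: "S \<in> set SS \<Longrightarrow> x \<in> set (fst (snd S)) \<Longrightarrow> fst x \<in> set (ids SS)"
  by (auto simp: ids_def)

lemma set_ids: "set (ids SS) = (\<Union>S\<in>set SS. fst ` set (fst (snd S)))"
  by (auto simp: ids_def)

lemma distinct_ids_filter: "distinct (ids SS) \<Longrightarrow> distinct (ids (filter P SS))"
  by (induction SS) (auto simp: set_ids)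

lemma disjoint_ids_filter:
  "distinct (ids SS) \<Longrightarrow> S \<in> set SS \<Longrightarrow> \<not> P S \<Longrightarrow> x \<in> set (fst (snd S)) \<Longrightarrow> fst x \<notin> set (ids (filter P SS))"
proof (induction SS)
  case (Cons T SS)
  have sub: "set (ids (filter P SS)) \<subseteq> set (ids SS)" by (auto simp: set_ids)
  show ?case
  proof (cases "S = T")
    case True
    then have "fst x \<notin> set (ids SS)" using Cons.prems by auto
    then show ?thesis using True Cons.prems(3) sub by auto
  next
    case False
    then have "S \<in> set SS" using Cons.prems(2) by simp
    then have "fst x \<notin> set (ids (filter P SS))" "fst x \<in> set (ids SS)"
      using Cons ids_mem by auto
    then show ?thesis using Cons.prems(1) by auto
  qed
qed simp

lemma serves_performs:
  assumes "\<And>S. S \<in> set SS \<Longrightarrow> good_service S \<and> fst S = v" "distinct (ids SS)"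
    and "\<And>S x. S \<in> set SS \<Longrightarrow> x \<in> set (fst (snd S)) \<Longrightarrow> L (fst x) = src x"
    and "serves I v {} (deliver I L (set (ids SS))) rest"
  shows "serves I v {} L (concat (map perform SS) @ rest)"
  using assms
proof (induction SS arbitrary: L)
  case (Cons S SS)
  have "serves I v {} (deliver I L (set (ids [S]))) (concat (map perform SS) @ rest)"
  proof (rule Cons.IH)
    fix S' x assume S': "S' \<in> set SS" "x \<in> set (fst (snd S'))"
    then have "fst x \<notin> set (ids [S])" using Cons.prems(2) ids_mem[OF S'] by auto
    then show "deliver I L (set (ids [S])) (fst x) = src x"
      using Cons.prems(3)[of S' x] S' by (simp add: deliver_def)
  next
    show "serves I v {} (deliver I (deliver I L (set (ids [S]))) (set (ids SS))) rest"
      using Cons.prems(4) by simp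
  qed (use Cons.prems in auto)
  then have "serves I v {} L (perform S @ concat (map perform SS) @ rest)"
    using Cons.prems(1)[of S] Cons.prems(3)[of S] by (intro serves_perform) simp_all
  then show ?case by simp
qed simp

text \<open>Objects are assumed at their sources only for services based at vertices still ahead,
  since in the induction the earlier ones have already been delivered.\<close>

lemma serves_schedule:
  assumes "distinct Z" "set Z \<subseteq> {..<nverts I}" "\<And>S. S \<in> set SS \<Longrightarrow> good_service S" "distinct (ids SS)"
    and "\<And>S x. S \<in> set SS \<Longrightarrow> fst S \<in> set Z \<Longrightarrow> x \<in> set (fst (snd S)) \<Longrightarrow> L (fst x) = src x"
    and "serves I (last (u # Z)) {} (deliver I L (set (ids (filter (\<lambda>S. fst S \<in> set Z) SS)))) rest"
  shows "serves I u {} L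
    (concat (map (\<lambda>v. Move v # concat (map perform (filter (\<lambda>S. fst S = v) SS))) Z) @ rest)"
  using assms(1,2,5,6)
proof (induction Z arbitrary: u L)
  case (Cons v Z)
  let ?A = "filter (\<lambda>S. fst S = v) SS"
  let ?R = "concat (map (\<lambda>v. Move v # concat (map perform (filter (\<lambda>S. fst S = v) SS))) Z) @ rest"
  have "serves I v {} (deliver I L (set (ids ?A))) ?R"
  proof (rule Cons.IH)
    fix S x assume S: "S \<in> set SS" "fst S \<in> set Z" "x \<in> set (fst (snd S))"
    then have "fst x \<notin> set (ids ?A)"
      using Cons.prems(1) by (intro disjoint_ids_filter[OF assms(4)]) auto
    then show "deliver I L (set (ids ?A)) (fst x) = src x"
      using Cons.prems(3)[of S x] S by (simp add: deliver_def)
  next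
    have "set (ids ?A) \<union> set (ids (filter (\<lambda>S. fst S \<in> set Z) SS)) = set (ids (filter (\<lambda>S. fst S \<in> set (v # Z)) SS))"
      by (auto simp: set_ids)
    then show "serves I (last (v # Z)) {}
        (deliver I (deliver I L (set (ids ?A))) (set (ids (filter (\<lambda>S. fst S \<in> set Z) SS)))) rest"
      using Cons.prems(4) by simp
  qed (use Cons.prems in auto)
  then have "serves I v {} L (concat (map perform ?A) @ ?R)"
    using Cons.prems assms(3) distinct_ids_filter[OF assms(4)]
    by (intro serves_performs) auto
  then show ?case using Cons.prems by simp
qed simp

lemma schedule_feasible:
  assumes Z: "distinct Z" "set Z = insert (root I) (src ` set (requests (pairs I)))"
    and SS: "\<And>S. S \<in> set SS \<Longrightarrow> good_service S" "distinct (ids SS)"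
      "fst ` set (requests (pairs I)) \<subseteq> set (ids SS)"
  shows "dar_feasible I (schedule (root I) Z SS)"
proof -
  have key: "fst S \<in> set Z" if "S \<in> set SS" for S
    using SS(1)[OF that] unfolding Z(2) good_service_def by (auto split: prod.splits)
  then have flt: "filter (\<lambda>S. fst S \<in> set Z) SS = SS" by (simp add: filter_id_conv)
  let ?L = "\<lambda>i. fst (pairs I ! i)"
  have "serves I (root I) {} ?L
      (concat (map (\<lambda>v. Move v # concat (map perform (filter (\<lambda>S. fst S = v) SS))) Z) @ [Move (root I)])"
  proof (rule serves_schedule[OF Z(1) _ SS(1,2)])
    show "set Z \<subseteq> {..<nverts I}" unfolding Z(2) using root_vert request_props(4) by auto
    fix S x assume "S \<in> set SS" "x \<in> set (fst (snd S))"
    then have "x \<in> set (requests (pairs I))"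
      using SS(1)[of S] unfolding good_service_def by (auto split: prod.splits)
    then show "fst (pairs I ! fst x) = src x" using request_props(2)[of x] by simp
  next
    have "deliver I ?L (set (ids SS)) i = snd (pairs I ! i)" if "i < npairs I" for i
    \<comment> \<open>With equal ends the initial place is the destination, whether or not the
      object is delivered.\<close>
    proof (cases "fst (pairs I ! i) = snd (pairs I ! i)")
      case False
      then have "i \<in> set (ids SS)" using SS(3) request_memI[OF that False] by force
      then show ?thesis by (simp add: deliver_def)
    qed (simp add: deliver_def)
    then show "serves I (last (root I # Z)) {}
        (deliver I ?L (set (ids (filter (\<lambda>S. fst S \<in> set Z) SS)))) [Move (root I)]"
      unfolding flt using root_vert by simp
  qed auto
  then show ?thesis by (simp add: dar_feasible_def schedule_def)
qed

text \<open>Each service goes twice around a closed walk based at \<open>v\<close>, so it can be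
  spliced out at \<open>v\<close> without affecting the rest.\<close>

lemma walk_len_detours:
  assumes "\<And>S. S \<in> set SS \<Longrightarrow> good_service S \<and> fst S = v" "v < nverts I"
  shows "walk_len (dst I) (v # concat (map route_of SS) @ rest) =
    (\<Sum>S\<leftarrow>SS. 2 * walk_len (dst I) (snd (snd S) @ [fst S])) + walk_len (dst I) (v # rest)"
  using assms(1)
proof (induction SS)
  case (Cons S SS)
  obtain Q Z where S: "S = (v, Q, Z)" using Cons.prems[of S] by (metis list.set_intros(1) prod.collapse)
  then obtain Z' where Z: "Z = v # Z'"
    using Cons.prems[of S] unfolding good_service_def by (cases Z) auto
  have "walk_len (dst I) (v # concat (map route_of (S # SS)) @ rest)
      = walk_len (dst I) ((v # Z') @ v # Z' @ v # concat (map route_of SS) @ rest)"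
    using assms(2) unfolding S Z route_of_def by simp
  also have "\<dots> = walk_len (dst I) (v # Z' @ [v]) + walk_len (dst I) (v # Z' @ [v])
      + walk_len (dst I) (v # concat (map route_of SS) @ rest)"
    using walk_len_append[of "dst I" "v # Z'" v "Z' @ v # concat (map route_of SS) @ rest"]
      walk_len_append[of "dst I" "v # Z'" v "concat (map route_of SS) @ rest"] by simp
  finally show ?case using Cons S Z by simp
qed simp

lemma schedule_walk:
  assumes "\<And>S. S \<in> set SS \<Longrightarrow> good_service S" "set Z \<subseteq> {..<nverts I}"
  shows "walk_len (dst I) (u # concat (map (\<lambda>v. v # concat (map route_of (filter (\<lambda>S. fst S = v) SS))) Z) @ [r])
    = walk_len (dst I) (u # Z @ [r]) +
      (\<Sum>v\<leftarrow>Z. \<Sum>S\<leftarrow>filter (\<lambda>S. fst S = v) SS. 2 * walk_len (dst I) (snd (snd S) @ [fst S]))"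
  using assms(2)
proof (induction Z arbitrary: u)
  case (Cons v Z)
  let ?A = "filter (\<lambda>S. fst S = v) SS"
  let ?R = "concat (map (\<lambda>v. v # concat (map route_of (filter (\<lambda>S. fst S = v) SS))) Z) @ [r]"
  have "walk_len (dst I) (v # concat (map route_of ?A) @ ?R) =
     (\<Sum>S\<leftarrow>?A. 2 * walk_len (dst I) (snd (snd S) @ [fst S])) + walk_len (dst I) (v # ?R)"
    using assms(1) Cons.prems by (intro walk_len_detours) auto
  then show ?case using Cons by simp
qed simp

text \<open>As \<open>Z\<close> has no repetitions, each \<open>S\<close> is counted for at most one
  key, and \<open>g\<close> is nonnegative.\<close>

lemma sum_list_by_key:
  assumes "distinct Z" "\<And>S. 0 \<le> (g S :: real)"
  shows "(\<Sum>v\<leftarrow>Z. \<Sum>S\<leftarrow>filter (\<lambda>S. f S = v) SS. g S) \<le> (\<Sum>S\<leftarrow>SS. g S)"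
proof (induction SS)
  case (Cons T SS)
  have "(\<Sum>v\<leftarrow>Z. \<Sum>S\<leftarrow>filter (\<lambda>S. f S = v) (T # SS). g S) =
      (\<Sum>v\<leftarrow>Z. (if f T = v then g T else 0) + (\<Sum>S\<leftarrow>filter (\<lambda>S. f S = v) SS. g S))"
    by (intro arg_cong[where f = sum_list] map_cong) auto
  also have "\<dots> = (\<Sum>v\<in>set Z. if f T = v then g T else 0) + (\<Sum>v\<leftarrow>Z. \<Sum>S\<leftarrow>filter (\<lambda>S. f S = v) SS. g S)"
    using assms(1) by (simp add: sum_list_addf sum_list_distinct_conv_sum_set)
  also have "(\<Sum>v\<in>set Z. if f T = v then g T else 0) \<le> g T"
    using assms(2)[of T] by (simp add: sum.delta')
  finally show ?case using Cons by simp
qed simp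

lemma schedule_length:
  assumes Z: "distinct Z" "Z \<noteq> []" "hd Z = root I" "set Z \<subseteq> {..<nverts I}"
    and SS: "\<And>S. S \<in> set SS \<Longrightarrow> good_service S"
  shows "route_length I (root I) (schedule (root I) Z SS) \<le> walk_len (dst I) (Z @ [root I]) +
    (\<Sum>S\<leftarrow>SS. 2 * walk_len (dst I) (snd (snd S) @ [fst S]))"
proof -
  have "walk_len (dst I) (root I # Z @ [root I]) = walk_len (dst I) (Z @ [root I])"
    using Z(2,3) root_vert by (cases Z) auto
  then show ?thesis
    using schedule_walk[OF SS Z(4), of SS "root I" "root I"]
      sum_list_by_key[OF Z(1), of "\<lambda>S. 2 * walk_len (dst I) (snd (snd S) @ [fst S])" fst SS] walk_len_nonneg
    unfolding route_length_moves moves_schedule by auto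
qed

end

section \<open>The greedy phase\<close>

text \<open>The difference consists of \<open>r - s\<close> terms, none below \<open>1 / r\<close>.
  With \<open>r\<close> requests left before a round and \<open>s\<close> after it, this makes the
  greedy charges telescope.\<close>

lemma harm_diff_ge:
  assumes "s \<le> r" "0 < r"
  shows "real (r - s) / real r \<le> harm r - harm s"
  using assms
proof (induction r rule: dec_induct)
  case (step r)
  show ?case
  proof (cases "r = 0")
    case True
    then show ?thesis using step by (simp add: harm_Suc)
  next
    case False
    have "real (Suc r - s) / real (Suc r) = real (r - s) / real (Suc r) + 1 / real (Suc r)"
      using step.hyps by (simp add: Suc_diff_le add_divide_distrib)
    moreover have "real (r - s) / real (Suc r) \<le> real (r - s) / real r"
      using False by (intro divide_left_mono) auto
    ultimately show ?thesis using step.IH False by (simp add: harm_Suc divide_inverse)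
  qed
qed simp

lemma some_src_mem: "R \<noteq> [] \<Longrightarrow> some_src R \<in> src ` set R"
  by (induction R rule: rev_induct) (auto simp: some_src_def)

lemma (in dar_setup) inj_on_fst_requests: "inj_on fst (set (requests (pairs I)))"
  using request_props(2) by (intro inj_onI) (metis prod_eqI)

locale greedy_setup = dar_setup +
  fixes orc :: "oracle_inst \<Rightarrow> nat list \<times> (nat \<times> nat) list" and rho :: real
  assumes rho: "1 \<le> rho"
    and orc: "\<And>R. set R \<subseteq> set (requests (pairs I)) \<Longrightarrow> distinct R \<Longrightarrow> R \<noteq> [] \<Longrightarrow>
      ratio_forest_feasible (sub_inst (cap (capacity I) R))
        (orc (dist_matrix I, map snd (cap (capacity I) R), capacity I)) \<and>
      cost min_ratio_k_forest (sub_inst (cap (capacity I) R))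
        (orc (dist_matrix I, map snd (cap (capacity I) R), capacity I))
      \<le> rho * opt min_ratio_k_forest (sub_inst (cap (capacity I) R))"
begin

abbreviation step :: "req list \<times> service list \<Rightarrow> req list \<times> service list" where
  "step \<equiv> greedy_step orc (dist_matrix I) (capacity I)"

abbreviation tour_len :: "service \<Rightarrow> real" where
  "tour_len S \<equiv> walk_len (dst I) (snd (snd S) @ [fst S])"

definition greedy_inv :: "req list \<times> service list \<Rightarrow> bool" where
  "greedy_inv s \<longleftrightarrow> set (fst s) \<subseteq> set (requests (pairs I)) \<and> distinct (fst s) \<and>
     (\<forall>S\<in>set (snd s). good_service S) \<and> distinct (map fst (fst s) @ ids (snd s)) \<and>
     fst ` set (requests (pairs I)) \<subseteq> fst ` set (fst s) \<union> set (ids (snd s))"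

text \<open>With \<open>r\<close> requests left, the optimal ratio is at most the bound of
  \<open>forest_density\<close> divided by \<open>r\<close>. Serving \<open>q\<close> of them thus
  costs a share \<open>q / r\<close>, which the harmonic difference dominates. The 6 combines the 3
  of trimming with the 2 of walking around a tree.\<close>

lemma greedy_step_props:
  assumes inv: "greedy_inv (R, SS)" and R: "R \<noteq> []"
  obtains R' S where "step (R, SS) = (R', S # SS)" "greedy_inv (R', S # SS)" "length R' < length R"
    and "\<And>es. dar_feasible I es \<Longrightarrow> tour_len S \<le>
      6 * rho * real (floorlog 2 (length R)) * route_length I (root I) es * (harm (length R) - harm (length R'))"
proof -
  have Rs: "set R \<subseteq> set (requests (pairs I))" "distinct R"
    and SS: "\<And>S. S \<in> set SS \<Longrightarrow> good_service S" "distinct (map fst R @ ids SS)"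
      "fst ` set (requests (pairs I)) \<subseteq> fst ` set R \<union> set (ids SS)"
    using inv unfolding greedy_inv_def by auto
  define C where "C = cap (capacity I) R"
  define J where "J = sub_inst C"
  define T where "T = orc (dist_matrix I, map snd C, capacity I)"
  define Q where "Q = induced (fst T) C"
  define S where "S = service_of T C"
  define v where "v = some_src Q"
  define R' where "R' = filter (\<lambda>x. x \<notin> set Q) R"
  have T: "ratio_forest_feasible J T"
    "cost min_ratio_k_forest J T \<le> rho * opt min_ratio_k_forest J"
    using orc[OF Rs R] unfolding T_def J_def C_def by auto
  have C: "set C \<subseteq> set R" "distinct C" using cap_props(1,2) Rs(2) unfolding C_def by blast+
  have Qeq: "Q = filter (joins (set (fst T))) C" by (simp add: Q_def induced_def)
  have Q: "set Q \<subseteq> set C" "distinct Q" "\<And>x. x \<in> set Q \<Longrightarrow> joins (set (fst T)) x"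
    using C(2) unfolding Qeq by auto
  have nc: "num_connected J (set (fst T)) = length Q"
    unfolding J_def num_connected_sub_inst Qeq ..
  have lenQ: "1 \<le> length Q" "length Q \<le> capacity I"
    using T(1) unfolding ratio_forest_feasible_def nc by (simp_all add: J_def)
  then have "v \<in> src ` set Q" unfolding v_def by (intro some_src_mem) auto
  then have vT: "v \<in> set (fst T)" using Q(3) by auto
  have tree: "is_tree (set (fst T)) (set (snd T))" "set (fst T) \<subseteq> {..<nverts I}"
    using T(1) unfolding ratio_forest_feasible_def by (simp_all add: J_def)
  note tt = tree_tour_props[OF Metric_space_axioms tree(1) vT tree(2)]
  have S: "S = (v, Q, tree_tour T v)" by (simp add: S_def service_of_def v_def Q_def)
  have QR: "set Q \<subseteq> set R" using Q(1) C(1) by blast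
  have "inj_on fst (set R)" using inj_on_fst_requests Rs(1) by (rule inj_on_subset)
  then have injQ: "inj_on fst (set Q)" using QR by (rule inj_on_subset)
  have goodS: "good_service S"
    unfolding good_service_def S
    using tt(1-4) tree(2) QR Rs(1) Q(2,3) injQ lenQ(2) \<open>v \<in> src ` set Q\<close> by (auto simp: distinct_map)
  have lenR': "length R' + length Q = length R"
  proof -
    have "length (filter (\<lambda>x. x \<in> set Q) R) = card (set (filter (\<lambda>x. x \<in> set Q) R))"
      using Rs(2) by (intro distinct_card[symmetric]) simp
    also have "set (filter (\<lambda>x. x \<in> set Q) R) = set Q" using QR by auto
    also have "card (set Q) = length Q" using Q(2) by (rule distinct_card)
    finally show ?thesis
      using sum_length_filter_compl[of "\<lambda>x. x \<in> set Q" R] unfolding R'_def by simp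
  qed
  show thesis
  proof
    show "step (R, SS) = (R', S # SS)"
      using R by (simp add: greedy_step_def R'_def S_def Q_def T_def C_def)
    show "length R' < length R" using lenR' lenQ(1) by simp
    show "greedy_inv (R', S # SS)"
    proof -
      have "distinct (map fst R')"
        using SS(2) unfolding R'_def by (simp add: distinct_map_filter)
      moreover have "set (map fst Q) \<inter> set (ids SS) = {}" "set (map fst R') \<inter> set (ids SS) = {}"
        using SS(2) QR unfolding R'_def by auto
      moreover have "set (map fst R') \<inter> set (map fst Q) = {}"
        using \<open>inj_on fst (set R)\<close> QR unfolding R'_def inj_on_def by auto
      moreover have "distinct (map fst Q)" using injQ Q(2) by (simp add: distinct_map)
      ultimately have "distinct (map fst R' @ ids (S # SS))" using SS(2) unfolding S by auto
      moreover have "fst ` set R \<subseteq> fst ` set R' \<union> set (map fst Q)" unfolding R'_def by auto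
      then have "fst ` set (requests (pairs I)) \<subseteq> fst ` set R' \<union> set (ids (S # SS))"
        using SS(3) unfolding S by (simp, blast)
      ultimately show ?thesis
        using Rs SS(1) goodS unfolding greedy_inv_def R'_def by auto
    qed
    fix es assume es: "dar_feasible I es"
    let ?r = "real (length R)" and ?q = "real (length Q)"
    have r: "0 < ?r" using R by simp
    have q: "0 < ?q" using lenQ(1) by linarith
    let ?K = "3 * real (floorlog 2 (length R)) * route_length I (root I) es"
    have "0 \<le> ?K" unfolding route_length_moves using walk_len_nonneg by simp
    have "opt min_ratio_k_forest J \<le> ?K / ?r"
      using forest_density[OF Rs es] r unfolding J_def C_def by (simp add: pos_le_divide_eq)
    then have "tree_length J T / ?q \<le> rho * (?K / ?r)"
      using T(2) rho mult_left_mono[of "opt min_ratio_k_forest J" "?K / ?r" rho]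
      by (simp add: min_ratio_k_forest_def nc)
    then have "tree_length J T \<le> rho * (?K / ?r) * ?q" using q by (simp add: pos_divide_le_eq)
    also have "\<dots> = rho * ?K * (?q / ?r)" by simp
    also have "?q / ?r \<le> harm (length R) - harm (length R')"
      using harm_diff_ge[of "length R'" "length R"] lenR' r
      by (metis add_diff_cancel_left' le_add1 of_nat_0_less_iff)
    then have "rho * ?K * (?q / ?r) \<le> rho * ?K * (harm (length R) - harm (length R'))"
      using rho \<open>0 \<le> ?K\<close> by (intro mult_left_mono) auto
    finally have "tree_length J T \<le> rho * ?K * (harm (length R) - harm (length R'))" .
    moreover have "tour_len S \<le> 2 * tree_length J T"
      using tt(5) unfolding S tree_length_def J_def by simp
    ultimately show "tour_len S \<le> 6 * rho * real (floorlog 2 (length R)) * route_length I (root I) es *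
        (harm (length R) - harm (length R'))"
      by (simp add: algebra_simps)
  qed
qed

lemma greedy_inv_init: "greedy_inv (requests (pairs I), [])"
  using distinct_requests inj_on_fst_requests by (auto simp: greedy_inv_def distinct_map)

abbreviation state :: "nat \<Rightarrow> req list \<times> service list" where
  "state j \<equiv> (step ^^ j) (requests (pairs I), [])"

text \<open>Replacing the logarithm of each round by that of \<open>npairs I\<close> gives all
  rounds the same factor, so their harmonic differences add up. The second claim records that each
  round serves a request until none is left.\<close>

lemma greedy_iterate:
  shows "greedy_inv (state j)"
    and "fst (state j) = [] \<or> j + length (fst (state j)) \<le> length (requests (pairs I))"
    and "dar_feasible I es \<Longrightarrow> (\<Sum>S\<leftarrow>snd (state j). tour_len S) \<le>
      6 * rho * real (floorlog 2 (npairs I)) * route_length I (root I) es *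
        (harm (length (requests (pairs I))) - harm (length (fst (state j))))"
proof -
  let ?K = "\<lambda>es. 6 * rho * real (floorlog 2 (npairs I)) * route_length I (root I) es"
  have "greedy_inv (state j) \<and> (fst (state j) = [] \<or> j + length (fst (state j)) \<le> length (requests (pairs I))) \<and>
    (\<forall>es. dar_feasible I es \<longrightarrow> (\<Sum>S\<leftarrow>snd (state j). tour_len S) \<le>
      ?K es * (harm (length (requests (pairs I))) - harm (length (fst (state j)))))"
  proof (induction j)
    case 0
    then show ?case using greedy_inv_init by simp
  next
    case (Suc j)
    obtain R SS where s: "state j = (R, SS)" by (metis surj_pair)
    show ?case
    proof (cases "R = []")
      case True
      then have "state (Suc j) = state j" using s by (simp add: greedy_step_def)
      then show ?thesis using Suc True s by simp
    next
      case False
      have inv: "greedy_inv (R, SS)" using Suc s by simp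
      obtain R' S where st: "step (R, SS) = (R', S # SS)" "greedy_inv (R', S # SS)" "length R' < length R"
        and len: "\<And>es. dar_feasible I es \<Longrightarrow> tour_len S \<le>
          6 * rho * real (floorlog 2 (length R)) * route_length I (root I) es * (harm (length R) - harm (length R'))"
        by (rule greedy_step_props[OF inv False]) blast
      have sS: "state (Suc j) = (R', S # SS)" using s st(1) by simp
      have "length R \<le> length (requests (pairs I))" using Suc False s by simp
      then have fl: "floorlog 2 (length R) \<le> floorlog 2 (npairs I)"
        using length_requests by (intro floorlog_mono) simp
      have "tour_len S \<le> ?K es * (harm (length R) - harm (length R'))" if es: "dar_feasible I es" for es
      proof -
        have "0 \<le> route_length I (root I) es" unfolding route_length_moves by (rule walk_len_nonneg)
        moreover have "harm (length R') \<le> (harm (length R) :: real)" using st(3) by (intro harm_mono) simp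
        ultimately have "6 * rho * real (floorlog 2 (length R)) * route_length I (root I) es * (harm (length R) - harm (length R'))
            \<le> ?K es * (harm (length R) - harm (length R'))"
          using rho fl by (intro mult_right_mono mult_left_mono) auto
        then show ?thesis using len[OF es] by simp
      qed
      moreover have "(\<Sum>S\<leftarrow>SS. tour_len S) \<le> ?K es * (harm (length (requests (pairs I))) - harm (length R))"
        if "dar_feasible I es" for es using Suc that s by auto
      ultimately have "(\<Sum>S\<leftarrow>S # SS. tour_len S) \<le> ?K es * (harm (length (requests (pairs I))) - harm (length R'))"
        if "dar_feasible I es" for es
        using that by (simp add: right_diff_distrib) (smt (verit))
      then show ?thesis using Suc st(2,3) False s unfolding sS by auto
    qed
  qed
  then show "greedy_inv (state j)" "fst (state j) = [] \<or> j + length (fst (state j)) \<le> length (requests (pairs I))"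
    "dar_feasible I es \<Longrightarrow> (\<Sum>S\<leftarrow>snd (state j). tour_len S) \<le>
      ?K es * (harm (length (requests (pairs I))) - harm (length (fst (state j))))"
    by blast+
qed

abbreviation tour :: "event list" where
  "tour \<equiv> dar orc ((dist_matrix I, pairs I, capacity I), root I)"

text \<open>The 2 belongs to the backbone, and 12 is twice 6 because each service goes around its
  tree twice.\<close>

lemma tour_props:
  shows "dar_feasible I tour"
    and "dar_feasible I es \<Longrightarrow> route_length I (root I) tour \<le>
      (2 + 12 * rho * real (floorlog 2 (npairs I))) * harm (npairs I) * route_length I (root I) es"
proof -
  define SS where "SS = snd (state (npairs I))"
  define Z where "Z = backbone (dist_matrix I) (root I) (requests (pairs I))"
  have out: "tour = schedule (root I) Z SS"
    by (simp add: dar_def fold_const SS_def Z_def npairs_def)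
  have empty: "fst (state (npairs I)) = []"
    using greedy_iterate(2)[of "npairs I"]
  proof
    assume "npairs I + length (fst (state (npairs I))) \<le> length (requests (pairs I))"
    then have "length (fst (state (npairs I))) = 0" using length_requests by linarith
    then show ?thesis by simp
  qed
  have SS: "\<And>S. S \<in> set SS \<Longrightarrow> good_service S" "distinct (ids SS)" "fst ` set (requests (pairs I)) \<subseteq> set (ids SS)"
    using greedy_iterate(1)[of "npairs I"] empty unfolding greedy_inv_def SS_def by auto
  have Z: "distinct Z" "Z \<noteq> []" "hd Z = root I" "set Z = insert (root I) (src ` set (requests (pairs I)))"
    using backbone_props[of "requests (pairs I)"] unfolding Z_def by auto
  show "dar_feasible I tour" unfolding out by (rule schedule_feasible[OF Z(1,4) SS])
  assume es: "dar_feasible I es"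
  let ?L = "route_length I (root I) es"
  let ?f = "real (floorlog 2 (npairs I))"
  have L: "0 \<le> ?L" unfolding route_length_moves by (rule walk_len_nonneg)
  have h: "harm (length (requests (pairs I))) \<le> (harm (npairs I) :: real)"
    using length_requests by (rule harm_mono)
  have "set Z \<subseteq> {..<nverts I}" unfolding Z(4) using root_vert request_props(4) by auto
  then have "route_length I (root I) tour \<le> walk_len (dst I) (Z @ [root I]) + (\<Sum>S\<leftarrow>SS. 2 * tour_len S)"
    unfolding out using Z SS(1) by (intro schedule_length) auto
  also have "walk_len (dst I) (Z @ [root I]) \<le> 2 * ?L * harm (length (requests (pairs I)))"
    unfolding Z_def using es by (intro backbone_length) auto
  also have "(\<Sum>S\<leftarrow>SS. 2 * tour_len S) = 2 * (\<Sum>S\<leftarrow>SS. tour_len S)"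
    by (simp add: sum_list_const_mult)
  also have "(\<Sum>S\<leftarrow>SS. tour_len S) \<le> 6 * rho * ?f * ?L * harm (length (requests (pairs I)))"
    using greedy_iterate(3)[OF es, of "npairs I"] empty unfolding SS_def by (simp add: harm_def)
  finally have "route_length I (root I) tour \<le> (2 + 12 * rho * ?f) * ?L * harm (length (requests (pairs I)))"
    by (simp add: algebra_simps)
  also have "\<dots> \<le> (2 + 12 * rho * ?f) * ?L * harm (npairs I)"
    using h L rho by (intro mult_left_mono mult_nonneg_nonneg add_nonneg_nonneg) auto
  finally show "route_length I (root I) tour \<le> (2 + 12 * rho * ?f) * harm (npairs I) * ?L"
    by (simp add: algebra_simps)
qed

end

section \<open>The main theorem\<close>

text \<open>The logarithm of \<open>max 2 m\<close> is at least 1 and so absorbs the additive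
  constant in \<open>harm m \<le> 1 + ln m\<close>.\<close>

lemma harm_le_log: "harm m \<le> 2 * log 2 (real (max 2 m))"
proof (cases "m = 0")
  case False
  have l: "1 \<le> log 2 (real (max 2 m))" by (simp add: le_log_iff)
  \<comment> \<open>The sequence that decreases to the Euler-Mascheroni constant starts at
    1.\<close>
  have "harm m - ln (real m) \<le> harm 1 - ln (real 1)"
    using False by (intro euler_mascheroni_sequence_decreasing) auto
  then have "harm m \<le> 1 + ln (real m)" by (simp add: harm_def)
  also have "ln (real m) \<le> log 2 (real m)"
    using False ln_2_less_1 by (simp add: log_def divide_simps mult_left_le)
  also have "log 2 (real m) \<le> log 2 (real (max 2 m))" using False by simp
  finally show ?thesis using l by linarith
qed (simp add: harm_def)

lemma floorlog_le_log: "real (floorlog 2 m) \<le> 2 * log 2 (real (max 2 m))"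
proof (cases "m = 0")
  case False
  have l: "1 \<le> log 2 (real (max 2 m))" by (simp add: le_log_iff)
  have "real (floorlog 2 m) \<le> 1 + log 2 (real m)"
    using False by (simp add: floorlog_def)
  also have "log 2 (real m) \<le> log 2 (real (max 2 m))" using False by simp
  finally show ?thesis using l by linarith
qed (simp add: floorlog_def)

text \<open>\<open>poly_time_approx\<close> uses one number as factor, exponent and summand;
  \<open>3 ^ e + e\<close> is large enough for all three roles.\<close>

lemma polynomial_bound: "1 \<le> x \<Longrightarrow> (x + 2) ^ e \<le> (3 ^ e + e) * x ^ (3 ^ e + e) + (3 ^ e + e)" for x :: nat
proof -
  assume x: "1 \<le> x"
  have "(x + 2) ^ e \<le> (3 * x) ^ e" using x by (intro power_mono) auto
  also have "\<dots> = 3 ^ e * x ^ e" by (simp add: power_mult_distrib)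
  also have "\<dots> \<le> (3 ^ e + e) * x ^ (3 ^ e + e)"
    using x by (intro mult_mono power_increasing) auto
  finally show ?thesis by simp
qed

definition inst_of :: "oracle_inst \<Rightarrow> pairs_inst" where
  "inst_of a = \<lparr>dist_matrix = fst a, pairs = fst (snd a), capacity = snd (snd a)\<rparr>"

lemma encode_event_list: "encode es = enc_list enc_event es"
  by (simp add: encode_list_def encode_event_def[symmetric])

lemma encode_inst: "encode (dist_matrix I, pairs I, capacity I) = enc_pairs_inst I"
  by (simp add: enc_pairs_inst_def encode_list_def encode_prod_def encode_rat_def encode_nat_def)
     (simp add: enc_pair_def encode_list_def encode_prod_def encode_rat_def encode_nat_def)

theorem mainTheorem4:
  shows "\<exists>C::real. C > 0 \<and>
    (\<forall>\<rho> :: nat \<Rightarrow> nat \<Rightarrow> nat \<Rightarrow> real.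
      (\<forall>n m k. 1 \<le> \<rho> n m k) \<longrightarrow>
      (\<forall>n k. mono (\<lambda>m. \<rho> n m k)) \<longrightarrow>
      (\<exists>A. poly_time_approx min_ratio_k_forest (guarantee \<rho>) A) \<longrightarrow>
      (\<exists>B. poly_time_approx dial_a_ride (guarantee (\<lambda>n m k. C * \<rho> n m k * log_sq m)) B))"
\<comment> \<open>With \<open>l\<close> the logarithm, \<open>2 + 12 * r * f\<close> and
  \<open>f \<le> 2 * l\<close> give at most \<open>26 * r * l\<close>; the harmonic factor
  contributes \<open>2 * l\<close>, and 26 times 2 is 52.\<close>
proof (intro exI[of _ "52::real"] conjI allI impI)
  fix \<rho> :: "nat \<Rightarrow> nat \<Rightarrow> nat \<Rightarrow> real"
  assume \<rho>1: "\<forall>n m k. 1 \<le> \<rho> n m k" and mono: "\<forall>n k. mono (\<lambda>m. \<rho> n m k)"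
    and "\<exists>A. poly_time_approx min_ratio_k_forest (guarantee \<rho>) A"
  then obtain A c where A: "\<And>J. valid_pairs_inst J \<Longrightarrow> \<exists>out t. computes_in A (enc_pairs_inst J) out t \<and>
      t \<le> c * vsize (enc_pairs_inst J) ^ c + c \<and>
      ((\<exists>T. ratio_forest_feasible J T) \<longrightarrow> (\<exists>T. out = enc_sol min_ratio_k_forest T \<and> ratio_forest_feasible J T \<and>
        cost min_ratio_k_forest J T \<le> guarantee \<rho> J * opt min_ratio_k_forest J))"
    unfolding poly_time_approx_def by (auto simp: min_ratio_k_forest_def)
  \<comment> \<open>The instances on which the output of \<open>A\<close> is constrained; elsewhere
    \<open>A\<close> halts, but its output need not encode a tree.\<close>
  define D where "D = {a. valid_pairs_inst (inst_of a) \<and> (\<exists>T. ratio_forest_feasible (inst_of a) T)}"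
  have "\<exists>T t. computes_in A (encode a) (encode T) t \<and> t \<le> c * sz a ^ c + c \<and>
      ratio_forest_feasible (inst_of a) T \<and>
      cost min_ratio_k_forest (inst_of a) T \<le> guarantee \<rho> (inst_of a) * opt min_ratio_k_forest (inst_of a)"
    if "a \<in> D" for a
  proof -
    have "enc_pairs_inst (inst_of a) = encode a"
      using encode_inst[of "inst_of a"] by (simp add: inst_of_def)
    moreover have "enc_sol min_ratio_k_forest T = encode T" for T
      by (simp add: min_ratio_k_forest_def encode_prod_def encode_list_def encode_nat_def)
    ultimately show ?thesis using A[of "inst_of a"] that unfolding D_def sz_def by fastforce
  qed
  then obtain orc where orc: "\<And>a. a \<in> D \<Longrightarrow> \<exists>t. computes_in A (encode a) (encode (orc a)) t \<and> t \<le> c * sz a ^ c + c"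
    "\<And>a. a \<in> D \<Longrightarrow> ratio_forest_feasible (inst_of a) (orc a)"
    "\<And>a. a \<in> D \<Longrightarrow> cost min_ratio_k_forest (inst_of a) (orc a) \<le> guarantee \<rho> (inst_of a) * opt min_ratio_k_forest (inst_of a)"
    by metis
  have "polyb (\<lambda>n. c * n ^ c + c)" by (intro polyb_basic)
  then have PT_orc: "PT_on D orc" using orc(1) by (rule PT_onI)
  have in_D: "(dist_matrix I, map snd (cap (capacity I) R), capacity I) \<in> D"
    and inst: "inst_of (dist_matrix I, map snd (cap (capacity I) R), capacity I) = dar_setup.sub_inst I (cap (capacity I) R)"
    if I: "valid_dar_inst I" and R: "set R \<subseteq> set (requests (pairs I))" "distinct R" "R \<noteq> []" for I R
  proof -
    interpret dar_setup I by (unfold_locales) (rule I)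
    show inst: "inst_of (dist_matrix I, map snd (cap (capacity I) R), capacity I) = sub_inst (cap (capacity I) R)"
      by (simp add: inst_of_def sub_inst_def)
    have "set (cap (capacity I) R) \<subseteq> set (requests (pairs I))" using cap_props(1) R(1) by blast
    then have "valid_pairs_inst (sub_inst (cap (capacity I) R))" by (rule sub_inst_valid)
    then show "(dist_matrix I, map snd (cap (capacity I) R), capacity I) \<in> D"
      using forest_feasible_ex[OF R] unfolding D_def mem_Collect_eq inst by (rule conjI)
  qed
  have greedy: "greedy_setup I orc (\<rho> (nverts I) (npairs I) (capacity I))" if I: "valid_dar_inst I" for I
  proof -
    interpret dar_setup I by (unfold_locales) (rule I)
    show ?thesis
    proof unfold_locales
      fix R assume R: "set R \<subseteq> set (requests (pairs I))" "distinct R" "R \<noteq> []"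
      let ?J = "sub_inst (cap (capacity I) R)"
      let ?a = "(dist_matrix I, map snd (cap (capacity I) R), capacity I)"
      have a: "?a \<in> D" "inst_of ?a = ?J" using in_D[OF I R] inst[OF I R] .
      have "length (cap (capacity I) R) \<le> npairs I"
      proof -
        have "length (cap (capacity I) R) = card (set (cap (capacity I) R))"
          using cap_props(2)[OF R(2)] by (simp add: distinct_card)
        also have "\<dots> \<le> card (set (requests (pairs I)))"
          using cap_props(1) R(1) by (intro card_mono) blast+
        also have "\<dots> \<le> npairs I" using card_length length_requests order_trans by blast
        finally show ?thesis .
      qed
      \<comment> \<open>Queries keep the vertices and the capacity and have at most
        \<open>npairs I\<close> pairs, so monotonicity in \<open>m\<close> bounds all their
        guarantees by one number.\<close>
      then have "guarantee \<rho> ?J \<le> \<rho> (nverts I) (npairs I) (capacity I)"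
        using mono unfolding guarantee_def by (auto dest: monoD)
      moreover have "0 \<le> opt min_ratio_k_forest ?J"
        unfolding opt_def using forest_feasible_ex[OF R] opt_ratio_nonneg
        by (intro cInf_greatest) (auto simp: min_ratio_k_forest_def)
      ultimately have "guarantee \<rho> ?J * opt min_ratio_k_forest ?J
          \<le> \<rho> (nverts I) (npairs I) (capacity I) * opt min_ratio_k_forest ?J"
        by (rule mult_right_mono)
      then show "ratio_forest_feasible ?J (orc ?a) \<and>
          cost min_ratio_k_forest ?J (orc ?a) \<le> \<rho> (nverts I) (npairs I) (capacity I) * opt min_ratio_k_forest ?J"
        using orc(2,3)[OF a(1)] unfolding a(2) by simp
    qed (use \<rho>1 in auto)
  qed
  define E where "E = {((dist_matrix I, pairs I, capacity I), root I) | I. valid_dar_inst I}"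
  have "PT_on E (dar orc)"
  proof (rule PT_dar[OF PT_orc])
    fix M ps k r j R SS
    assume "((M, ps, k), r) \<in> E" and st: "(greedy_step orc M k ^^ j) (requests ps, []) = (R, SS)" and "R \<noteq> []"
    then obtain I where I: "valid_dar_inst I" "M = dist_matrix I" "ps = pairs I" "k = capacity I"
      unfolding E_def by blast
    interpret greedy_setup I orc "\<rho> (nverts I) (npairs I) (capacity I)" by (rule greedy[OF I(1)])
    \<comment> \<open>The running time argument borrows the correctness invariant here, to show that
      every query lies in \<open>D\<close>.\<close>
    have "greedy_inv (R, SS)" using greedy_iterate(1)[of j] st unfolding I by simp
    then show "(M, map snd (cap k R), k) \<in> D"
      using in_D[OF I(1)] \<open>R \<noteq> []\<close> unfolding I greedy_inv_def by simp
  qed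
  then obtain B e where B: "\<And>a. a \<in> E \<Longrightarrow> \<exists>t. computes_in B (encode a) (encode (dar orc a)) t \<and> t \<le> (sz a + 2) ^ e"
    unfolding PT_on_def by blast
  have "poly_time_approx dial_a_ride (guarantee (\<lambda>n m k. 52 * \<rho> n m k * log_sq m)) B"
    unfolding poly_time_approx_def
  proof (intro exI[of _ "3 ^ e + e"] allI impI)
    fix I assume "is_instance dial_a_ride I"
    then have I: "valid_dar_inst I" by (simp add: dial_a_ride_def)
    interpret greedy_setup I orc "\<rho> (nverts I) (npairs I) (capacity I)" by (rule greedy[OF I])
    let ?a = "((dist_matrix I, pairs I, capacity I), root I)"
    have enc: "encode ?a = enc_inst dial_a_ride I"
      using encode_inst[of I] by (simp add: dial_a_ride_def encode_nat_def)
    have "?a \<in> E" using I unfolding E_def by blast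
    then obtain t where t: "computes_in B (encode ?a) (encode tour) t" "t \<le> (sz ?a + 2) ^ e"
      using B by blast
    have "t \<le> (3 ^ e + e) * vsize (enc_inst dial_a_ride I) ^ (3 ^ e + e) + (3 ^ e + e)"
      using t(2) polynomial_bound[of "sz ?a" e] sz_pos[of ?a] unfolding sz_def enc by simp
    moreover have "encode tour = enc_sol dial_a_ride tour"
      by (simp add: dial_a_ride_def encode_event_list)
    moreover have feas: "feasible dial_a_ride I tour" using tour_props(1) by (simp add: dial_a_ride_def)
    moreover have "cost dial_a_ride I tour
        \<le> guarantee (\<lambda>n m k. 52 * \<rho> n m k * log_sq m) I * opt dial_a_ride I"
    proof -
      define r l where "r = \<rho> (nverts I) (npairs I) (capacity I)" and "l = log 2 (real (max 2 (npairs I)))"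
      let ?f = "real (floorlog 2 (npairs I))" and ?K = "52 * r * l\<^sup>2"
      have l: "1 \<le> l" by (simp add: l_def le_log_iff)
      have r: "1 \<le> r" using \<rho>1 by (simp add: r_def)
      have K: "0 < ?K" using l r by simp
      have bound: "(2 + 12 * r * ?f) * harm (npairs I) \<le> ?K"
      proof -
        have "2 \<le> 2 * r * l" using mult_mono[of 1 r 1 l] l r by simp
        moreover have "12 * r * ?f \<le> 12 * r * (2 * l)"
          using r floorlog_le_log[of "npairs I"] by (intro mult_left_mono) (auto simp: l_def)
        ultimately have "2 + 12 * r * ?f \<le> 26 * r * l" by (simp add: algebra_simps)
        then have "(2 + 12 * r * ?f) * harm (npairs I) \<le> (26 * r * l) * (2 * l)"
          using r l harm_le_log[of "npairs I"] harm_nonneg by (intro mult_mono) (auto simp: l_def)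
        then show ?thesis by (simp add: power2_eq_square)
      qed
      have "cost dial_a_ride I tour \<le> ?K * route_length I (root I) es" if "dar_feasible I es" for es
      proof -
        have "0 \<le> route_length I (root I) es" unfolding route_length_moves by (rule walk_len_nonneg)
        then show ?thesis
          using tour_props(2)[OF that] mult_right_mono[OF bound, of "route_length I (root I) es"]
          by (simp add: dial_a_ride_def r_def)
      qed
      \<comment> \<open>After division by the positive \<open>?K\<close> the bound against every
        feasible tour becomes a lower bound of all costs, hence of their infimum.\<close>
      then have "cost dial_a_ride I tour / ?K \<le> opt dial_a_ride I"
        unfolding opt_def using feas K
        by (intro cInf_greatest) (auto simp: dial_a_ride_def pos_divide_le_eq mult.commute)
      then have "cost dial_a_ride I tour \<le> ?K * opt dial_a_ride I"
        using K by (simp only: pos_divide_le_eq mult.commute)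
      then show ?thesis by (simp add: guarantee_def log_sq_def r_def l_def)
    qed
    ultimately show "\<exists>out t. computes_in B (enc_inst dial_a_ride I) out t \<and>
        t \<le> (3 ^ e + e) * vsize (enc_inst dial_a_ride I) ^ (3 ^ e + e) + (3 ^ e + e) \<and>
        ((\<exists>S. feasible dial_a_ride I S) \<longrightarrow>
          (\<exists>S. out = enc_sol dial_a_ride S \<and> feasible dial_a_ride I S \<and>
            cost dial_a_ride I S \<le> guarantee (\<lambda>n m k. 52 * \<rho> n m k * log_sq m) I * opt dial_a_ride I))"
      using t(1) unfolding enc
      by (intro exI[of _ "encode tour"] exI[of _ t] exI[of _ tour] conjI impI)
  qed
  then show "\<exists>B. poly_time_approx dial_a_ride (guarantee (\<lambda>n m k. 52 * \<rho> n m k * log_sq m)) B" ..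
qed simp

end
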